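(* Let $\kappa,\lambda$ be infinite cardinals. If $\lambda\leq\kappa$ and $\kappa^{\aleph_0}=\kappa$, then there exist $2^\kappa$ incomparable, linearly ordered continua $X$ such that $\hat w(X)=w(X)=\kappa$ and $|X|=\lambda^{\nu(\lambda,\kappa)}$.
   Context: $w(X)$ denotes the weight of a space $X$, and $\hat w(X)$ is the smallest possible weight of a nonempty open subspace of $X$. For infinite cardinals $\lambda\leq\kappa$, $\nu(\lambda,\kappa)$ denotes the smallest infinite cardinal $\mu$ such that $\lambda^\mu>\kappa$. A linearly ordered space is a topological space whose topology is the order topology of some linear ordering of its point set. A continuum is a compact connected Hausdorff space with more than one point. A linearly ordered continuum is a linearly ordered space that is a continuum. Spaces $X_i$ $(i\in I)$ are called incomparable if $X_i$ is not homeomorphic to a subspace of $X_j$ whenever $i,j\in I$ and $i\neq j$. *)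

theory Defs
  imports "HOL-Analysis.Analysis"
begin

unbundle cardinal_syntax

text \<open>
  Cardinals are represented by cardinal orders, as in the library: \<open>=o\<close>, \<open>\<le>o\<close> and \<open><o\<close> compare
  them, and \<open>^c\<close> is exponentiation. A smallest element of a class of cardinals is determined
  only up to \<open>=o\<close>, so the functions below pick a representative, and equations between cardinals
  are stated with \<open>=o\<close>. The choice is meaningful only for a nonempty set of cardinal orders.
\<close>

definition least_card :: "'a rel set \<Rightarrow> 'a rel" where
  "least_card R = (SOME r. r \<in> R \<and> (\<forall>s\<in>R. r \<le>o s))"

lemma least_card:
  assumes "R \<noteq> {}" "\<And>r. r \<in> R \<Longrightarrow> Card_order r"
  shows least_card_in: "least_card R \<in> R"
    and least_card_le: "\<And>s. s \<in> R \<Longrightarrow> least_card R \<le>o s"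
proof -
  have "\<exists>r. r \<in> R \<and> (\<forall>s\<in>R. r \<le>o s)"
    using exists_minim_Card_order[of R] assms by blast
  from someI_ex[OF this] show "least_card R \<in> R" "\<And>s. s \<in> R \<Longrightarrow> least_card R \<le>o s"
    unfolding least_card_def by blast+
qed

text \<open>
  The candidates range over cardinal orders on the type of \<open>\<kappa>\<close>. This is no restriction if
  \<open>2 \<le> lam\<close> and \<open>\<kappa>\<close> is infinite: then \<open>\<kappa> < lam\<^sup>\<kappa>\<close>, so the smallest \<open>\<mu>\<close> is at most \<open>\<kappa>\<close>.
\<close>

definition nu :: "'b rel \<Rightarrow> 'a rel \<Rightarrow> 'a rel" where
  "nu lam \<kappa> = least_card {\<mu>. Cinfinite \<mu> \<and> \<kappa> <o lam ^c \<mu>}"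

lemma nu_candidate:
  assumes "Cinfinite lam" "Cinfinite \<kappa>"
  shows "\<kappa> <o lam ^c \<kappa>"
proof -
  have "ctwo \<le>o lam"
    using assms(1) by (intro ctwo_ordLeq_Cinfinite)
  then have "ctwo ^c \<kappa> \<le>o lam ^c \<kappa>"
    using assms(2) by (intro cexp_mono1) auto
  then show ?thesis
    using ordLess_ctwo_cexp assms(2) ordLess_ordLeq_trans by blast
qed

definition base_of :: "'a topology \<Rightarrow> 'a set set \<Rightarrow> bool" where
  "base_of X \<B> \<longleftrightarrow>
     (\<forall>V\<in>\<B>. openin X V) \<and>
     (\<forall>U x. openin X U \<and> x \<in> U \<longrightarrow> (\<exists>V\<in>\<B>. x \<in> V \<and> V \<subseteq> U))"

definition weight :: "'a topology \<Rightarrow> 'a set rel" where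
  "weight X = least_card {|\<B>| |\<B>. base_of X \<B>}"

definition min_open_weight :: "'a topology \<Rightarrow> 'a set rel" where
  "min_open_weight X = least_card {weight (subtopology X U) | U. openin X U \<and> U \<noteq> {}}"

lemma base_of_all_open: "base_of X {U. openin X U}"
  by (auto simp: base_of_def)

lemma Card_order_weight: "Card_order (weight X)"
proof -
  have "weight X \<in> {|\<B>| |\<B>. base_of X \<B>}"
    unfolding weight_def by (rule least_card_in) (auto intro: base_of_all_open simp: card_of_Card_order)
  then show ?thesis by (auto simp: card_of_Card_order)
qed

definition order_topology_on :: "'a set \<Rightarrow> 'a rel \<Rightarrow> 'a topology" where
  "order_topology_on A r =
     topology_generated_by
       (insert A ({{x \<in> A. x \<noteq> a \<and> (x, a) \<in> r} | a. a \<in> A} \<union>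
                  {{x \<in> A. x \<noteq> a \<and> (a, x) \<in> r} | a. a \<in> A}))"

lemma topspace_order_topology_on [simp]: "topspace (order_topology_on A r) = A"
  by (auto simp: order_topology_on_def)

definition linearly_ordered_space :: "'a topology \<Rightarrow> bool" where
  "linearly_ordered_space X \<longleftrightarrow>
     (\<exists>r. linear_order_on (topspace X) r \<and> X = order_topology_on (topspace X) r)"

definition continuum :: "'a topology \<Rightarrow> bool" where
  "continuum X \<longleftrightarrow>
     compact_space X \<and> connected_space X \<and> Hausdorff_space X \<and>
     (\<exists>x\<in>topspace X. \<exists>y\<in>topspace X. x \<noteq> y)"

definition incomparable :: "'i set \<Rightarrow> ('i \<Rightarrow> 'a topology) \<Rightarrow> bool" where
  "incomparable I X \<longleftrightarrow>
     (\<forall>i\<in>I. \<forall>j\<in>I. i \<noteq> j \<longrightarrow>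
        \<not> (\<exists>S \<subseteq> topspace (X j). X i homeomorphic_space subtopology (X j) S))"

end

theory Submission
  imports Defs
begin

text \<open>
  A continuous injection between linearly ordered continua preserves betweenness, so it is monotone,
  and its image is convex. It therefore suffices to construct \<open>2\<^sup>\<kappa>\<close> complete dense linear orders, of
  the required weight and cardinality, none of which is isomorphic or anti-isomorphic to a convex
  subset of another. They are the Dedekind completions of lexicographic products \<open>C \<times> Q\<close>: the
  order \<open>Q\<close> supplies weight and cardinality, and \<open>C\<close>, which has countably many elements for each
  ordinal below \<open>\<kappa>\<close>, codes a set \<open>S\<close> of ordinals. Points of the completion are cuts, a chain of sets
  ordered by inclusion and closed under unions.

  Let \<open>\<nu>\<close> be the smallest infinite cardinal with \<open>\<lambda>\<^sup>\<nu> > \<kappa>\<close>. Its cofinality is uncountable, for otherwise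
  \<open>\<lambda>\<^sup>\<nu>\<close> would be at most \<open>\<kappa>\<^sup>\<omega> = \<kappa>\<close> (\<open>nu_uncountable_cofinality\<close>). Well-order a set \<open>E\<close> of size \<open>\<kappa>\<close> with a
  greatest element, and let \<open>L\<close> be a subset of size \<open>\<lambda>\<close>. Then \<open>Q\<close> consists of the functions from \<open>\<nu>\<close> to
  \<open>E\<close> that are eventually constant with a fixed default value and take values outside \<open>L\<close> at only
  countably many arguments. By the minimality of \<open>\<nu>\<close> and \<open>\<kappa>\<^sup>\<omega> = \<kappa>\<close>, it has at most \<open>\<kappa>\<close> elements
  (\<open>card_Q_le\<close>). Every interval contains \<open>\<kappa>\<close> disjoint intervals (\<open>disjoint_cones\<close>), and so all nonempty
  open subspaces of the completion have weight \<open>\<kappa>\<close>. Each cut has a cofinal set below or a coinitial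
  set above of size at most \<open>\<nu>\<close> (\<open>short_side\<close>), which gives at most \<open>\<kappa>\<^sup>\<nu> = \<lambda>\<^sup>\<nu>\<close> cuts; conversely, the
  functions from \<open>\<nu>\<close> to \<open>L\<close> give \<open>\<lambda>\<^sup>\<nu>\<close> different cuts.

  For the coding, call a point a marker if it is a limit of countably many points from the left, and
  also from the right. The key property of \<open>Q\<close> is that none of its cuts is countable on both sides
  (\<open>not_both_sides_countable\<close>). So the markers of the completion come from the gaps of \<open>C\<close>, which can
  be placed at will. They are arranged such that their left limits form a copy of the
  ordinals below \<open>\<kappa>\<close>, that the least point is their only right limit, and that the right character of
  the limit with index \<open>i\<close> is countable if and only if \<open>i\<close> is in \<open>S\<close>. An increasing embedding
  preserves all this: it fixes the least point, hence all left limits of markers by induction, and so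
  the coded sets agree (\<open>coded_chain_embeds_imp_eq\<close>). A decreasing embedding would produce too many
  right limits (\<open>coded_chain_not_embeds_decreasing\<close>).
\<close>

section \<open>Chains closed under suprema as linearly ordered continua\<close>

definition order_rel :: "'a::order set \<Rightarrow> 'a rel" where
  "order_rel X = {(x, y). x \<in> X \<and> y \<in> X \<and> x \<le> y}"

abbreviation chain_topology :: "'a::order set \<Rightarrow> 'a topology" where
  "chain_topology X \<equiv> order_topology_on X (order_rel X)"

text \<open>
  A complete dense linear order, presented inside a complete lattice. Dedekind cuts form such a
  chain in the lattice of sets: inclusion orders them, and their unions are again cuts.
\<close>

locale dense_chain =
  fixes X :: "'a::complete_lattice set"
  assumes chain: "\<And>x y. x \<in> X \<Longrightarrow> y \<in> X \<Longrightarrow> x \<le> y \<or> y \<le> x"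
    and Sup_closed: "\<And>F. F \<subseteq> X \<Longrightarrow> Sup F \<in> X"
    and dense: "\<And>x y. x \<in> X \<Longrightarrow> y \<in> X \<Longrightarrow> x < y \<Longrightarrow> \<exists>z\<in>X. x < z \<and> z < y"
    and nontrivial: "Sup X \<noteq> bot"
begin

lemma bot_in: "bot \<in> X" and top_in: "Sup X \<in> X"
  using Sup_closed[of "{}"] Sup_closed[of X] by auto

lemma top_greatest: "x \<in> X \<Longrightarrow> x \<le> Sup X" by (rule Sup_upper)

lemma not_le: "x \<in> X \<Longrightarrow> y \<in> X \<Longrightarrow> \<not> x \<le> y \<longleftrightarrow> y < x"
  using chain by fastforce

lemma not_less: "x \<in> X \<Longrightarrow> y \<in> X \<Longrightarrow> \<not> x < y \<longleftrightarrow> y \<le> x"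
  using chain by fastforce

text \<open>
  Real induction for chains. If the property passes to a point from all smaller points, and from
  an initial segment to a right neighbourhood, then the supremum of the initial segment on which
  it holds must be the greatest point. Compactness and connectedness both reduce to it.
\<close>

lemma chain_induct [consumes 1, case_names limit step]:
  assumes "x \<in> X"
    and limit: "\<And>x. x \<in> X \<Longrightarrow> (\<And>y. y \<in> X \<Longrightarrow> y < x \<Longrightarrow> Q y) \<Longrightarrow> Q x"
    and step: "\<And>x. x \<in> X \<Longrightarrow> x \<noteq> Sup X \<Longrightarrow> (\<And>y. y \<in> X \<Longrightarrow> y \<le> x \<Longrightarrow> Q y) \<Longrightarrow>
                 \<exists>b\<in>X. x < b \<and> (\<forall>y\<in>X. x < y \<and> y < b \<longrightarrow> Q y)"
  shows "Q x"
proof -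
  define F where "F = {x\<in>X. \<forall>y\<in>X. y \<le> x \<longrightarrow> Q y}"
  have sX: "Sup F \<in> X" by (rule Sup_closed) (auto simp: F_def)
  have below: "Q y" if y: "y \<in> X" "y < Sup F" for y
  proof -
    have "\<exists>z\<in>F. \<not> z \<le> y" using y by (meson Sup_least leD)
    then obtain z where z: "z \<in> F" "\<not> z \<le> y" by blast
    then have "y \<le> z" using chain y by (auto simp: F_def)
    then show ?thesis using z y by (auto simp: F_def)
  qed
  have s: "\<forall>y\<in>X. y \<le> Sup F \<longrightarrow> Q y"
    using below limit[OF sX] by (metis order_le_less)
  have "Sup F = Sup X"
  proof (rule ccontr)
    assume "Sup F \<noteq> Sup X"
    have "\<exists>b\<in>X. Sup F < b \<and> (\<forall>y\<in>X. Sup F < y \<and> y < b \<longrightarrow> Q y)"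
      by (rule step[OF sX \<open>Sup F \<noteq> Sup X\<close>]) (use s in blast)
    then obtain b where b: "b \<in> X" "Sup F < b" "\<forall>y\<in>X. Sup F < y \<and> y < b \<longrightarrow> Q y" by blast
    then obtain z where z: "z \<in> X" "Sup F < z" "z < b" using dense sX by blast
    have "z \<in> F" unfolding F_def
    proof (intro CollectI conjI ballI impI z)
      fix y assume y: "y \<in> X" "y \<le> z"
      show "Q y"
      proof (cases "y \<le> Sup F")
        case False
        then have "Sup F < y" "y < b" using not_le sX y z by auto
        then show ?thesis using b y by blast
      qed (use s y in blast)
    qed
    then have "z \<le> Sup F" by (rule Sup_upper)
    then show False using z by simp
  qed
  then show ?thesis using s assms(1) top_greatest by auto
qed

lemma lower_open: "a \<in> X \<Longrightarrow> openin (chain_topology X) {x\<in>X. x < a}"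
  and upper_open: "a \<in> X \<Longrightarrow> openin (chain_topology X) {x\<in>X. a < x}"
proof -
  assume a: "a \<in> X"
  have "{x\<in>X. x < a} = {x\<in>X. x \<noteq> a \<and> (x, a) \<in> order_rel X}"
       "{x\<in>X. a < x} = {x\<in>X. x \<noteq> a \<and> (a, x) \<in> order_rel X}"
    using a by (auto simp: order_rel_def)
  then show "openin (chain_topology X) {x\<in>X. x < a}"
            "openin (chain_topology X) {x\<in>X. a < x}"
    using a unfolding order_topology_on_def by (auto intro!: topology_generated_by_Basis)
qed

text \<open>
  Open sets contain half-open intervals on both sides of each of their points. The two sides are
  kept apart, since an endpoint of the chain has only one of them.
\<close>

lemma nbhd_interval:
  assumes "openin (chain_topology X) U" "x \<in> U"
  shows "(x \<noteq> bot \<longrightarrow> (\<exists>a\<in>X. a < x \<and> (\<forall>y\<in>X. a < y \<and> y \<le> x \<longrightarrow> y \<in> U))) \<and>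
         (x \<noteq> Sup X \<longrightarrow> (\<exists>b\<in>X. x < b \<and> (\<forall>y\<in>X. x \<le> y \<and> y < b \<longrightarrow> y \<in> U)))"
proof -
  have "generate_topology_on (insert X ({{x \<in> X. x \<noteq> a \<and> (x, a) \<in> order_rel X} | a. a \<in> X} \<union>
                  {{x \<in> X. x \<noteq> a \<and> (a, x) \<in> order_rel X} | a. a \<in> X})) U"
    using assms(1) unfolding order_topology_on_def openin_topology_generated_by_iff .
  then show ?thesis using assms(2)
  proof (induction)
    case Empty then show ?case by simp
  next
    case (Int U V)
    then have x: "x \<in> U" "x \<in> V" by auto
    note U = Int.IH(1)[OF x(1)] and V = Int.IH(2)[OF x(2)]
    show ?case
    proof (intro conjI impI)
      assume x0: "x \<noteq> bot"
      obtain a b where ab: "a\<in>X" "a < x" "\<forall>y\<in>X. a < y \<and> y \<le> x \<longrightarrow> y \<in> U"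
        "b\<in>X" "b < x" "\<forall>y\<in>X. b < y \<and> y \<le> x \<longrightarrow> y \<in> V"
        using U V x0 by blast
      show "\<exists>a\<in>X. a < x \<and> (\<forall>y\<in>X. a < y \<and> y \<le> x \<longrightarrow> y \<in> U \<inter> V)"
        using chain[OF ab(1) ab(4)]
      proof
        assume "a \<le> b" then show ?thesis using ab by (intro bexI[of _ b]) auto
      next
        assume "b \<le> a" then show ?thesis using ab by (intro bexI[of _ a]) auto
      qed
    next
      assume x1: "x \<noteq> Sup X"
      obtain a b where ab: "a\<in>X" "x < a" "\<forall>y\<in>X. x \<le> y \<and> y < a \<longrightarrow> y \<in> U"
        "b\<in>X" "x < b" "\<forall>y\<in>X. x \<le> y \<and> y < b \<longrightarrow> y \<in> V"
        using U V x1 by blast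
      show "\<exists>b\<in>X. x < b \<and> (\<forall>y\<in>X. x \<le> y \<and> y < b \<longrightarrow> y \<in> U \<inter> V)"
        using chain[OF ab(1) ab(4)]
      proof
        assume "a \<le> b" then show ?thesis using ab by (intro bexI[of _ a]) auto
      next
        assume "b \<le> a" then show ?thesis using ab by (intro bexI[of _ b]) auto
      qed
    qed
  next
    case (UN K)
    then obtain k where k: "k \<in> K" "x \<in> k" by auto
    show ?case using UN.IH[OF k] k(1) by (meson UnionI)
  next
    case (Basis s)
    from Basis(1) consider "s = X" | a where "a \<in> X" "s = {x \<in> X. x \<noteq> a \<and> (x, a) \<in> order_rel X}"
      | a where "a \<in> X" "s = {x \<in> X. x \<noteq> a \<and> (a, x) \<in> order_rel X}" by blast
    then show ?case
    proof cases
      case 1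
      then have "x \<in> X" using Basis(2) by simp
      then have "x \<noteq> bot \<Longrightarrow> bot < x" "x \<noteq> Sup X \<Longrightarrow> x < Sup X"
        using top_greatest[of x] bot.not_eq_extremum[of x] by (auto simp: less_le)
      then show ?thesis using 1 bot_in top_in by blast
    next
      case 2
      then have x: "x \<in> X" "x < a" using Basis(2) by (auto simp: order_rel_def)
      moreover have "y \<in> s" if "y \<in> X" "y < a" for y
        using that 2 by (auto simp: order_rel_def)
      moreover have "x \<noteq> bot \<Longrightarrow> bot < x" using bot.not_eq_extremum[of x] by blast
      ultimately show ?thesis using 2 bot_in by (meson order_le_less_trans)
    next
      case 3
      then have "x \<in> X" "a < x" using Basis(2) by (auto simp: order_rel_def)
      moreover have "y \<in> s" if "y \<in> X" "a < y" for y
        using that 3 by (auto simp: order_rel_def)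
      moreover have "x \<noteq> Sup X \<Longrightarrow> x < Sup X" using calculation(1) top_greatest[of x] by (simp add: less_le)
      ultimately show ?thesis using 3 top_in by (meson order_less_le_trans)
    qed
  qed
qed

lemma nbhd_below:
  assumes "openin (chain_topology X) U" "x \<in> U" "x \<noteq> bot"
  obtains a where "a \<in> X" "a < x" "\<And>y. y \<in> X \<Longrightarrow> a < y \<Longrightarrow> y \<le> x \<Longrightarrow> y \<in> U"
  using nbhd_interval[OF assms(1,2)] assms(3) by blast

lemma nbhd_above:
  assumes "openin (chain_topology X) U" "x \<in> U" "x \<noteq> Sup X"
  obtains b where "b \<in> X" "x < b" "\<And>y. y \<in> X \<Longrightarrow> x \<le> y \<Longrightarrow> y < b \<Longrightarrow> y \<in> U"
  using nbhd_interval[OF assms(1,2)] assms(3) by blast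

lemma compact: "compact_space (chain_topology X)"
  unfolding compact_space_alt
proof (intro allI impI, goal_cases)
  case (1 \<U>)
  then have op: "\<And>U. U \<in> \<U> \<Longrightarrow> openin (chain_topology X) U" and cov: "X \<subseteq> \<Union>\<U>" by auto
  have "\<exists>\<F>. finite \<F> \<and> \<F> \<subseteq> \<U> \<and> {y\<in>X. y \<le> x} \<subseteq> \<Union>\<F>" if "x \<in> X" for x
    using that
  proof (induction rule: chain_induct)
    case (limit x)
    obtain U where U: "U \<in> \<U>" "x \<in> U" using limit(1) cov by blast
    show ?case
    proof (cases "x = bot")
      case True
      then show ?thesis using U by (intro exI[of _ "{U}"]) (auto simp: bot_unique)
    next
      case False
      then obtain a where a: "a \<in> X" "a < x" "\<And>y. y \<in> X \<Longrightarrow> a < y \<Longrightarrow> y \<le> x \<Longrightarrow> y \<in> U"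
        using nbhd_below[OF op[OF U(1)] U(2)] by metis
      obtain \<F> where \<F>: "finite \<F>" "\<F> \<subseteq> \<U>" "{y\<in>X. y \<le> a} \<subseteq> \<Union>\<F>" using limit(2)[OF a(1,2)] by blast
      have "{y\<in>X. y \<le> x} \<subseteq> \<Union>(insert U \<F>)"
      proof
        fix y assume "y \<in> {y\<in>X. y \<le> x}"
        then show "y \<in> \<Union>(insert U \<F>)"
          using a \<F>(3) not_le[of y a] by (cases "y \<le> a") auto
      qed
      then show ?thesis using \<F> U by (intro exI[of _ "insert U \<F>"]) auto
    qed
  next
    case (step x)
    obtain U where U: "U \<in> \<U>" "x \<in> U" using step(1) cov by blast
    obtain b where b: "b \<in> X" "x < b" "\<And>y. y \<in> X \<Longrightarrow> x \<le> y \<Longrightarrow> y < b \<Longrightarrow> y \<in> U"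
      using nbhd_above[OF op[OF U(1)] U(2) step(2)] by metis
    obtain \<F> where \<F>: "finite \<F>" "\<F> \<subseteq> \<U>" "{y\<in>X. y \<le> x} \<subseteq> \<Union>\<F>"
      using step(3)[OF step(1)] by blast
    have "{z\<in>X. z \<le> y} \<subseteq> \<Union>(insert U \<F>)" if "y \<in> X" "y < b" for y
    proof
      fix z assume z: "z \<in> {z\<in>X. z \<le> y}"
      show "z \<in> \<Union>(insert U \<F>)"
      proof (cases "z \<le> x")
        case True then show ?thesis using \<F>(3) z by auto
      next
        case False
        then have "x \<le> z" "z < b" using not_le[of z x] step(1) z that by auto
        then show ?thesis using b(3)[of z] z by auto
      qed
    qed
    then show ?case using b \<F> U
      by (intro bexI[of _ b] conjI ballI impI exI[of _ "insert U \<F>"]) auto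
  qed
  from this[OF top_in] obtain \<F> where "finite \<F>" "\<F> \<subseteq> \<U>" "{y\<in>X. y \<le> Sup X} \<subseteq> \<Union>\<F>" by blast
  moreover have "{y\<in>X. y \<le> Sup X} = X" using top_greatest by auto
  ultimately show ?case by auto
qed

lemma interval_connected: "connectedin (chain_topology X) {x\<in>X. c \<le> x \<and> x \<le> d}"
proof -
  let ?I = "{x\<in>X. c \<le> x \<and> x \<le> d}"
  have key: False
    if E: "openin (chain_topology X) E1" "openin (chain_topology X) E2"
      "?I \<subseteq> E1 \<union> E2" "E1 \<inter> E2 \<inter> ?I = {}"
      and p: "p \<in> ?I" "p \<in> E1" and q: "q \<in> ?I" "q \<in> E2" and pq: "p \<le> q" for p q E1 E2
  proof -
    have I: "x \<in> ?I" if "x \<in> X" "p \<le> x" "x \<le> q" for x using that p q by auto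
    have "p \<le> x \<and> x \<le> q \<longrightarrow> x \<in> E1" if "x \<in> X" for x
      using that
    proof (induction rule: chain_induct)
      case (limit x)
      show ?case
      proof (intro impI, rule ccontr)
        assume x: "p \<le> x \<and> x \<le> q" "x \<notin> E1"
        then have x2: "x \<in> E2" "p < x" using E(3) p I[OF limit(1)] by (auto simp: less_le)
        then have "x \<noteq> bot" by auto
        obtain a where a: "a \<in> X" "a < x" "\<And>y. y \<in> X \<Longrightarrow> a < y \<Longrightarrow> y \<le> x \<Longrightarrow> y \<in> E2"
          using nbhd_below[OF E(2) x2(1) \<open>x \<noteq> bot\<close>] by metis
        obtain m where m: "m \<in> X" "a \<le> m" "p \<le> m" "m < x"
          using chain[of a p] a x2 p by auto
        obtain z where z: "z \<in> X" "m < z" "z < x" using dense m limit(1) by blast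
        have "z \<in> E1" using limit(2)[of z] z m x by auto
        moreover have "z \<in> E2" using a(3)[of z] z m by auto
        moreover have "z \<in> ?I" using I[of z] z m x by auto
        ultimately show False using E(4) by blast
      qed
    next
      case (step x)
      consider "x < p" | "p \<le> x" "x \<le> q" "x \<noteq> q" | "q \<le> x"
        using chain[of x p] chain[of x q] p q step(1) by fastforce
      then show ?case
      proof cases
        case 1 then show ?thesis using p by (intro bexI[of _ p]) auto
      next
        case 2
        then have "x \<in> E1" using step(3)[OF step(1)] by auto
        then obtain b where "b \<in> X" "x < b" "\<And>y. y \<in> X \<Longrightarrow> x \<le> y \<Longrightarrow> y < b \<Longrightarrow> y \<in> E1"
          using nbhd_above[OF E(1) _ step(2)] by metis
        then show ?thesis by (intro bexI[of _ b]) auto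
      next
        case 3
        then show ?thesis using step(1,2) top_in top_greatest[OF step(1)]
          by (intro bexI[of _ "Sup X"]) (auto simp: less_le)
      qed
    qed
    then have "q \<in> E1" using q pq by blast
    then show False using E(4) q by blast
  qed
  show ?thesis unfolding connectedin
  proof (intro conjI notI)
    show "?I \<subseteq> topspace (chain_topology X)" by auto
    assume "\<exists>E1 E2. openin (chain_topology X) E1 \<and> openin (chain_topology X) E2 \<and>
       ?I \<subseteq> E1 \<union> E2 \<and> E1 \<inter> E2 \<inter> ?I = {} \<and> E1 \<inter> ?I \<noteq> {} \<and> E2 \<inter> ?I \<noteq> {}"
    then obtain E1 E2 p q where E: "openin (chain_topology X) E1" "openin (chain_topology X) E2"
       "?I \<subseteq> E1 \<union> E2" "E1 \<inter> E2 \<inter> ?I = {}" and p: "p \<in> ?I" "p \<in> E1" and q: "q \<in> ?I" "q \<in> E2" by blast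
    have E': "?I \<subseteq> E2 \<union> E1" "E2 \<inter> E1 \<inter> ?I = {}" using E by auto
    have "p \<le> q \<or> q \<le> p" using chain p q by blast
    then show False
      using key[OF E p q] key[OF E(2,1) E' q p] by blast
  qed
qed

text \<open>
  A point missing from the set separates it into the part below and the part above.
\<close>

lemma connected_convex:
  assumes "connectedin (chain_topology X) C" "u \<in> C" "w \<in> C" "v \<in> X" "u < v" "v < w"
  shows "v \<in> C"
proof (rule ccontr)
  assume v: "v \<notin> C"
  have CX: "C \<subseteq> X" using connectedin_subset_topspace[OF assms(1)] by simp
  have "C \<subseteq> {x\<in>X. x < v} \<union> {x\<in>X. v < x}"
  proof
    fix x assume "x \<in> C"
    then have "x \<in> X" "x \<noteq> v" using CX v by auto
    then show "x \<in> {x\<in>X. x < v} \<union> {x\<in>X. v < x}" using chain[of x v] assms(4) by (auto simp: less_le)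
  qed
  moreover have "{x\<in>X. x < v} \<inter> {x\<in>X. v < x} \<inter> C = {}" by auto
  moreover have "{x\<in>X. x < v} \<inter> C \<noteq> {}" "{x\<in>X. v < x} \<inter> C \<noteq> {}" using assms CX by auto
  ultimately show False
    using connectedinD[OF assms(1) lower_open[OF assms(4)] upper_open[OF assms(4)]] by blast
qed

lemma Hausdorff: "Hausdorff_space (chain_topology X)"
proof -
  have *: "\<exists>U V. openin (chain_topology X) U \<and> openin (chain_topology X) V \<and> x \<in> U \<and> y \<in> V \<and> disjnt U V"
    if xy: "x \<in> X" "y \<in> X" "x < y" for x y
  proof -
    obtain z where z: "z \<in> X" "x < z" "z < y" using dense[OF xy] by blast
    show ?thesis using lower_open[OF z(1)] upper_open[OF z(1)] z xy
      by (intro exI[of _ "{u\<in>X. u < z}"] exI[of _ "{u\<in>X. z < u}"]) (auto simp: disjnt_def)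
  qed
  show ?thesis unfolding Hausdorff_space_def
  proof (intro allI impI)
    fix x y assume xy: "x \<in> topspace (chain_topology X) \<and> y \<in> topspace (chain_topology X) \<and> x \<noteq> y"
    then have "x < y \<or> y < x" using chain[of x y] by (auto simp: less_le)
    then show "\<exists>U V. openin (chain_topology X) U \<and> openin (chain_topology X) V \<and> x \<in> U \<and> y \<in> V \<and> disjnt U V"
      using *[of x y] *[of y x] xy by (metis disjnt_sym topspace_order_topology_on)
  qed
qed

lemma continuum: "continuum (chain_topology X)"
proof -
  have "{x\<in>X. bot \<le> x \<and> x \<le> Sup X} = X" using top_greatest by auto
  then have "connected_space (chain_topology X)"
    using interval_connected[of "bot" "Sup X"] connectedin_topspace[of "chain_topology X"] by simp
  then show ?thesis
    using compact Hausdorff bot_in top_in nontrivial unfolding continuum_def by auto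
qed

lemma linearly_ordered: "linearly_ordered_space (chain_topology X)"
proof -
  have "linear_order_on X (order_rel X)"
    using chain unfolding linear_order_on_def partial_order_on_def preorder_on_def
    by (auto simp: order_rel_def refl_on_def trans_def antisym_def total_on_def)
  then show ?thesis unfolding linearly_ordered_space_def by auto
qed

end

section \<open>Weights\<close>

lemma weight_realised: obtains \<B> where "base_of X \<B>" "weight X = |\<B>|"
proof -
  have "weight X \<in> {|\<B>| |\<B>. base_of X \<B>}"
    unfolding weight_def by (rule least_card_in) (auto intro: base_of_all_open simp: card_of_Card_order)
  then show ?thesis using that by blast
qed

lemma weight_le: "base_of X \<B> \<Longrightarrow> weight X \<le>o |\<B>|"
  unfolding weight_def by (rule least_card_le) (auto intro: base_of_all_open simp: card_of_Card_order)

lemma base_of_subtopology: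
  assumes "base_of X \<B>" shows "base_of (subtopology X U) ((\<lambda>V. V \<inter> U) ` \<B>)"
  unfolding base_of_def
proof (intro conjI ballI allI impI)
  fix V assume "V \<in> (\<lambda>V. V \<inter> U) ` \<B>"
  then show "openin (subtopology X U) V"
    using assms unfolding base_of_def openin_subtopology by blast
next
  fix W x assume W: "openin (subtopology X U) W \<and> x \<in> W"
  then obtain W' where "openin X W'" "W = W' \<inter> U" unfolding openin_subtopology by blast
  then obtain V where "V \<in> \<B>" "x \<in> V" "V \<subseteq> W'" "x \<in> U"
    using assms W unfolding base_of_def by blast
  then show "\<exists>V\<in>(\<lambda>V. V \<inter> U) ` \<B>. x \<in> V \<and> V \<subseteq> W"
    using \<open>W = W' \<inter> U\<close> by (intro bexI[of _ "V \<inter> U"]) auto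
qed

text \<open>
  Every member of the family contains a nonempty member of the base, and disjointness makes this
  choice injective.
\<close>

lemma card_disjoint_open_le_weight:
  assumes op: "\<And>e. e \<in> T \<Longrightarrow> openin X (O' e) \<and> O' e \<noteq> {}"
    and disj: "\<And>d e. d \<in> T \<Longrightarrow> e \<in> T \<Longrightarrow> d \<noteq> e \<Longrightarrow> O' d \<inter> O' e = {}"
  shows "|T| \<le>o weight X"
proof -
  obtain \<B> where B: "base_of X \<B>" "weight X = |\<B>|" by (rule weight_realised)
  have "\<exists>V\<in>\<B>. V \<noteq> {} \<and> V \<subseteq> O' e" if "e \<in> T" for e
    using op[OF that] B(1) unfolding base_of_def by blast
  then obtain V where V: "\<And>e. e \<in> T \<Longrightarrow> V e \<in> \<B> \<and> V e \<noteq> {} \<and> V e \<subseteq> O' e" by metis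
  have "inj_on V T"
    by (rule inj_onI) (use V disj in blast)
  then show ?thesis using B(2) V card_of_ordLeqI[of V T \<B>] by auto
qed

text \<open>
  Weights do not increase in subspaces, so a lower bound on all nonempty open subspaces makes
  all these weights equal.
\<close>

lemma weight_homogeneous:
  fixes \<kappa> :: "'k rel"
  assumes base: "base_of X \<B>" "|\<B>| \<le>o \<kappa>" and "Card_order \<kappa>" and ne: "topspace X \<noteq> {}"
    and cell: "\<And>U. openin X U \<Longrightarrow> U \<noteq> {} \<Longrightarrow> \<kappa> \<le>o weight (subtopology X U)"
  shows "weight X =o \<kappa>" and "min_open_weight X =o weight X"
proof -
  have up: "weight (subtopology X U) \<le>o \<kappa>" for U
  proof -
    have "weight (subtopology X U) \<le>o |(\<lambda>V. V \<inter> U) ` \<B>|"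
      by (rule weight_le[OF base_of_subtopology[OF base(1)]])
    also have "|(\<lambda>V. V \<inter> U) ` \<B>| \<le>o |\<B>|" by (rule card_of_image)
    also note base(2)
    finally show ?thesis .
  qed
  have eq: "weight (subtopology X U) =o \<kappa>" if "openin X U" "U \<noteq> {}" for U
    using up cell[OF that] by (simp add: ordIso_iff_ordLeq)
  show w: "weight X =o \<kappa>" using eq[of "topspace X"] ne by auto
  let ?R = "{weight (subtopology X U) | U. openin X U \<and> U \<noteq> {}}"
  have "min_open_weight X \<in> ?R"
    unfolding min_open_weight_def
    by (rule least_card_in) (use ne in \<open>auto intro: Card_order_weight\<close>)
  then obtain U where "openin X U" "U \<noteq> {}" "min_open_weight X = weight (subtopology X U)" by blast
  then show "min_open_weight X =o weight X" using eq w ordIso_symmetric ordIso_transitive by metis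
qed

section \<open>Embeddings of chains and countable characters\<close>

definition linear_on :: "('a \<Rightarrow> 'a \<Rightarrow> bool) \<Rightarrow> 'a set \<Rightarrow> bool" where
  "linear_on R X \<longleftrightarrow> (\<forall>x\<in>X. \<not> R x x) \<and> (\<forall>x\<in>X. \<forall>y\<in>X. \<forall>z\<in>X. R x y \<longrightarrow> R y z \<longrightarrow> R x z) \<and>
     (\<forall>x\<in>X. \<forall>y\<in>X. x \<noteq> y \<longrightarrow> R x y \<or> R y x)"

lemma linear_on_irrefl: "linear_on R X \<Longrightarrow> x \<in> X \<Longrightarrow> \<not> R x x"
  and linear_on_total: "linear_on R X \<Longrightarrow> x \<in> X \<Longrightarrow> y \<in> X \<Longrightarrow> x \<noteq> y \<Longrightarrow> R x y \<or> R y x"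
  unfolding linear_on_def by auto

lemma linear_on_trans:
  assumes "linear_on R X" "x \<in> X" "y \<in> X" "z \<in> X" "R x y" "R y z"
  shows "R x z"
  by (rule assms(1)[unfolded linear_on_def, THEN conjunct2, THEN conjunct1, rule_format, OF assms(2-)])

lemma linear_onI:
  assumes "\<And>x. x \<in> X \<Longrightarrow> \<not> R x x" "\<And>x y z. x \<in> X \<Longrightarrow> y \<in> X \<Longrightarrow> z \<in> X \<Longrightarrow> R x y \<Longrightarrow> R y z \<Longrightarrow> R x z"
    "\<And>x y. x \<in> X \<Longrightarrow> y \<in> X \<Longrightarrow> x \<noteq> y \<Longrightarrow> R x y \<or> R y x"
  shows "linear_on R X"
  unfolding linear_on_def
proof (intro conjI ballI impI)
  show "R x z" if "x \<in> X" "y \<in> X" "z \<in> X" "R x y" "R y z" for x y z using that by (rule assms(2))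
qed (use assms(1,3) in auto)

text \<open>
  Monotone with respect to the given relations, and with convex image. The relation on the target
  may be the reverse order, which covers decreasing maps.
\<close>

definition order_embeds ::
  "('a \<Rightarrow> 'a \<Rightarrow> bool) \<Rightarrow> 'a set \<Rightarrow> ('b \<Rightarrow> 'b \<Rightarrow> bool) \<Rightarrow> 'b set \<Rightarrow> ('a \<Rightarrow> 'b) \<Rightarrow> bool" where
  "order_embeds R X R' Y f \<longleftrightarrow> f ` X \<subseteq> Y \<and> (\<forall>x\<in>X. \<forall>x'\<in>X. R x x' \<longrightarrow> R' (f x) (f x')) \<and>
     (\<forall>x\<in>X. \<forall>x'\<in>X. \<forall>y\<in>Y. R' (f x) y \<and> R' y (f x') \<longrightarrow> y \<in> f ` X)"

text \<open>
  Betweenness is topological: for \<open>x < y < z\<close> the image of \<open>[y, z]\<close> is connected, hence convex,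
  and by injectivity it misses \<open>f x\<close>; likewise for \<open>[x, y]\<close> and \<open>f z\<close>. So \<open>f y\<close> lies between
  \<open>f x\<close> and \<open>f z\<close>, and the order of the images of the two endpoints decides the direction.
\<close>

lemma continuous_injection_monotone:
  assumes "dense_chain X" "dense_chain Y"
    and cont: "continuous_map (chain_topology X) (chain_topology Y) f" and inj: "inj_on f X"
  shows "order_embeds (<) X (<) Y f \<or> order_embeds (<) X (>) Y f"
proof -
  interpret X: dense_chain X by fact
  interpret Y: dense_chain Y by fact
  have fX: "f x \<in> Y" if "x \<in> X" for x using cont that by (auto simp: continuous_map_def)
  have less: "f x < f y \<or> f y < f x" if "x \<in> X" "y \<in> X" "x < y" for x y
  proof -
    have "f x \<noteq> f y" using inj that by (auto dest: inj_onD)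
    then show ?thesis using Y.chain[OF fX fX] that by (auto simp: less_le)
  qed
  \<comment> \<open>A point outside an interval cannot have its image between the images of the endpoints.\<close>
  have out: False if "c \<in> X" "d \<in> X" "e \<in> X" "d \<le> e" "c < d \<or> e < c"
    "f d < f c \<and> f c < f e \<or> f e < f c \<and> f c < f d" for c d e
  proof -
    let ?I = "{x\<in>X. d \<le> x \<and> x \<le> e}"
    have C: "connectedin (chain_topology Y) (f ` ?I)"
      by (rule connectedin_continuous_map_image[OF cont X.interval_connected])
    have "f d \<in> f ` ?I" "f e \<in> f ` ?I" using that by auto
    then have "f c \<in> f ` ?I"
      using Y.connected_convex[OF C] that fX by blast
    then obtain x where "x \<in> ?I" "f x = f c" by auto
    then show False using inj that by (auto dest!: inj_onD)
  qed
  have between: "f x < f y \<and> f y < f z \<or> f z < f y \<and> f y < f x"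
    if "x \<in> X" "y \<in> X" "z \<in> X" "x < y" "y < z" for x y z
  proof -
    have "x < z" using that by simp
    note l = less[OF that(1,2,4)] less[OF that(2,3,5)] less[OF that(1,3) \<open>x < z\<close>]
    have "\<not> (f y < f x \<and> f x < f z \<or> f z < f x \<and> f x < f y)"
      using out[OF that(1,2,3)] that less_imp_le[OF that(5)] by blast
    moreover have "\<not> (f x < f z \<and> f z < f y \<or> f y < f z \<and> f z < f x)"
      using out[OF that(3,1,2)] that less_imp_le[OF that(4)] by blast
    ultimately show ?thesis using l by blast
  qed
  have conv: "y \<in> f ` X" if "x \<in> X" "x' \<in> X" "y \<in> Y" "f x < y" "y < f x'" for x x' y
  proof -
    have "connectedin (chain_topology Y) (f ` {x\<in>X. bot \<le> x \<and> x \<le> Sup X})"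
      by (rule connectedin_continuous_map_image[OF cont X.interval_connected])
    moreover have "{x\<in>X. bot \<le> x \<and> x \<le> Sup X} = X" using X.top_greatest by auto
    ultimately have "connectedin (chain_topology Y) (f ` X)" by simp
    then show ?thesis using Y.connected_convex[of "f ` X" "f x" "f x'" y] that by blast
  qed
  \<comment> \<open>The order of the images of the endpoints determines the order of all other images.\<close>
  have bt: "bot < Sup X" using X.nontrivial bot.not_eq_extremum[of "Sup X"] by blast
  have le: "x = bot \<or> bot < x" "x = Sup X \<or> x < Sup X" if "x \<in> X" for x
    using X.top_greatest[OF that] bot.not_eq_extremum[of x] by (auto simp: less_le)
  have *: "(f bot < f (Sup X) \<longrightarrow> f x < f y) \<and> (f (Sup X) < f bot \<longrightarrow> f y < f x)"
    if xy: "x \<in> X" "y \<in> X" "x < y" for x y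
  proof -
    have y: "bot < y" using xy by (metis bot.extremum_strict le(1))
    have 1: "(f bot < f (Sup X) \<longrightarrow> f bot < f y) \<and> (f (Sup X) < f bot \<longrightarrow> f y < f bot)"
      using le(2)[OF xy(2)] between[OF X.bot_in xy(2) X.top_in y] by (auto dest: less_trans)
    show ?thesis
      using le(1)[OF xy(1)]
    proof
      assume "x = bot" then show ?thesis using 1 by simp
    next
      assume "bot < x"
      from between[OF X.bot_in xy(1,2) this xy(3)] 1 show ?thesis by (auto dest: less_trans)
    qed
  qed
  show ?thesis
    using less[OF X.bot_in X.top_in bt]
  proof
    assume "f bot < f (Sup X)"
    then have "order_embeds (<) X (<) Y f" unfolding order_embeds_def using * conv fX by auto
    then show ?thesis ..
  next
    assume "f (Sup X) < f bot"
    then have "order_embeds (<) X (>) Y f" unfolding order_embeds_def using * conv fX by auto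
    then show ?thesis ..
  qed
qed

lemma incomparable_chains:
  assumes "\<And>i. i \<in> I \<Longrightarrow> dense_chain (X i)"
    and "\<And>i j f. i \<in> I \<Longrightarrow> j \<in> I \<Longrightarrow> i \<noteq> j \<Longrightarrow> \<not> order_embeds (<) (X i) (<) (X j) f"
    and "\<And>i j f. i \<in> I \<Longrightarrow> j \<in> I \<Longrightarrow> i \<noteq> j \<Longrightarrow> \<not> order_embeds (<) (X i) (>) (X j) f"
  shows "incomparable I (\<lambda>i. chain_topology (X i))"
  unfolding incomparable_def
proof (intro ballI impI notI)
  fix i j assume ij: "i \<in> I" "j \<in> I" "i \<noteq> j"
  assume "\<exists>S\<subseteq>topspace (chain_topology (X j)).
            chain_topology (X i) homeomorphic_space subtopology (chain_topology (X j)) S"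
  then obtain S f where "homeomorphic_map (chain_topology (X i)) (subtopology (chain_topology (X j)) S) f"
    unfolding homeomorphic_space by blast
  then have "continuous_map (chain_topology (X i)) (chain_topology (X j)) f" "inj_on f (X i)"
    by (auto simp: homeomorphic_eq_everything_map continuous_map_in_subtopology)
  then show False
    using continuous_injection_monotone[OF assms(1)[OF ij(1)] assms(1)[OF ij(2)]] assms(2,3) ij by blast
qed


text \<open>
  The point \<open>x\<close> is the limit of a countable set of points on its \<open>R\<close>-side. For \<open>R\<close> the order or its
  reverse, these are the right and left countable characters. A marker has both. Every decreasing
  sequence has a limit of countable right character, so only the combination of both sides can be
  rare.
\<close>

definition countable_side :: "('a \<Rightarrow> 'a \<Rightarrow> bool) \<Rightarrow> 'a set \<Rightarrow> 'a \<Rightarrow> bool" where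
  "countable_side R X x \<longleftrightarrow> (\<exists>y\<in>X. R x y) \<and>
     (\<exists>K\<subseteq>X. countable K \<and> (\<forall>k\<in>K. R x k) \<and> (\<forall>y\<in>X. R x y \<longrightarrow> (\<exists>k\<in>K. k = y \<or> R k y)))"

definition marker :: "'a::order set \<Rightarrow> 'a \<Rightarrow> bool" where
  "marker X x \<longleftrightarrow> countable_side (<) X x \<and> countable_side (>) X x"

text \<open>
  With \<open>R = (<)\<close> a limit of markers from the right, with \<open>R = (>)\<close> one from the left.
\<close>

definition marker_limit :: "('a::order \<Rightarrow> 'a \<Rightarrow> bool) \<Rightarrow> 'a set \<Rightarrow> 'a \<Rightarrow> bool" where
  "marker_limit R X x \<longleftrightarrow> (\<exists>y\<in>X. R x y) \<and>
     (\<forall>y\<in>X. R x y \<longrightarrow> (\<exists>m\<in>X. marker X m \<and> R x m \<and> R m y))"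

lemma countable_sideE:
  assumes "countable_side R X x"
  obtains K where "K \<subseteq> X" "countable K" "\<forall>k\<in>K. R x k" "\<forall>y\<in>X. R x y \<longrightarrow> (\<exists>k\<in>K. k = y \<or> R k y)"
  using assms unfolding countable_side_def by (elim conjE exE)

lemma countable_sideI:
  assumes "y \<in> X" "R x y" "K \<subseteq> X" "countable K" "\<And>k. k \<in> K \<Longrightarrow> R x k"
    "\<And>y. y \<in> X \<Longrightarrow> R x y \<Longrightarrow> \<exists>k\<in>K. k = y \<or> R k y"
  shows "countable_side R X x"
  unfolding countable_side_def using assms by (intro conjI exI[of _ K]) auto

lemma (in dense_chain) linear_on: "linear_on (<) X" "linear_on (>) X"
proof -
  have "x < y \<or> y < x" if "x \<in> X" "y \<in> X" "x \<noteq> y" for x y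
    using chain[OF that(1,2)] that(3) by (auto simp: less_le)
  then show "linear_on (<) X" "linear_on (>) X"
    unfolding linear_on_def by (auto dest: less_trans)
qed

lemma order_embeds_flip:
  "order_embeds R X R' Y f \<Longrightarrow> order_embeds (\<lambda>x y. R y x) X (\<lambda>x y. R' y x) Y f"
  unfolding order_embeds_def by blast

lemma linear_on_flip: "linear_on R X \<Longrightarrow> linear_on (\<lambda>x y. R y x) X"
  unfolding linear_on_def by meson

locale order_embedding =
  fixes R :: "'a \<Rightarrow> 'a \<Rightarrow> bool" and X R' and Y :: "'b set" and f
  assumes linX: "linear_on R X" and linY: "linear_on R' Y" and emb: "order_embeds R X R' Y f"
begin

lemmas transX = linX[THEN linear_on_trans]
  and totalX = linX[THEN linear_on_total]
  and irreflY = linY[THEN linear_on_irrefl]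
  and transY = linY[THEN linear_on_trans]
  and totalY = linY[THEN linear_on_total]
  and mono = emb[unfolded order_embeds_def, THEN conjunct2, THEN conjunct1, rule_format]
  and convex = emb[unfolded order_embeds_def, THEN conjunct2, THEN conjunct2, rule_format, OF _ _ _ conjI]

lemma into: "x \<in> X \<Longrightarrow> f x \<in> Y"
  using emb unfolding order_embeds_def by (elim conjE) (erule subsetD, erule imageI)

lemma convexE:
  assumes "x \<in> X" "x' \<in> X" "y \<in> Y" "R' (f x) y" "R' y (f x')"
  obtains z where "z \<in> X" "y = f z"
  using convex[OF assms] by auto

lemma less_iff: "x \<in> X \<Longrightarrow> y \<in> X \<Longrightarrow> R' (f x) (f y) \<longleftrightarrow> R x y"
proof
  assume xy: "x \<in> X" "y \<in> X" and l: "R' (f x) (f y)"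
  have "x \<noteq> y" using l irreflY[OF into[OF xy(1)]] by auto
  moreover have "\<not> R y x"
  proof
    assume "R y x"
    then have "R' (f y) (f x)" using mono xy by blast
    then have "R' (f x) (f x)" using transY[OF into into into l] xy by blast
    then show False using irreflY into xy by blast
  qed
  ultimately show "R x y" using totalX xy by blast
qed (rule mono)

lemma inj: "inj_on f X"
proof (rule inj_onI, rule ccontr)
  fix x y assume xy: "x \<in> X" "y \<in> X" "f x = f y" "x \<noteq> y"
  then have "R' (f x) (f y) \<or> R' (f y) (f x)" using totalX mono by blast
  then show False using xy(3) irreflY[OF into[OF xy(2)]] by simp
qed

text \<open>
  Convexity of the image makes the image of \<open>X\<close> coinitial above \<open>f x\<close>, unless \<open>x\<close> is the last point.
\<close>

lemma below:
  assumes "x \<in> X" "x1 \<in> X" "R x x1" "y \<in> Y" "R' (f x) y"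
  obtains z where "z \<in> X" "R x z" "y = f z \<or> R' (f z) y"
proof (cases "R' y (f x1)")
  case True
  obtain z where z: "z \<in> X" "y = f z" by (rule convexE[OF assms(1,2,4,5) True])
  then have "R x z" using less_iff[OF assms(1) z(1)] assms(5) by simp
  then show ?thesis using that[of z] z by simp
next
  case False
  then have "y = f x1 \<or> R' (f x1) y" using totalY[OF assms(4) into[OF assms(2)]] by blast
  then show ?thesis using that[OF assms(2,3)] by simp
qed

lemma countable_side_iff:
  assumes x: "x \<in> X" "x1 \<in> X" "R x x1"
  shows "countable_side R' Y (f x) \<longleftrightarrow> countable_side R X x"
proof
  assume "countable_side R X x"
  then obtain K where K: "K \<subseteq> X" "countable K" "\<forall>k\<in>K. R x k"
    "\<forall>y\<in>X. R x y \<longrightarrow> (\<exists>k\<in>K. k = y \<or> R k y)" by (rule countable_sideE)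
  have "\<exists>k\<in>f ` K. k = y \<or> R' k y" if y: "y \<in> Y" "R' (f x) y" for y
  proof -
    obtain z where z: "z \<in> X" "R x z" "y = f z \<or> R' (f z) y" by (rule below[OF x y])
    then obtain k where k: "k \<in> K" "k = z \<or> R k z" using K(4) by blast
    then have "f k = f z \<or> R' (f k) (f z)" using mono z K(1) by blast
    moreover have "f k \<in> Y" "f z \<in> Y" using into z K(1) k by auto
    ultimately have "f k = y \<or> R' (f k) y" using z(3) transY[of "f k" "f z" y] y(1) by auto
    then show ?thesis using k by blast
  qed
  moreover have "f ` K \<subseteq> Y" "countable (f ` K)" using K(1,2) into by auto
  moreover have "R' (f x) k" if "k \<in> f ` K" for k using that K(1,3) mono x by blast
  ultimately show "countable_side R' Y (f x)"
    using countable_sideI[of "f x1" Y R' "f x" "f ` K"] into mono x by blast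
next
  assume "countable_side R' Y (f x)"
  then obtain K where K: "K \<subseteq> Y" "countable K" "\<forall>k\<in>K. R' (f x) k"
    "\<forall>y\<in>Y. R' (f x) y \<longrightarrow> (\<exists>k\<in>K. k = y \<or> R' k y)" by (rule countable_sideE)
  let ?K = "{z\<in>X. f z \<in> K}"
  have "countable ?K"
  proof (rule countable_image_inj_on)
    show "inj_on f ?K" using inj by (rule inj_on_subset) auto
    show "countable (f ` ?K)" by (rule countable_subset[OF _ K(2)]) auto
  qed
  moreover have "\<forall>k\<in>?K. R x k" using K(3) less_iff x by blast
  moreover have "\<exists>k\<in>?K. k = y \<or> R k y" if y: "y \<in> X" "R x y" for y
  proof -
    obtain k where k: "k \<in> K" "k = f y \<or> R' k (f y)" using K(4) y mono into x by meson
    have "k = f y \<or> (\<exists>z\<in>X. k = f z)"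
      using convexE[OF x(1) y(1), of k] K(1,3) k by blast
    then obtain z where z: "z \<in> X" "k = f z" using y by blast
    then have "z = y \<or> R z y" using k(2) less_iff[OF z(1) y(1)] inj_onD[OF inj _ z(1) y(1)] by blast
    then show ?thesis using z k(1) by blast
  qed
  ultimately show "countable_side R X x"
    using countable_sideI[of x1 X R x ?K] x(2,3) by blast
qed

end

lemma marker_iff:
  assumes X: "linear_on (<) X" and Y: "linear_on R' Y" and R': "R' = (<) \<or> R' = (>)"
    and f: "order_embeds (<) X R' Y f"
    and m: "m \<in> X" "a \<in> X" "b \<in> X" "a < m" "m < b"
  shows "marker Y (f m) \<longleftrightarrow> marker X m"
proof -
  interpret A: order_embedding "(<)" X R' Y f by (rule order_embedding.intro[OF X Y f])
  interpret B: order_embedding "\<lambda>x y. y < x" X "\<lambda>x y. R' y x" Y f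
    by (rule order_embedding.intro[OF linear_on_flip[OF X] linear_on_flip[OF Y] order_embeds_flip[OF f]])
  show ?thesis
    using A.countable_side_iff[OF m(1,3,5)] B.countable_side_iff[OF m(1,2,4)] R'
    unfolding marker_def by auto
qed

lemma marker_limit_iff:
  fixes X :: "'a::order set" and Y :: "'b::order set"
  assumes "order_embedding R X R' Y f"
    and mk: "\<forall>m\<in>X. (\<exists>a\<in>X. R a m) \<longrightarrow> (\<exists>b\<in>X. R m b) \<longrightarrow> (marker Y (f m) \<longleftrightarrow> marker X m)"
    and x: "x \<in> X" "x1 \<in> X" "R x x1"
  shows "marker_limit R' Y (f x) \<longleftrightarrow> marker_limit R X x"
proof -
  interpret order_embedding R X R' Y f by fact
  show ?thesis
  proof
    assume L: "marker_limit R X x"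
    have "\<exists>m\<in>Y. marker Y m \<and> R' (f x) m \<and> R' m y" if y: "y \<in> Y" "R' (f x) y" for y
    proof -
      obtain z where z: "z \<in> X" "R x z" "y = f z \<or> R' (f z) y" by (rule below[OF x y])
      then obtain m where m: "m \<in> X" "marker X m" "R x m" "R m z"
        using L unfolding marker_limit_def by blast
      then have "marker Y (f m)" "R' (f x) (f m)" "R' (f m) (f z)" using mk mono x z by blast+
      moreover have "R' (f m) y"
        using z(3) calculation(3) transY[OF into[OF m(1)] into[OF z(1)] y(1)] by auto
      ultimately show ?thesis using into m by blast
    qed
    then show "marker_limit R' Y (f x)" unfolding marker_limit_def using x mono into by blast
  next
    assume L: "marker_limit R' Y (f x)"
    have "\<exists>m\<in>X. marker X m \<and> R x m \<and> R m y" if y: "y \<in> X" "R x y" for y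
    proof -
      obtain m where m: "m \<in> Y" "marker Y m" "R' (f x) m" "R' m (f y)"
        using L mono[OF x(1) y] into[OF y(1)] unfolding marker_limit_def by blast
      then obtain z where z: "z \<in> X" "m = f z" using convexE x y by metis
      then have "R x z" "R z y" using m less_iff[OF x(1) z(1)] less_iff[OF z(1) y(1)] by simp_all
      then show ?thesis using mk x(1) y(1) z m(2) by blast
    qed
    then show "marker_limit R X x" unfolding marker_limit_def using x by blast
  qed
qed

section \<open>Chains coding a set of ordinals\<close>

text \<open>
  Chains in which a set \<open>S\<close> of ordinals can be read off from the markers: the least point is the only
  right limit of markers, the left limits of markers are the points \<open>b i\<close> (and possibly the greatest
  point), and the right character of \<open>b i\<close> tells whether \<open>i\<close> belongs to \<open>S\<close>.
\<close>

locale coded_chain = dense_chain X for X :: "'a::complete_lattice set" +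
  fixes lt :: "'i \<Rightarrow> 'i \<Rightarrow> bool" and J :: "'i set" and b :: "'i \<Rightarrow> 'a" and S :: "'i set"
  assumes b_in: "i \<in> J \<Longrightarrow> b i \<in> X"
    and b_less: "i \<in> J \<Longrightarrow> j \<in> J \<Longrightarrow> lt i j \<Longrightarrow> b i < b j"
    and b_less_top: "i \<in> J \<Longrightarrow> b i < Sup X"
    and bot_right_limit: "marker_limit (<) X bot"
    and right_limitD: "x \<in> X \<Longrightarrow> marker_limit (<) X x \<Longrightarrow> x = bot"
    and b_left_limit: "i \<in> J \<Longrightarrow> marker_limit (>) X (b i)"
    and left_limitD: "x \<in> X \<Longrightarrow> marker_limit (>) X x \<Longrightarrow> x = Sup X \<or> (\<exists>i\<in>J. x = b i)"
    and code: "i \<in> J \<Longrightarrow> countable_side (<) X (b i) \<longleftrightarrow> i \<in> S"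

text \<open>
  A decreasing embedding turns left limits of markers into right limits. There are two of the
  former in \<open>X\<close>, but only one of the latter in \<open>Y\<close>.
\<close>

lemma coded_chain_not_embeds_decreasing:
  assumes "coded_chain X lt J b S" "coded_chain Y lt J c T"
    and ij: "i \<in> J" "j \<in> J" "lt i j"
  shows "\<not> order_embeds (<) X (>) Y f"
proof
  assume f: "order_embeds (<) X (>) Y f"
  interpret X: coded_chain X lt J b S by fact
  interpret Y: coded_chain Y lt J c T by fact
  have e: "order_embedding (>) X (<) Y f"
    by (rule order_embedding.intro[OF X.linear_on(2) Y.linear_on(1) order_embeds_flip[OF f]])
  then interpret order_embedding "(>)" X "(<)" Y f .
  have mk: "\<forall>m\<in>X. (\<exists>a\<in>X. a > m) \<longrightarrow> (\<exists>b\<in>X. m > b) \<longrightarrow> (marker Y (f m) \<longleftrightarrow> marker X m)"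
    using marker_iff[OF X.linear_on(1) Y.linear_on(2) disjI2[OF refl] f] by blast
  have "f (b k) = bot" if k: "k \<in> J" for k
  proof -
    have L: "marker_limit (>) X (b k)" using X.b_left_limit[OF k] .
    then obtain y where "y \<in> X" "b k > y" unfolding marker_limit_def by blast
    then have "marker_limit (<) Y (f (b k))"
      using marker_limit_iff[OF e mk X.b_in[OF k]] L by blast
    then show ?thesis using Y.right_limitD into X.b_in[OF k] by blast
  qed
  then have "f (b i) = f (b j)" using ij by simp
  moreover have "b i \<noteq> b j" using X.b_less[OF ij] by auto
  ultimately show False using inj X.b_in ij by (meson inj_onD)
qed

text \<open>
  An increasing embedding maps the least point, as a right limit of markers, to the least point.
  Hence it maps the left limits of markers onto an initial segment of those of \<open>Y\<close>; as these are
  well-ordered, it maps \<open>b i\<close> to \<open>c i\<close> by induction, and preserves the right characters.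
\<close>

lemma coded_chain_embeds_imp_eq:
  assumes "coded_chain X lt J b S" "coded_chain Y lt J c T"
    and wf: "wfp_on J lt" and total: "\<And>i j. i \<in> J \<Longrightarrow> j \<in> J \<Longrightarrow> i \<noteq> j \<Longrightarrow> lt i j \<or> lt j i"
    and f: "order_embeds (<) X (<) Y f"
  shows "S \<inter> J = T \<inter> J"
proof -
  interpret X: coded_chain X lt J b S by fact
  interpret Y: coded_chain Y lt J c T by fact
  have e: "order_embedding (<) X (<) Y f"
    by (rule order_embedding.intro[OF X.linear_on(1) Y.linear_on(1) f])
  have e': "order_embedding (>) X (>) Y f"
    by (rule order_embedding.intro[OF X.linear_on(2) Y.linear_on(2) order_embeds_flip[OF f]])
  interpret order_embedding "(<)" X "(<)" Y f by (rule e)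
  have mk: "\<forall>m\<in>X. (\<exists>a\<in>X. a < m) \<longrightarrow> (\<exists>b\<in>X. m < b) \<longrightarrow> (marker Y (f m) \<longleftrightarrow> marker X m)"
    using marker_iff[OF X.linear_on(1) Y.linear_on(1) disjI1[OF refl] f] by blast
  then have mk': "\<forall>m\<in>X. (\<exists>a\<in>X. a > m) \<longrightarrow> (\<exists>b\<in>X. m > b) \<longrightarrow> (marker Y (f m) \<longleftrightarrow> marker X m)"
    by blast
  have fbot: "f bot = bot"
  proof (rule Y.right_limitD[OF into[OF X.bot_in]])
    obtain y where "y \<in> X" "bot < y" using X.bot_right_limit unfolding marker_limit_def by blast
    then show "marker_limit (<) Y (f bot)"
      using marker_limit_iff[OF e mk X.bot_in] X.bot_right_limit by blast
  qed
  have fb: "f (b i) = c i" if "i \<in> J" for i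
    using wf that
  proof (induction i rule: wfp_on_induct)
    case in_set
    show ?case by (rule that)
  next
    case (less i)
    note i = \<open>i \<in> J\<close>
    have inX: "b i \<in> X" and inY: "c i \<in> Y" using X.b_in Y.b_in i by auto
    have "marker_limit (>) Y (f (b i))"
    proof -
      have "marker_limit (>) X (b i)" using X.b_left_limit[OF i] .
      moreover from this obtain y where "y \<in> X" "b i > y" unfolding marker_limit_def by blast
      ultimately show ?thesis using marker_limit_iff[OF e' mk' inX] by blast
    qed
    then consider "f (b i) = Sup Y" | k where "k \<in> J" "f (b i) = c k"
      using Y.left_limitD[OF into[OF inX]] by blast
    then have ge: "c i \<le> f (b i)"
    proof cases
      case 1 then show ?thesis using Y.top_greatest[OF inY] by simp
    next
      case 2
      have "\<not> lt k i"
      proof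
        assume "lt k i"
        then have "f (b k) = f (b i)" using less.IH 2 by simp
        then have "b k = b i" using inj X.b_in 2(1) inX by (meson inj_onD)
        then show False using X.b_less[OF 2(1) i \<open>lt k i\<close>] by simp
      qed
      then show ?thesis using total[OF 2(1) i] Y.b_less[OF i 2(1)] 2(2) by (cases "k = i") auto
    qed
    show "f (b i) = c i"
    proof (rule ccontr)
      assume "f (b i) \<noteq> c i"
      with ge have lt1: "c i < f (b i)" by auto
      \<comment> \<open>The point \<open>c i\<close> is then taken by \<open>f\<close>, necessarily at some \<open>b k\<close> with \<open>k\<close> below \<open>i\<close>.\<close>
      have L: "marker_limit (>) Y (c i)" by (rule Y.b_left_limit[OF i])
      then obtain y where "y \<in> Y" "y < c i" unfolding marker_limit_def by blast
      then have "bot < c i" by (meson bot.extremum order_le_less_trans)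
      then obtain x where x: "x \<in> X" "c i = f x"
        using convexE[OF X.bot_in inX inY] lt1 fbot by auto
      have x1: "x < b i" using lt1 less_iff[OF x(1) inX] x(2) by simp
      have x0: "bot < x" using \<open>bot < c i\<close> less_iff[OF X.bot_in x(1)] x(2) fbot by simp
      have "marker_limit (>) X x"
        using marker_limit_iff[OF e' mk' x(1) X.bot_in x0] L x(2) by simp
      moreover have "x < Sup X" using x1 X.top_greatest[OF inX] by auto
      ultimately obtain k where k: "k \<in> J" "x = b k" using X.left_limitD[OF x(1)] by auto
      have "\<not> lt i k" using X.b_less[OF i k(1)] k(2) x1 by auto
      then have "lt k i" using total[OF k(1) i] k(2) x1 by auto
      then have "f x = c k" "c k < c i" using less.IH[OF k(1)] Y.b_less[OF k(1) i] k by auto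
      then show False using x(2) by simp
    qed
  qed
  have "i \<in> S \<longleftrightarrow> i \<in> T" if i: "i \<in> J" for i
    using countable_side_iff[OF X.b_in[OF i] X.top_in X.b_less_top[OF i]] fb[OF i]
      X.code[OF i] Y.code[OF i] by simp
  then show ?thesis by blast
qed

section \<open>Completions of dense linear orders\<close>

text \<open>
  \<open>X\<close> is the Dedekind completion of \<open>P\<close>, whose elements are identified with points of \<open>X\<close> by \<open>j\<close>. A
  point \<open>x\<close> amounts to the initial segment \<open>below x\<close>, which has no greatest element.
\<close>

locale completion = dense_chain X for X :: "'a::complete_lattice set" +
  fixes P :: "'p set" and lt :: "'p \<Rightarrow> 'p \<Rightarrow> bool" and j :: "'p \<Rightarrow> 'a"
  assumes lt_linear: "linear_on lt P"
    and j_in: "p \<in> P \<Longrightarrow> j p \<in> X"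
    and j_less: "p \<in> P \<Longrightarrow> q \<in> P \<Longrightarrow> j p < j q \<longleftrightarrow> lt p q"
    and j_dense: "x \<in> X \<Longrightarrow> y \<in> X \<Longrightarrow> x < y \<Longrightarrow> \<exists>p\<in>P. x < j p \<and> j p < y"
begin

lemmas lt_irrefl = lt_linear[THEN linear_on_irrefl]
  and lt_trans = lt_linear[THEN linear_on_trans]
  and lt_total = lt_linear[THEN linear_on_total]

definition below :: "'a \<Rightarrow> 'p set" where "below x = {p\<in>P. j p < x}"

lemma j_inj: "p \<in> P \<Longrightarrow> q \<in> P \<Longrightarrow> j p = j q \<Longrightarrow> p = q"
  using lt_total[of p q] j_less[of p q] j_less[of q p] by auto

lemma below_subset_iff:
  assumes "x \<in> X" "y \<in> X" shows "below x \<subseteq> below y \<longleftrightarrow> x \<le> y"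
proof
  assume "x \<le> y" then show "below x \<subseteq> below y" by (auto simp: below_def)
next
  assume sub: "below x \<subseteq> below y"
  show "x \<le> y"
  proof (rule ccontr)
    assume "\<not> x \<le> y"
    then obtain p where p: "p \<in> P" "y < j p" "j p < x"
      using j_dense[OF assms(2,1)] not_le[OF assms] by blast
    then have "p \<in> below y" using sub by (auto simp: below_def)
    then show False using p by (auto simp: below_def)
  qed
qed

lemma below_inj: "x \<in> X \<Longrightarrow> y \<in> X \<Longrightarrow> below x = below y \<Longrightarrow> x = y"
  using below_subset_iff[of x y] below_subset_iff[of y x] by (auto intro: antisym)

lemma below_initial: "q \<in> below x \<Longrightarrow> p \<in> P \<Longrightarrow> lt p q \<Longrightarrow> p \<in> below x"
  using j_less[of p q] by (auto simp: below_def dest: less_trans)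

lemma below_no_max:
  assumes "x \<in> X" "p \<in> below x" obtains q where "q \<in> below x" "lt p q"
proof -
  have p: "p \<in> P" "j p < x" using assms by (auto simp: below_def)
  then obtain q where "q \<in> P" "j p < j q" "j q < x" using j_dense j_in assms(1) by blast
  then show ?thesis using that[of q] p j_less by (auto simp: below_def)
qed

lemma Sup_below: assumes "x \<in> X" shows "x = Sup (j ` below x)"
proof -
  have s: "Sup (j ` below x) \<in> X" using j_in by (intro Sup_closed) (auto simp: below_def)
  have "Sup (j ` below x) \<le> x" by (rule Sup_least) (auto simp: below_def)
  moreover have "x \<le> Sup (j ` below x)"
  proof (rule ccontr)
    assume "\<not> x \<le> Sup (j ` below x)"
    then obtain p where p: "p \<in> P" "Sup (j ` below x) < j p" "j p < x"
      using j_dense[OF s assms] not_le[OF assms s] by blast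
    then have "j p \<le> Sup (j ` below x)" by (intro Sup_upper) (auto simp: below_def)
    then show False using p by auto
  qed
  ultimately show ?thesis by (rule antisym[rotated])
qed

lemma below_Sup:
  assumes "I \<subseteq> P" and init: "\<And>p q. q \<in> I \<Longrightarrow> p \<in> P \<Longrightarrow> lt p q \<Longrightarrow> p \<in> I"
    and nomax: "\<And>p. p \<in> I \<Longrightarrow> \<exists>q\<in>I. lt p q"
  shows "Sup (j ` I) \<in> X" "below (Sup (j ` I)) = I"
proof -
  show s: "Sup (j ` I) \<in> X" using j_in assms(1) by (intro Sup_closed) auto
  have "p \<in> I" if p: "p \<in> P" "j p < Sup (j ` I)" for p
  proof -
    have "\<exists>q\<in>I. \<not> j q \<le> j p" using p by (meson SUP_least leD)
    then obtain q where q: "q \<in> I" "\<not> j q \<le> j p" by blast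
    then have "j p < j q" using not_le j_in p(1) assms(1) by blast
    then show ?thesis using init[OF q(1) p(1)] j_less p(1) q(1) assms(1) by blast
  qed
  moreover have "j p < Sup (j ` I)" if p: "p \<in> I" for p
  proof -
    obtain q where q: "q \<in> I" "lt p q" using nomax p by blast
    then have "j p < j q" using j_less p assms(1) by blast
    also have "j q \<le> Sup (j ` I)" using q by (intro Sup_upper) auto
    finally show ?thesis .
  qed
  ultimately show "below (Sup (j ` I)) = I" using assms(1) by (auto simp: below_def)
qed

lemma countable_cofinal_below:
  assumes "countable_side (>) X x" "x \<in> X"
  obtains L where "L \<subseteq> below x" "countable L" "\<And>p. p \<in> below x \<Longrightarrow> \<exists>l\<in>L. p = l \<or> lt p l"
proof -
  obtain K where K: "K \<subseteq> X" "countable K" "\<forall>k\<in>K. x > k"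
    "\<forall>y\<in>X. x > y \<longrightarrow> (\<exists>k\<in>K. k = y \<or> k > y)" using assms(1) by (rule countable_sideE)
  have "\<forall>k\<in>K. \<exists>l\<in>P. k < j l \<and> j l < x" using j_dense[OF _ assms(2)] K(1,3) by blast
  then obtain l where l: "\<And>k. k \<in> K \<Longrightarrow> l k \<in> P \<and> k < j (l k) \<and> j (l k) < x" by metis
  have "\<exists>l'\<in>l ` K. p = l' \<or> lt p l'" if p: "p \<in> below x" for p
  proof -
    have "p \<in> P" "j p < x" using p by (auto simp: below_def)
    then obtain k where k: "k \<in> K" "k = j p \<or> j p < k" using K(4) j_in by blast
    then have "j p < j (l k)" using l[OF k(1)] by auto
    then show ?thesis using l[OF k(1)] j_less \<open>p \<in> P\<close> k(1) by blast
  qed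
  moreover have "l ` K \<subseteq> below x" using l by (auto simp: below_def)
  ultimately show ?thesis using that[of "l ` K"] K(2) by auto
qed

lemma countable_coinitial_above:
  assumes "countable_side (<) X x" "x \<in> X"
  obtains R where "R \<subseteq> P - below x" "countable R" "\<And>p. p \<in> P - below x \<Longrightarrow> \<exists>r\<in>R. r = p \<or> lt r p"
proof -
  obtain K where K: "K \<subseteq> X" "countable K" "\<forall>k\<in>K. x < k"
    "\<forall>y\<in>X. x < y \<longrightarrow> (\<exists>k\<in>K. k = y \<or> k < y)" using assms(1) by (rule countable_sideE)
  have "\<forall>k\<in>K. \<exists>r\<in>P. x < j r \<and> j r < k" using j_dense[OF assms(2)] K(1,3) by blast
  then obtain r where r: "\<And>k. k \<in> K \<Longrightarrow> r k \<in> P \<and> x < j (r k) \<and> j (r k) < k" by metis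
  \<comment> \<open>If \<open>x\<close> itself comes from \<open>P\<close>, it is the least element of the complement of \<open>below x\<close>.\<close>
  let ?E = "{p\<in>P. j p = x}"
  let ?R = "r ` K \<union> ?E"
  have "\<exists>r\<in>?R. r = p \<or> lt r p" if p: "p \<in> P - below x" for p
  proof (cases "j p = x")
    case True then show ?thesis using p by blast
  next
    case False
    have "p \<in> P" "x \<le> j p" using p not_less j_in assms(2) by (auto simp: below_def)
    then have "x < j p" using False by simp
    then obtain k where k: "k \<in> K" "k = j p \<or> k < j p" using K(4) j_in \<open>p \<in> P\<close> by blast
    then have "j (r k) < j p" using r[OF k(1)] by auto
    then show ?thesis using r[OF k(1)] j_less \<open>p \<in> P\<close> k(1) by blast
  qed
  moreover have "?R \<subseteq> P - below x" using r by (auto simp: below_def dest: less_asym)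
  moreover have "finite ?E"
  proof (cases "\<exists>p\<in>P. j p = x")
    case True
    then obtain p where "p \<in> P" "j p = x" by blast
    then have "?E \<subseteq> {p}" using j_inj by blast
    then show ?thesis by (rule finite_subset) simp
  next
    case False
    then have "?E = {}" by blast
    then show ?thesis by (simp only: finite.emptyI)
  qed
  then have "countable ?E" by (rule countable_finite)
  then have "countable ?R" using K(2) by simp
  ultimately show ?thesis using that[of ?R] by blast
qed

lemma countable_sideI_below:
  assumes "x \<in> X" "y \<in> X" "y < x" "L \<subseteq> below x" "countable L"
    "\<And>p. p \<in> below x \<Longrightarrow> \<exists>l\<in>L. p = l \<or> lt p l"
  shows "countable_side (>) X x"
proof (rule countable_sideI[of y X "(>)" x "j ` L"])
  show "j ` L \<subseteq> X" using assms(4) j_in by (auto simp: below_def)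
  show "x > k" if "k \<in> j ` L" for k using that assms(4) by (auto simp: below_def)
  show "\<exists>k\<in>j ` L. k = z \<or> k > z" if z: "z \<in> X" "x > z" for z
  proof -
    obtain p where p: "p \<in> P" "z < j p" "j p < x" using j_dense[OF z(1) assms(1) z(2)] by blast
    then obtain l where l: "l \<in> L" "p = l \<or> lt p l" using assms(6) by (auto simp: below_def)
    then have "l \<in> P" using assms(4) by (auto simp: below_def)
    then have "z < j l" using l(2) p j_less[OF p(1), of l] by (auto dest: less_trans)
    then show ?thesis using l(1) by blast
  qed
qed (use assms in auto)

lemma countable_sideI_above:
  assumes "x \<in> X" "y \<in> X" "x < y" "R \<subseteq> P" "\<And>r. r \<in> R \<Longrightarrow> x < j r" "countable R"
    "\<And>p. p \<in> P \<Longrightarrow> x < j p \<Longrightarrow> \<exists>r\<in>R. r = p \<or> lt r p"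
  shows "countable_side (<) X x"
proof (rule countable_sideI[of y X "(<)" x "j ` R"])
  show "j ` R \<subseteq> X" using assms(4) j_in by auto
  show "x < k" if "k \<in> j ` R" for k using that assms(5) by auto
  show "\<exists>k\<in>j ` R. k = z \<or> k < z" if z: "z \<in> X" "x < z" for z
  proof -
    obtain p where p: "p \<in> P" "x < j p" "j p < z" using j_dense[OF assms(1) z] by blast
    then obtain r where r: "r \<in> R" "r = p \<or> lt r p" using assms(7) by blast
    then have "r \<in> P" using assms(4) by auto
    then have "j r < z" using r(2) p j_less[of r p] by (auto dest: less_trans)
    then show ?thesis using r(1) by blast
  qed
qed (use assms in auto)

definition box :: "'p set \<Rightarrow> 'p set \<Rightarrow> 'a set" where
  "box A B = {x\<in>X. (\<forall>a\<in>A. j a < x) \<and> (\<forall>b\<in>B. x < j b)}"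

abbreviation "small_sets \<equiv> insert {} ((\<lambda>p. {p}) ` P)"

lemma base_boxes: "base_of (chain_topology X) ((\<lambda>(A, B). box A B) ` (small_sets \<times> small_sets))"
  unfolding base_of_def
proof (intro conjI ballI allI impI)
  fix V assume "V \<in> (\<lambda>(A, B). box A B) ` (small_sets \<times> small_sets)"
  then obtain A B where AB: "A \<in> small_sets" "B \<in> small_sets" "V = box A B" by auto
  have lo: "openin (chain_topology X) (box A {})"
  proof (cases "A = {}")
    case True
    then have "box A {} = topspace (chain_topology X)" by (auto simp: box_def)
    then show ?thesis by (simp only: openin_topspace)
  next
    case False
    then obtain p where "p \<in> P" "A = {p}" using AB by auto
    then show ?thesis using upper_open[OF j_in[of p]] by (simp add: box_def)
  qed
  have hi: "openin (chain_topology X) (box {} B)"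
  proof (cases "B = {}")
    case True
    then have "box {} B = topspace (chain_topology X)" by (auto simp: box_def)
    then show ?thesis by (simp only: openin_topspace)
  next
    case False
    then obtain p where "p \<in> P" "B = {p}" using AB by auto
    then show ?thesis using lower_open[OF j_in[of p]] by (simp add: box_def)
  qed
  have "V = box A {} \<inter> box {} B" using AB by (auto simp: box_def)
  then show "openin (chain_topology X) V" using lo hi by auto
next
  fix U x assume U: "openin (chain_topology X) U \<and> x \<in> U"
  then have x: "x \<in> X" using openin_subset by fastforce
  obtain A where A: "A \<in> small_sets" "x \<in> box A {}" "\<And>y. y \<in> box A {} \<Longrightarrow> y \<le> x \<Longrightarrow> y \<in> U"
  proof (cases "x = bot")
    case True
    then show ?thesis using that[of "{}"] U x by (auto simp: box_def bot_unique)
  next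
    case False
    then obtain a where a: "a \<in> X" "a < x" "\<And>y. y \<in> X \<Longrightarrow> a < y \<Longrightarrow> y \<le> x \<Longrightarrow> y \<in> U"
      using nbhd_below U by metis
    obtain p where "p \<in> P" "a < j p" "j p < x" using j_dense[OF a(1) x a(2)] by blast
    then show ?thesis using that[of "{p}"] a(3) x by (auto simp: box_def dest: less_trans)
  qed
  obtain B where B: "B \<in> small_sets" "x \<in> box {} B" "\<And>y. y \<in> box {} B \<Longrightarrow> x \<le> y \<Longrightarrow> y \<in> U"
  proof (cases "x = Sup X")
    case True
    then have "y = x" if "y \<in> box {} {}" "x \<le> y" for y
      using that top_greatest by (auto simp: box_def intro: antisym)
    then show ?thesis using that[of "{}"] U x by (auto simp: box_def)
  next
    case False
    then obtain b where b: "b \<in> X" "x < b" "\<And>y. y \<in> X \<Longrightarrow> x \<le> y \<Longrightarrow> y < b \<Longrightarrow> y \<in> U"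
      using nbhd_above U by metis
    obtain p where "p \<in> P" "x < j p" "j p < b" using j_dense[OF x b(1,2)] by blast
    then show ?thesis using that[of "{p}"] b(3) x by (auto simp: box_def dest: less_trans)
  qed
  have "box A B \<subseteq> U"
  proof
    fix y assume "y \<in> box A B"
    then have y: "y \<in> box A {}" "y \<in> box {} B" "y \<in> X" by (auto simp: box_def)
    then show "y \<in> U" using A(3) B(3) chain[OF x y(3)] by blast
  qed
  moreover have "x \<in> box A B" using A(2) B(2) by (auto simp: box_def)
  ultimately show "\<exists>V\<in>(\<lambda>(A, B). box A B) ` (small_sets \<times> small_sets). x \<in> V \<and> V \<subseteq> U"
    using A(1) B(1) by blast
qed

text \<open>
  Boxes with corners from \<open>P\<close> are a base of size at most \<open>\<kappa>\<close>. If every interval of \<open>P\<close> contains \<open>\<kappa>\<close>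
  disjoint intervals \<open>(u e, v e)\<close>, then every nonempty open set contains \<open>\<kappa>\<close> disjoint open sets.
\<close>

lemma weights:
  fixes \<kappa> :: "'k rel"
  assumes \<kappa>: "Cinfinite \<kappa>" and P: "|P| \<le>o \<kappa>"
    and cell: "\<And>p q. p \<in> P \<Longrightarrow> q \<in> P \<Longrightarrow> lt p q \<Longrightarrow>
      \<exists>(T :: 'e set) u v. \<kappa> \<le>o |T| \<and> (\<forall>e\<in>T. u e \<in> P \<and> v e \<in> P \<and> lt p (u e) \<and> lt (u e) (v e) \<and> lt (v e) q) \<and>
        (\<forall>d\<in>T. \<forall>e\<in>T. d \<noteq> e \<longrightarrow> lt (v d) (u e) \<or> lt (v e) (u d))"
  shows "weight (chain_topology X) =o \<kappa>"
    and "min_open_weight (chain_topology X) =o weight (chain_topology X)"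
proof -
  have inf: "Card_order \<kappa>" "\<not> finite (Field \<kappa>)" using \<kappa> by (auto simp: cinfinite_def)
  have "|small_sets| \<le>o \<kappa>"
  proof -
    have "|(\<lambda>p. {p}) ` P| \<le>o \<kappa>" using card_of_image P ordLeq_transitive by blast
    moreover have "|{{}} :: 'p set set| \<le>o \<kappa>"
      using inf by (intro Card_order_singl_ordLeq) auto
    ultimately have "|{{}} \<union> (\<lambda>p. {p}) ` P| \<le>o \<kappa>" using \<kappa> by (intro Un_Cinfinite_bound)
    then show ?thesis by simp
  qed
  then have "|small_sets \<times> small_sets| \<le>o \<kappa>"
    using inf by (intro card_of_Times_ordLeq_infinite_Field)
  then have B: "|(\<lambda>(A, B). box A B) ` (small_sets \<times> small_sets)| \<le>o \<kappa>"
    using card_of_image ordLeq_transitive by blast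
  have C: "\<kappa> \<le>o weight (subtopology (chain_topology X) U)"
    if U: "openin (chain_topology X) U" "U \<noteq> {}" for U
  proof -
    obtain x where x: "x \<in> U" using U by blast
    then have xX: "x \<in> X" using openin_subset[OF U(1)] by auto
    obtain a b where ab: "a \<in> X" "b \<in> X" "a < b" "\<And>y. y \<in> X \<Longrightarrow> a < y \<Longrightarrow> y < b \<Longrightarrow> y \<in> U"
    proof (cases "x = Sup X")
      case True
      then have "x \<noteq> bot" using nontrivial by simp
      then obtain a where a: "a \<in> X" "a < x" "\<And>y. y \<in> X \<Longrightarrow> a < y \<Longrightarrow> y \<le> x \<Longrightarrow> y \<in> U"
        using nbhd_below[OF U(1) x] by metis
      then show ?thesis using that[OF a(1) xX a(2)] by auto
    next
      case False
      then obtain b where b: "b \<in> X" "x < b" "\<And>y. y \<in> X \<Longrightarrow> x \<le> y \<Longrightarrow> y < b \<Longrightarrow> y \<in> U"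
        using nbhd_above[OF U(1) x] by metis
      then show ?thesis using that[OF xX b(1,2)] by auto
    qed
    obtain p where p: "p \<in> P" "a < j p" "j p < b" using j_dense[OF ab(1-3)] by blast
    obtain q where q: "q \<in> P" "j p < j q" "j q < b" using j_dense[OF j_in[OF p(1)] ab(2) p(3)] by blast
    obtain T :: "'e set" and u v where T: "\<kappa> \<le>o |T|"
      and uv: "\<forall>e\<in>T. u e \<in> P \<and> v e \<in> P \<and> lt p (u e) \<and> lt (u e) (v e) \<and> lt (v e) q"
      and sep: "\<forall>d\<in>T. \<forall>e\<in>T. d \<noteq> e \<longrightarrow> lt (v d) (u e) \<or> lt (v e) (u d)"
      using cell[OF p(1) q(1) iffD1[OF j_less[OF p(1) q(1)] q(2)]] by (elim exE conjE)
    have uv': "u e \<in> P" "v e \<in> P" "j p < j (u e)" "j (u e) < j (v e)" "j (v e) < j q" if "e \<in> T" for e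
      using bspec[OF uv that] j_less p(1) q(1) by simp_all
    let ?O = "\<lambda>e. box {u e} {v e}"
    have "|T| \<le>o weight (subtopology (chain_topology X) U)"
    proof (rule card_disjoint_open_le_weight[of T _ ?O])
      fix e assume e: "e \<in> T"
      have "?O e \<in> (\<lambda>(A, B). box A B) ` (small_sets \<times> small_sets)"
        using uv'[OF e] by (intro image_eqI[of _ _ "({u e}, {v e})"]) auto
      then have "openin (chain_topology X) (?O e)"
        using base_boxes unfolding base_of_def by blast
      moreover have "?O e \<subseteq> U"
      proof
        fix y assume "y \<in> ?O e"
        then have y: "y \<in> X" "j (u e) < y" "y < j (v e)" by (auto simp: box_def)
        have "a < y" using p(2) uv'(3)[OF e] y(2) by (meson less_trans)
        moreover have "y < b" using q(3) uv'(5)[OF e] y(3) by (meson less_trans)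
        ultimately show "y \<in> U" using ab(4) y(1) by blast
      qed
      moreover have "?O e \<noteq> {}"
        using dense[OF j_in j_in uv'(4)[OF e]] uv'(1,2)[OF e] by (auto simp: box_def)
      ultimately show "openin (subtopology (chain_topology X) U) (?O e) \<and> ?O e \<noteq> {}"
        unfolding openin_subtopology by blast
    next
      fix d e assume de: "d \<in> T" "e \<in> T" "d \<noteq> e"
      then have "j (v d) < j (u e) \<or> j (v e) < j (u d)"
        using bspec[OF bspec[OF sep de(1)] de(2)] j_less uv'(1,2)[OF de(1)] uv'(1,2)[OF de(2)] by simp
      then show "?O d \<inter> ?O e = {}"
        by (auto simp: box_def dest: less_trans)
    qed
    then show ?thesis using T ordLeq_transitive by blast
  qed
  have ne: "topspace (chain_topology X) \<noteq> {}" using bot_in by auto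
  show "weight (chain_topology X) =o \<kappa>"
    "min_open_weight (chain_topology X) =o weight (chain_topology X)"
    using weight_homogeneous[OF base_boxes B inf(1) ne C] by auto
qed

text \<open>
  A cut is determined by a cofinal family of its lower part, or by a coinitial family of its upper
  part. If one of the two can always be indexed by \<open>N\<close>, there are at most \<open>2 \<cdot> |P|\<^sup>N + 2\<close> cuts.
\<close>

lemma card_le_if_short_sides:
  fixes N :: "'n set"
  assumes short: "\<And>x. x \<in> X \<Longrightarrow> below x \<noteq> {} \<Longrightarrow> below x \<noteq> P \<Longrightarrow>
     \<exists>h\<in>Func N P. below x = {p\<in>P. \<exists>n\<in>N. p = h n \<or> lt p (h n)} \<or>
        below x = {p\<in>P. \<not> (\<exists>n\<in>N. h n = p \<or> lt (h n) p)}"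
    and \<mu>: "Cinfinite \<mu>" "|Func N P| \<le>o \<mu>"
  shows "|X| \<le>o \<mu>"
proof -
  let ?f = "\<lambda>h. Sup (j ` {p\<in>P. \<exists>n\<in>N. p = h n \<or> lt p (h n)})"
  let ?g = "\<lambda>h. Sup (j ` {p\<in>P. \<not> (\<exists>n\<in>N. h n = p \<or> lt (h n) p)})"
  have "X \<subseteq> ?f ` Func N P \<union> (?g ` Func N P \<union> ({Sup (j ` {})} \<union> {Sup (j ` P)}))"
  proof
    fix x assume x: "x \<in> X"
    show "x \<in> ?f ` Func N P \<union> (?g ` Func N P \<union> ({Sup (j ` {})} \<union> {Sup (j ` P)}))"
    proof (cases "below x = {} \<or> below x = P")
      case True
      then show ?thesis using Sup_below[OF x] by auto
    next
      case False
      then obtain h where "h \<in> Func N P" "below x = {p\<in>P. \<exists>n\<in>N. p = h n \<or> lt p (h n)} \<or>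
        below x = {p\<in>P. \<not> (\<exists>n\<in>N. h n = p \<or> lt (h n) p)}" using short[OF x] by blast
      then have "h \<in> Func N P" "x = ?f h \<or> x = ?g h" using Sup_below[OF x] by auto
      then show ?thesis by blast
    qed
  qed
  moreover have "|{y}| \<le>o \<mu>" for y :: 'a
    using \<mu>(1) by (intro Card_order_singl_ordLeq) (auto simp: cinfinite_def)
  moreover have "|?f ` Func N P| \<le>o \<mu>" "|?g ` Func N P| \<le>o \<mu>"
    using \<mu>(2) card_of_image ordLeq_transitive by blast+
  ultimately have "|?f ` Func N P \<union> (?g ` Func N P \<union> ({Sup (j ` {})} \<union> {Sup (j ` P)}))| \<le>o \<mu>"
    using \<mu>(1) by (intro Un_Cinfinite_bound)
  then show ?thesis
    using card_of_mono1[OF \<open>X \<subseteq> _\<close>] ordLeq_transitive by blast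
qed

end

text \<open>
  Excluding a greatest element picks one representative of the two cuts that belong to an element
  of \<open>A\<close>. This condition is preserved by unions.
\<close>

definition cuts :: "'a set \<Rightarrow> ('a \<Rightarrow> 'a \<Rightarrow> bool) \<Rightarrow> 'a set set" where
  "cuts A lt = {D. D \<subseteq> A \<and> (\<forall>x\<in>D. \<forall>y\<in>A. lt y x \<longrightarrow> y \<in> D) \<and> (\<forall>x\<in>D. \<exists>y\<in>D. lt x y)}"

lemma completion_cuts:
  assumes lin: "linear_on lt A" and ne: "A \<noteq> {}"
    and dense: "\<And>x y. x \<in> A \<Longrightarrow> y \<in> A \<Longrightarrow> lt x y \<Longrightarrow> \<exists>z\<in>A. lt x z \<and> lt z y"
    and nomax: "\<And>x. x \<in> A \<Longrightarrow> \<exists>y\<in>A. lt x y"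
  shows "completion (cuts A lt) A lt (\<lambda>p. {q\<in>A. lt q p})"
proof -
  note irrefl = lin[THEN linear_on_irrefl]
    and trans = lin[THEN linear_on_trans]
    and total = lin[THEN linear_on_total]
  let ?j = "\<lambda>p. {q\<in>A. lt q p}"
  have cutD: "D \<subseteq> A" "\<And>x y. x \<in> D \<Longrightarrow> y \<in> A \<Longrightarrow> lt y x \<Longrightarrow> y \<in> D" "\<And>x. x \<in> D \<Longrightarrow> \<exists>y\<in>D. lt x y"
    if "D \<in> cuts A lt" for D using that unfolding cuts_def by auto
  have jin: "?j p \<in> cuts A lt" if "p \<in> A" for p
    unfolding cuts_def
  proof (rule CollectI, intro conjI ballI impI)
    fix x y assume "x \<in> ?j p" "y \<in> A" "lt y x"
    then show "y \<in> ?j p" using trans[of y x p] that by simp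
  qed (use dense that in auto)
  have ch: "D \<subseteq> E \<or> E \<subseteq> D" if D: "D \<in> cuts A lt" and E: "E \<in> cuts A lt" for D E
  proof (rule disjCI, rule subsetI)
    fix x assume "\<not> E \<subseteq> D" and x: "x \<in> D"
    then obtain y where y: "y \<in> E" "y \<notin> D" by blast
    then have "\<not> lt y x" "x \<noteq> y" using cutD[OF D] cutD(1)[OF E] x by blast+
    then have "lt x y" using total x y cutD(1)[OF D] cutD(1)[OF E] by blast
    then show "x \<in> E" using cutD(2)[OF E y(1)] x cutD(1)[OF D] by blast
  qed
  have jd: "\<exists>p\<in>A. D \<subset> ?j p \<and> ?j p \<subset> E" if D: "D \<in> cuts A lt" and E: "E \<in> cuts A lt" and DE: "D \<subset> E" for D E
  proof -
    obtain p where p: "p \<in> E" "p \<notin> D" using DE by blast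
    obtain q where q: "q \<in> E" "lt p q" using cutD(3)[OF E p(1)] by blast
    have pq: "p \<in> A" "q \<in> A" using p q cutD(1)[OF E] by auto
    have "q \<notin> D" using cutD(2)[OF D _ pq(1) q(2)] p by blast
    have "x \<in> ?j q" if x: "x \<in> D" for x
    proof -
      have "x \<in> A" "x \<noteq> q" "\<not> lt q x" using x cutD(1,2)[OF D] pq \<open>q \<notin> D\<close> by blast+
      then show ?thesis using total pq by blast
    qed
    moreover have "p \<in> ?j q" using pq q by blast
    ultimately have "D \<subset> ?j q" using p(2) by blast
    moreover have "?j q \<subseteq> E" using cutD(2)[OF E q(1)] by blast
    then have "?j q \<subset> E" using q(1) irrefl pq by blast
    ultimately show ?thesis using pq by blast
  qed
  have un: "\<Union>F \<in> cuts A lt" if "F \<subseteq> cuts A lt" for F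
  proof -
    have "\<And>D. D \<in> F \<Longrightarrow> D \<in> cuts A lt" using that by blast
    note cutD' = cutD[OF this]
    show ?thesis unfolding cuts_def
    proof (rule CollectI, intro conjI ballI impI)
      show "\<Union>F \<subseteq> A" using cutD'(1) by blast
      show "y \<in> \<Union>F" if "x \<in> \<Union>F" "y \<in> A" "lt y x" for x y using that cutD'(2) by blast
      show "\<exists>y\<in>\<Union>F. lt x y" if "x \<in> \<Union>F" for x using that cutD'(3) by blast
    qed
  qed
  have "A \<in> cuts A lt" unfolding cuts_def using nomax by blast
  then have "\<Union>(cuts A lt) \<noteq> {}" using ne by blast
  moreover have "\<exists>z\<in>cuts A lt. D \<subset> z \<and> z \<subset> E" if "D \<in> cuts A lt" "E \<in> cuts A lt" "D \<subset> E" for D E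
    using jd[OF that] jin by (elim bexE conjE) (rule bexI, rule conjI)
  ultimately have dc: "dense_chain (cuts A lt)"
    by (intro dense_chain.intro ch un) (simp_all only: bot_set_def[symmetric] empty_def[symmetric] not_False_eq_True)
  have jl: "?j p \<subset> ?j q \<longleftrightarrow> lt p q" if pq: "p \<in> A" "q \<in> A" for p q
  proof
    assume "lt p q"
    then have "?j p \<subseteq> ?j q" using trans[OF _ pq] by blast
    moreover have "p \<in> ?j q" "p \<notin> ?j p" using \<open>lt p q\<close> pq irrefl by blast+
    ultimately show "?j p \<subset> ?j q" by blast
  next
    assume "?j p \<subset> ?j q"
    then obtain x where x: "x \<in> A" "lt x q" "\<not> lt x p" by blast
    then have "x = p \<or> lt p x" using total pq by blast
    then show "lt p q" using trans[OF pq(1) x(1) pq(2)] x(2) by blast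
  qed
  show ?thesis
    using dc by (rule completion.intro) (use lin jin jl jd in \<open>unfold_locales\<close>)
qed

lemma (in completion) reindex:
  assumes e: "bij_betw e Q P" and lt': "\<And>p q. p \<in> Q \<Longrightarrow> q \<in> Q \<Longrightarrow> lt' p q \<longleftrightarrow> lt (e p) (e q)"
  shows "completion X Q lt' (\<lambda>p. j (e p))"
proof unfold_locales
  have eQ: "e p \<in> P" if "p \<in> Q" for p using e that by (auto simp: bij_betw_def)
  have inj: "e p = e q \<Longrightarrow> p = q" if "p \<in> Q" "q \<in> Q" for p q
    using e that by (auto simp: bij_betw_def dest: inj_onD)
  show "linear_on lt' Q"
    unfolding linear_on_def
  proof (intro conjI ballI impI)
    show "\<not> lt' x x" if "x \<in> Q" for x using that lt' eQ lt_irrefl by simp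
    show "lt' x z" if "x \<in> Q" "y \<in> Q" "z \<in> Q" "lt' x y" "lt' y z" for x y z
      using that lt' lt_trans[OF eQ eQ eQ, of x y z] by simp
    show "lt' x y \<or> lt' y x" if "x \<in> Q" "y \<in> Q" "x \<noteq> y" for x y
      using that lt' lt_total[OF eQ eQ, of x y] inj by auto
  qed
  show "\<And>p. p \<in> Q \<Longrightarrow> j (e p) \<in> X" using eQ j_in by blast
  show "\<And>p q. p \<in> Q \<Longrightarrow> q \<in> Q \<Longrightarrow> j (e p) < j (e q) \<longleftrightarrow> lt' p q" using eQ j_less lt' by blast
  show "\<exists>p\<in>Q. x < j (e p) \<and> j (e p) < y" if xy: "x \<in> X" "y \<in> X" "x < y" for x y
  proof -
    obtain p where p: "p \<in> P" "x < j p" "j p < y" using j_dense[OF xy] by blast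
    then obtain q where "q \<in> Q" "p = e q" using e by (auto simp: bij_betw_def)
    then show ?thesis using p by blast
  qed
qed

section \<open>Lexicographically ordered functions\<close>

lemma wfp_on_minimal:
  assumes "wfp_on A R" "x \<in> A" "Pr x"
  shows "\<exists>m\<in>A. Pr m \<and> (\<forall>y\<in>A. R y m \<longrightarrow> \<not> Pr y)"
proof (rule ccontr)
  assume no: "\<not> ?thesis"
  have "\<not> Pr x" using assms(1,2)
  proof (induction x rule: wfp_on_induct)
    case in_set show ?case by (rule assms(2))
  next
    case (less x) then show ?case using no by blast
  qed
  then show False using assms(3) by blast
qed

text \<open>
  The index set \<open>N\<close> has uncountable cofinality. The set \<open>E\<close> of values has a least element \<open>bt\<close> and a
  greatest element \<open>tp\<close>; the default value \<open>e0\<close> lies strictly between them. Only values in \<open>EL\<close> may be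
  taken at uncountably many arguments.
\<close>

locale lex_functions =
  fixes N :: "'n set" and ltN :: "'n \<Rightarrow> 'n \<Rightarrow> bool" and E :: "'e set" and ltE :: "'e \<Rightarrow> 'e \<Rightarrow> bool"
    and EL :: "'e set" and bt e0 tp :: 'e
  assumes N_linear: "linear_on ltN N" and N_wf: "wfp_on N ltN"
    and N_bounded: "\<And>K. K \<subseteq> N \<Longrightarrow> countable K \<Longrightarrow> \<exists>n\<in>N. \<forall>k\<in>K. ltN k n"
    and E_linear: "linear_on ltE E" and E_wf: "wfp_on E ltE"
    and EL: "EL \<subseteq> E" "bt \<in> EL" "e0 \<in> EL" "tp \<in> EL"
    and bt_e0: "ltE bt e0" and e0_tp: "ltE e0 tp"
    and bt_least: "\<And>x. x \<in> E \<Longrightarrow> x \<noteq> bt \<Longrightarrow> ltE bt x"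
    and tp_greatest: "\<And>x. x \<in> E \<Longrightarrow> x \<noteq> tp \<Longrightarrow> ltE x tp"
begin

lemmas N_irrefl = N_linear[THEN linear_on_irrefl]
  and N_trans = N_linear[THEN linear_on_trans]
  and N_total = N_linear[THEN linear_on_total]
  and E_irrefl = E_linear[THEN linear_on_irrefl]
  and E_trans = E_linear[THEN linear_on_trans]
  and E_total = E_linear[THEN linear_on_total]

lemma E_mem: "bt \<in> E" "e0 \<in> E" "tp \<in> E" using EL by auto

lemma N_asym: "m \<in> N \<Longrightarrow> n \<in> N \<Longrightarrow> ltN m n \<Longrightarrow> \<not> ltN n m"
  using N_trans[of m n m] N_irrefl[of m] by blast

lemma N_least:
  assumes "n \<in> N" "Pr n"
  obtains m where "m \<in> N" "Pr m" "\<forall>k\<in>N. ltN k m \<longrightarrow> \<not> Pr k"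
  using wfp_on_minimal[of N ltN n Pr] N_wf assms by blast

lemma N_above2: assumes "a \<in> N" "b \<in> N" obtains n where "n \<in> N" "ltN a n" "ltN b n"
  using N_bounded[of "{a, b}"] assms by auto

lemma N_ne: "\<exists>n. n \<in> N" using N_bounded[of "{}"] by auto

definition lex :: "('n \<Rightarrow> 'e) \<Rightarrow> ('n \<Rightarrow> 'e) \<Rightarrow> bool" where
  "lex f g \<longleftrightarrow> (\<exists>d\<in>N. (\<forall>n\<in>N. ltN n d \<longrightarrow> f n = g n) \<and> ltE (f d) (g d))"

definition Fn :: "('n \<Rightarrow> 'e) set" where
  "Fn = {f. (\<forall>n. n \<notin> N \<longrightarrow> f n = e0) \<and> (\<forall>n\<in>N. f n \<in> E)}"

text \<open>
  The restriction to \<open>EL\<close> up to countably many exceptions keeps \<open>Q\<close> small, while any value may still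
  be used at any single argument. It has to allow countably many exceptions, not just finitely many:
  otherwise an infinite sequence of exceptional values would be a branch outside \<open>Q\<close> and create a
  cut that is countable on both sides.
\<close>

definition Q :: "('n \<Rightarrow> 'e) set" where
  "Q = {f\<in>Fn. (\<exists>d\<in>N. \<forall>n\<in>N. ltN d n \<longrightarrow> f n = e0) \<and> countable {n\<in>N. f n \<notin> EL}}"

lemma Q_Fn: "Q \<subseteq> Fn" by (auto simp: Q_def)

lemma Fn_E: "f \<in> Fn \<Longrightarrow> n \<in> N \<Longrightarrow> f n \<in> E" by (auto simp: Fn_def)

lemma Q_E: "f \<in> Q \<Longrightarrow> n \<in> N \<Longrightarrow> f n \<in> E" by (auto simp: Fn_def Q_def)

lemma lexI: "d \<in> N \<Longrightarrow> (\<And>n. n \<in> N \<Longrightarrow> ltN n d \<Longrightarrow> f n = g n) \<Longrightarrow> ltE (f d) (g d) \<Longrightarrow> lex f g"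
  unfolding lex_def by blast

lemma lexE:
  assumes "lex f g"
  obtains d where "d \<in> N" "\<forall>n\<in>N. ltN n d \<longrightarrow> f n = g n" "ltE (f d) (g d)"
  using assms unfolding lex_def by (elim bexE conjE)

lemma first_difference:
  assumes "f \<in> Fn" "g \<in> Fn" "f \<noteq> g"
  obtains d where "d \<in> N" "f d \<noteq> g d" "\<forall>n\<in>N. ltN n d \<longrightarrow> f n = g n"
proof -
  have "\<exists>n\<in>N. f n \<noteq> g n"
  proof (rule ccontr)
    assume "\<not> ?thesis"
    then have "f n = g n" for n using assms(1,2) by (cases "n \<in> N") (auto simp: Fn_def)
    then show False using assms(3) by blast
  qed
  then obtain n where n: "n \<in> N" "f n \<noteq> g n" by blast
  obtain m where "m \<in> N" "f m \<noteq> g m" "\<forall>k\<in>N. ltN k m \<longrightarrow> \<not> f k \<noteq> g k"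
    by (rule N_least[of n "\<lambda>n. f n \<noteq> g n", OF n])
  then show ?thesis using that[of m] by simp
qed

lemma lex_irrefl: "f \<in> Fn \<Longrightarrow> \<not> lex f f"
  using E_irrefl[OF Fn_E] by (auto simp: lex_def)

lemma lex_trans:
  assumes F: "f \<in> Fn" "g \<in> Fn" "h \<in> Fn" and fg: "lex f g" and gh: "lex g h"
  shows "lex f h"
proof -
  obtain a where a: "a \<in> N" "\<forall>n\<in>N. ltN n a \<longrightarrow> f n = g n" "ltE (f a) (g a)" using fg by (rule lexE)
  obtain b where b: "b \<in> N" "\<forall>n\<in>N. ltN n b \<longrightarrow> g n = h n" "ltE (g b) (h b)" using gh by (rule lexE)
  consider "a = b" | "ltN a b" | "ltN b a" using N_total a b by blast
  then show ?thesis
  proof cases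
    case 1
    have "ltE (f a) (h a)"
      using E_trans[OF Fn_E[OF F(1)] Fn_E[OF F(2)] Fn_E[OF F(3)], of a a a] a b 1 by simp
    then show ?thesis using a b 1 by (intro lexI[of a]) auto
  next
    case 2
    have "g n = h n" if "n \<in> N" "ltN n a" for n
      using b(2)[rule_format, OF that(1) N_trans[OF that(1) a(1) b(1) that(2) 2]] .
    then show ?thesis using a b(2)[rule_format, OF a(1) 2] by (intro lexI[of a]) auto
  next
    case 3
    have "f n = g n" if "n \<in> N" "ltN n b" for n
      using a(2)[rule_format, OF that(1) N_trans[OF that(1) b(1) a(1) that(2) 3]] .
    then show ?thesis using b a(2)[rule_format, OF b(1) 3] by (intro lexI[of b]) auto
  qed
qed

lemma lex_total: assumes F: "f \<in> Fn" "g \<in> Fn" "f \<noteq> g" shows "lex f g \<or> lex g f"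
proof -
  obtain d where d: "d \<in> N" "f d \<noteq> g d" "\<forall>n\<in>N. ltN n d \<longrightarrow> f n = g n"
    by (rule first_difference[OF F])
  then have "ltE (f d) (g d) \<or> ltE (g d) (f d)" using E_total[OF Fn_E Fn_E] F by blast
  then show ?thesis
  proof
    assume "ltE (f d) (g d)"
    then have "lex f g" using d by (intro lexI[of d]) auto
    then show ?thesis ..
  next
    assume "ltE (g d) (f d)"
    then have "lex g f" using d by (intro lexI[of d]) auto
    then show ?thesis ..
  qed
qed

lemma lex_linear_Fn: "linear_on lex Fn"
  unfolding linear_on_def
proof (intro conjI ballI impI)
  show "\<not> lex f f" if "f \<in> Fn" for f using that by (rule lex_irrefl)
  show "lex f h" if "f \<in> Fn" "g \<in> Fn" "h \<in> Fn" "lex f g" "lex g h" for f g h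
    using that by (rule lex_trans)
  show "lex f g \<or> lex g f" if "f \<in> Fn" "g \<in> Fn" "f \<noteq> g" for f g using that by (rule lex_total)
qed

lemma Q_irrefl: "f \<in> Q \<Longrightarrow> \<not> lex f f"
  and Q_total: "f \<in> Q \<Longrightarrow> g \<in> Q \<Longrightarrow> f \<noteq> g \<Longrightarrow> lex f g \<or> lex g f"
  using lex_irrefl lex_total Q_Fn by auto

lemma Q_trans: "f \<in> Q \<Longrightarrow> g \<in> Q \<Longrightarrow> h \<in> Q \<Longrightarrow> lex f g \<Longrightarrow> lex g h \<Longrightarrow> lex f h"
  by (rule lex_trans[of f g h]) (simp_all add: Q_def)

lemma Q_asym: "f \<in> Q \<Longrightarrow> g \<in> Q \<Longrightarrow> lex f g \<Longrightarrow> \<not> lex g f"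
  using Q_trans[of f g f] Q_irrefl[of f] by blast

text \<open>
  The function that follows \<open>s\<close> on the initial segment \<open>H\<close>, then takes the extreme value \<open>c\<close>
  (least or greatest) up to \<open>d\<close>, and the default value from there on. As \<open>d\<close> grows, these
  functions exhaust the cone of the extensions of \<open>s\<close> downwards or upwards; since \<open>N\<close> has
  uncountable cofinality, no countable set of functions does.
\<close>

definition pad :: "'n set \<Rightarrow> ('n \<Rightarrow> 'e) \<Rightarrow> 'e \<Rightarrow> 'n \<Rightarrow> 'n \<Rightarrow> 'e" where
  "pad H s c d n = (if n \<notin> N then e0 else if n \<in> H then s n else if ltN n d then c else e0)"

lemma pad_in_Q:
  assumes H: "H \<subseteq> N" "k \<in> N" "\<And>n. n \<in> H \<Longrightarrow> ltN n k" and d: "d \<in> N" and c: "c \<in> EL"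
    and s: "\<And>n. n \<in> H \<Longrightarrow> s n \<in> E" "countable {n\<in>H. s n \<notin> EL}"
  shows "pad H s c d \<in> Q"
proof -
  obtain m where m: "m \<in> N" "ltN k m" "ltN d m" using N_above2[OF H(2) d] .
  have "pad H s c d n = e0" if "n \<in> N" "ltN m n" for n
  proof -
    have "ltN d n" using N_trans[OF d m(1) that(1) m(3) that(2)] .
    moreover have "ltN k n" using N_trans[OF H(2) m(1) that(1) m(2) that(2)] .
    ultimately show ?thesis
      using N_asym[OF d that(1)] N_asym[OF H(2) that(1)] H(3)[of n] by (auto simp: pad_def)
  qed
  moreover have "{n\<in>N. pad H s c d n \<notin> EL} \<subseteq> {n\<in>H. s n \<notin> EL}"
    using c EL by (auto simp: pad_def)
  then have "countable {n\<in>N. pad H s c d n \<notin> EL}" using s(2) countable_subset by blast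
  moreover have "pad H s c d \<in> Fn" using s(1) c EL E_mem by (auto simp: Fn_def pad_def)
  ultimately show ?thesis unfolding Q_def using m(1) by blast
qed

text \<open>
  Beyond the support of \<open>r\<close> and beyond \<open>H\<close>, the function \<open>r\<close> takes the default value, which is neither
  \<open>bt\<close> nor \<open>tp\<close>. So the first difference to the padded function occurs where the latter is extreme.
\<close>

lemma pad_eventually:
  assumes H: "H \<subseteq> N" "k \<in> N" "\<And>n. n \<in> H \<Longrightarrow> ltN n k" and r: "r \<in> Q" "\<And>n. n \<in> H \<Longrightarrow> r n = s n"
  shows "\<exists>m\<in>N. \<forall>d\<in>N. ltN m d \<longrightarrow> lex (pad H s bt d) r \<and> lex r (pad H s tp d)"
proof -
  obtain a where a: "a \<in> N" "\<forall>n\<in>N. ltN a n \<longrightarrow> r n = e0" using r(1) unfolding Q_def by blast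
  obtain m where m: "m \<in> N" "ltN k m" "ltN a m" using N_above2[OF H(2) a(1)] .
  have rm: "r m = e0" using a(2) m by blast
  have mH: "m \<notin> H" using H(3)[of m] N_asym[OF H(2) m(1) m(2)] by blast
  have ne: "e0 \<noteq> bt" "e0 \<noteq> tp" using bt_e0 e0_tp E_irrefl[OF E_mem(2)] by auto
  have *: "\<exists>d'\<in>N. (\<forall>n\<in>N. ltN n d' \<longrightarrow> r n = pad H s c d n) \<and> r d' \<noteq> c \<and> pad H s c d d' = c"
    if d: "d \<in> N" "ltN m d" and c: "c = bt \<or> c = tp" for c d
  proof -
    have "r m \<noteq> pad H s c d m" using rm m(1) mH d(2) c ne by (auto simp: pad_def)
    then obtain d' where d': "d' \<in> N" "r d' \<noteq> pad H s c d d'"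
      "\<forall>n\<in>N. ltN n d' \<longrightarrow> \<not> r n \<noteq> pad H s c d n"
      by (rule N_least[of m "\<lambda>n. r n \<noteq> pad H s c d n", OF m(1)])
    have "\<not> ltN m d'" using d'(3) m(1) \<open>r m \<noteq> pad H s c d m\<close> by blast
    then have "d' = m \<or> ltN d' m" using N_total[OF m(1) d'(1)] by blast
    then have "ltN d' d" using d N_trans[OF d'(1) m(1) d(1)] by blast
    moreover have "d' \<notin> H" using r(2)[of d'] d'(1,2) by (auto simp: pad_def)
    ultimately have "pad H s c d d' = c" using d'(1) by (simp add: pad_def)
    then show ?thesis using d' by (intro bexI[of _ d']) auto
  qed
  have "lex (pad H s bt d) r \<and> lex r (pad H s tp d)" if d: "d \<in> N" "ltN m d" for d
  proof
    obtain d' where "d' \<in> N" "\<forall>n\<in>N. ltN n d' \<longrightarrow> r n = pad H s bt d n" "r d' \<noteq> bt" "pad H s bt d d' = bt"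
      using *[OF d, of bt] by blast
    then show "lex (pad H s bt d) r" using bt_least[OF Q_E[OF r(1)]] by (intro lexI[of d']) auto
    obtain d' where "d' \<in> N" "\<forall>n\<in>N. ltN n d' \<longrightarrow> r n = pad H s tp d n" "r d' \<noteq> tp" "pad H s tp d d' = tp"
      using *[OF d, of tp] by blast
    then show "lex r (pad H s tp d)" using tp_greatest[OF Q_E[OF r(1)]] by (intro lexI[of d']) auto
  qed
  then show ?thesis using m(1) by blast
qed

lemma common_bound:
  assumes "countable R" "\<And>r. r \<in> R \<Longrightarrow> \<exists>m\<in>N. \<forall>d\<in>N. ltN m d \<longrightarrow> Pr r d"
  obtains d where "d \<in> N" "\<forall>r\<in>R. Pr r d"
proof -
  obtain m where m: "\<And>r. r \<in> R \<Longrightarrow> m r \<in> N \<and> (\<forall>d\<in>N. ltN (m r) d \<longrightarrow> Pr r d)" using assms(2) by metis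
  then have "m ` R \<subseteq> N" "countable (m ` R)" using assms(1) by auto
  then obtain d where "d \<in> N" "\<forall>k\<in>m ` R. ltN k d" using N_bounded by meson
  then show ?thesis using that[of d] m by blast
qed

end

section \<open>Cuts in the lexicographic order\<close>


locale lex_cut = lex_functions +
  fixes D
  assumes D_sub: "D \<subseteq> Q" and D_initial: "\<And>p q. q \<in> D \<Longrightarrow> p \<in> Q \<Longrightarrow> lex p q \<Longrightarrow> p \<in> D"
begin

abbreviation "U \<equiv> Q - D"

lemma DQ: "l \<in> D \<Longrightarrow> l \<in> Q" using D_sub by blast

definition agree :: "('a \<Rightarrow> 'b) \<Rightarrow> ('a \<Rightarrow> 'b) \<Rightarrow> 'a \<Rightarrow> bool" where
  "agree l r b \<longleftrightarrow> (\<forall>m\<in>N. m = b \<or> ltN m b \<longrightarrow> l m = r m)"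

lemma agreeD: "agree l r b \<Longrightarrow> m \<in> N \<Longrightarrow> m = b \<or> ltN m b \<Longrightarrow> l m = r m"
  unfolding agree_def by blast

lemma agree_mono: "agree l r b \<Longrightarrow> b \<in> N \<Longrightarrow> m \<in> N \<Longrightarrow> ltN m b \<Longrightarrow> agree l r m"
  unfolding agree_def using N_trans[of _ m b] by blast

text \<open>
  The levels at which the two parts of the cut still share an initial piece. They form an initial
  segment of \<open>N\<close>, and the shared pieces are unique; together they form the branch \<open>spine\<close> along
  which the cut splits the tree.
\<close>

definition split_levels :: "'a set" where
  "split_levels = {b\<in>N. \<exists>l\<in>D. \<exists>r\<in>U. agree l r b}"

abbreviation "A \<equiv> split_levels"

lemma A_N: "b \<in> A \<Longrightarrow> b \<in> N" by (simp add: split_levels_def)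

text \<open>
  Since \<open>l\<close> lies between \<open>l0\<close> and \<open>r0\<close>, it follows whatever these have in common.
\<close>

lemma agree_low:
  assumes l0: "l0 \<in> D" and l: "l \<in> D" and r0: "r0 \<in> U" and b: "b \<in> N" "agree l0 r0 b" and less: "lex l0 l"
  shows "agree l0 l b"
proof -
  obtain d where d: "d \<in> N" "\<forall>n\<in>N. ltN n d \<longrightarrow> l0 n = l n" "ltE (l0 d) (l d)" using less by (rule lexE)
  have "\<not> (d = b \<or> ltN d b)"
  proof
    assume db: "d = b \<or> ltN d b"
    have eq: "l0 n = r0 n" if "n \<in> N" "n = d \<or> ltN n d" for n
      using agreeD[OF b(2) that(1)] that db N_trans[OF that(1) d(1) b(1)] by blast
    have "lex r0 l"
    proof (rule lexI[OF d(1)])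
      show "r0 n = l n" if "n \<in> N" "ltN n d" for n using eq[OF that(1)] d(2) that by simp
      show "ltE (r0 d) (l d)" using eq[OF d(1)] d(3) by simp
    qed
    then show False using D_initial[OF l] r0 by blast
  qed
  then have bd: "ltN b d" using N_total[OF d(1) b(1)] by blast
  show ?thesis unfolding agree_def
  proof (intro ballI impI)
    fix m assume m: "m \<in> N" "m = b \<or> ltN m b"
    then have "ltN m d" using bd N_trans[OF m(1) b(1) d(1)] by blast
    then show "l0 m = l m" using d(2) m(1) by blast
  qed
qed

lemma agree_high:
  assumes l0: "l0 \<in> D" and r: "r \<in> U" and r0: "r0 \<in> U" and b: "b \<in> N" "agree l0 r0 b" and less: "lex r r0"
  shows "agree r r0 b"
proof -
  obtain d where d: "d \<in> N" "\<forall>n\<in>N. ltN n d \<longrightarrow> r n = r0 n" "ltE (r d) (r0 d)" using less by (rule lexE)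
  have "\<not> (d = b \<or> ltN d b)"
  proof
    assume db: "d = b \<or> ltN d b"
    have eq: "l0 n = r0 n" if "n \<in> N" "n = d \<or> ltN n d" for n
      using agreeD[OF b(2) that(1)] that db N_trans[OF that(1) d(1) b(1)] by blast
    have "lex r l0"
    proof (rule lexI[OF d(1)])
      show "r n = l0 n" if "n \<in> N" "ltN n d" for n using eq[OF that(1)] d(2) that by simp
      show "ltE (r d) (l0 d)" using eq[OF d(1)] d(3) by simp
    qed
    then show False using D_initial[OF l0] r by blast
  qed
  then have bd: "ltN b d" using N_total[OF d(1) b(1)] by blast
  show ?thesis unfolding agree_def
  proof (intro ballI impI)
    fix m assume m: "m \<in> N" "m = b \<or> ltN m b"
    then have "ltN m d" using bd N_trans[OF m(1) b(1) d(1)] by blast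
    then show "r m = r0 m" using d(2) m(1) by blast
  qed
qed

lemma agree_unique:
  assumes "l \<in> D" "l' \<in> D" "r \<in> U" "r' \<in> U" "b \<in> N" "agree l r b" "agree l' r' b"
  shows "agree l l' b"
proof -
  consider "l = l'" | "lex l l'" | "lex l' l" using Q_total[OF DQ DQ] assms by blast
  then show ?thesis
  proof cases
    case 1 then show ?thesis by (simp add: agree_def)
  next
    case 2 then show ?thesis using agree_low[OF assms(1,2,3,5,6)] by simp
  next
    case 3 then have "agree l' l b" using agree_low[OF assms(2,1,4,5,7)] by simp
    then show ?thesis unfolding agree_def by simp
  qed
qed

definition Lo :: "'a \<Rightarrow> 'a \<Rightarrow> 'b" where "Lo b = (SOME l. l \<in> D \<and> (\<exists>r\<in>U. agree l r b))"
definition Hi :: "'a \<Rightarrow> 'a \<Rightarrow> 'b" where "Hi b = (SOME r. r \<in> U \<and> agree (Lo b) r b)"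

definition spine :: "'a \<Rightarrow> 'b" where "spine b = Lo b b"

lemma Lo_Hi: assumes "b \<in> A" shows "Lo b \<in> D" "Hi b \<in> U" "agree (Lo b) (Hi b) b"
proof -
  have "\<exists>l. l \<in> D \<and> (\<exists>r\<in>U. agree l r b)" using assms unfolding split_levels_def by blast
  from someI_ex[OF this] have 1: "Lo b \<in> D \<and> (\<exists>r\<in>U. agree (Lo b) r b)" unfolding Lo_def .
  then have "\<exists>r. r \<in> U \<and> agree (Lo b) r b" by blast
  from someI_ex[OF this] have 2: "Hi b \<in> U \<and> agree (Lo b) (Hi b) b" unfolding Hi_def .
  show "Lo b \<in> D" "Hi b \<in> U" "agree (Lo b) (Hi b) b" using 1 2 by simp_all
qed

lemma A_initial: "b \<in> A \<Longrightarrow> m \<in> N \<Longrightarrow> ltN m b \<Longrightarrow> m \<in> A"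
  using Lo_Hi[of b] agree_mono[of "Lo b" "Hi b" b m] A_N[of b] by (auto simp: split_levels_def)

lemma spine_eq:
  assumes b: "b \<in> N" and lr: "l \<in> D" "r \<in> U" "agree l r b" and m: "m \<in> N" "m = b \<or> ltN m b"
  shows "l m = spine m" "r m = spine m"
proof -
  have lrm: "agree l r m" using agree_mono[OF lr(3) b m(1)] m(2) lr(3) by blast
  then have mA: "m \<in> A" using lr m(1) by (auto simp: split_levels_def)
  have "agree l (Lo m) m" using agree_unique[OF lr(1) Lo_Hi(1)[OF mA] lr(2) Lo_Hi(2)[OF mA] m(1) lrm Lo_Hi(3)[OF mA]] .
  then show l: "l m = spine m" using agreeD[of l "Lo m" m m] m(1) by (simp add: spine_def)
  show "r m = spine m" using agreeD[OF lrm m(1)] l by simp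
qed

lemma Lo_spine: "b \<in> A \<Longrightarrow> m \<in> N \<Longrightarrow> m = b \<or> ltN m b \<Longrightarrow> Lo b m = spine m"
  and Hi_spine: "b \<in> A \<Longrightarrow> m \<in> N \<Longrightarrow> m = b \<or> ltN m b \<Longrightarrow> Hi b m = spine m"
  using spine_eq[OF A_N Lo_Hi] by blast+

lemma spine_E: "m \<in> A \<Longrightarrow> spine m \<in> E"
  unfolding spine_def using Q_E[OF DQ[OF Lo_Hi(1)]] A_N by blast

definition cone :: "('a \<Rightarrow> 'b) \<Rightarrow> bool" where "cone f \<longleftrightarrow> (\<forall>m\<in>A. f m = spine m)"

lemma leaves_cone:
  assumes "\<not> cone f"
  obtains m where "m \<in> A" "f m \<noteq> spine m" "\<forall>k\<in>N. ltN k m \<longrightarrow> f k = spine k"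
proof -
  obtain n where n: "n \<in> A" "f n \<noteq> spine n" using assms unfolding cone_def by blast
  then obtain m where m: "m \<in> N" "m \<in> A \<and> f m \<noteq> spine m" "\<forall>k\<in>N. ltN k m \<longrightarrow> \<not> (k \<in> A \<and> f k \<noteq> spine k)"
    using N_least[of n "\<lambda>n. n \<in> A \<and> f n \<noteq> spine n"] A_N by metis
  then show ?thesis using that[of m] A_initial by blast
qed

lemma low_leaves_cone:
  assumes "f \<in> D" "\<not> cone f"
  obtains m where "m \<in> A" "ltE (f m) (spine m)" "\<forall>k\<in>N. ltN k m \<longrightarrow> f k = spine k"
proof -
  obtain m where m: "m \<in> A" "f m \<noteq> spine m" "\<forall>k\<in>N. ltN k m \<longrightarrow> f k = spine k"
    using assms(2) by (rule leaves_cone)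
  have "\<not> ltE (spine m) (f m)"
  proof
    assume "ltE (spine m) (f m)"
    then have "lex (Hi m) f" using m Hi_spine[OF m(1)] A_N[OF m(1)] by (intro lexI[of m]) auto
    then show False using D_initial[OF assms(1)] Lo_Hi(2)[OF m(1)] by blast
  qed
  then have "ltE (f m) (spine m)"
    using E_total[OF Q_E[OF DQ[OF assms(1)] A_N[OF m(1)]] spine_E[OF m(1)] m(2)] by blast
  then show ?thesis using that[of m] m by blast
qed

lemma high_leaves_cone:
  assumes "f \<in> U" "\<not> cone f"
  obtains m where "m \<in> A" "ltE (spine m) (f m)" "\<forall>k\<in>N. ltN k m \<longrightarrow> f k = spine k"
proof -
  obtain m where m: "m \<in> A" "f m \<noteq> spine m" "\<forall>k\<in>N. ltN k m \<longrightarrow> f k = spine k"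
    using assms(2) by (rule leaves_cone)
  have "\<not> ltE (f m) (spine m)"
  proof
    assume "ltE (f m) (spine m)"
    then have "lex f (Lo m)" using m Lo_spine[OF m(1)] A_N[OF m(1)] by (intro lexI[of m]) auto
    then show False using D_initial[OF Lo_Hi(1)[OF m(1)]] assms(1) by blast
  qed
  then have "ltE (spine m) (f m)"
    using E_total[OF Q_E[of f m] spine_E[OF m(1)] m(2)] A_N[OF m(1)] assms(1) by blast
  then show ?thesis using that[of m] m by blast
qed

lemma first_unsplit:
  assumes "A \<noteq> N"
  obtains \<mu> where "\<mu> \<in> N" "\<mu> \<notin> A" "A = {n\<in>N. ltN n \<mu>}"
proof -
  obtain n where "n \<in> N" "n \<notin> A" using assms A_N by blast
  then obtain \<mu> where \<mu>: "\<mu> \<in> N" "\<mu> \<notin> A" "\<forall>k\<in>N. ltN k \<mu> \<longrightarrow> \<not> k \<notin> A"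
    using N_least[of n "\<lambda>n. n \<notin> A"] by metis
  have "ltN n \<mu>" if n: "n \<in> A" for n
    using N_total[OF A_N[OF n] \<mu>(1)] n \<mu>(2) A_initial[OF n \<mu>(1)] by blast
  then have "A = {n\<in>N. ltN n \<mu>}" using \<mu>(3) A_N by blast
  then show ?thesis using that \<mu> by blast
qed

text \<open>
  If the upper part of the cut meets the cone of the spine, let \<open>b\<close> be the least value taken by its
  members of the cone at the first level \<open>\<mu>\<close> after the spine. Because \<open>\<mu>\<close> is not a common level, the
  whole cone over the spine extended by \<open>b\<close> belongs to the upper part. So the padded functions
  descend coinitially in the upper part.
\<close>

lemma high_cone:
  assumes "A \<noteq> N" and r0: "r0 \<in> U" "cone r0"
  shows "\<exists>u. (\<forall>d\<in>N. u d \<in> U) \<and> (\<forall>r\<in>U. \<exists>m\<in>N. \<forall>d\<in>N. ltN m d \<longrightarrow> lex (u d) r)"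
proof -
  obtain \<mu> where \<mu>: "\<mu> \<in> N" "\<mu> \<notin> A" "A = {n\<in>N. ltN n \<mu>}" using assms(1) by (rule first_unsplit)
  have "r0 \<mu> \<in> E" using Q_E r0 \<mu> by blast
  then have "\<exists>b\<in>E. (\<exists>r\<in>U. cone r \<and> r \<mu> = b) \<and> (\<forall>y\<in>E. ltE y b \<longrightarrow> \<not> (\<exists>r\<in>U. cone r \<and> r \<mu> = y))"
    using wfp_on_minimal[OF E_wf, of "r0 \<mu>" "\<lambda>b. \<exists>r\<in>U. cone r \<and> r \<mu> = b"] r0 by blast
  then obtain r1 where r1: "r1 \<in> U" "cone r1"
    "\<And>r. r \<in> U \<Longrightarrow> cone r \<Longrightarrow> \<not> ltE (r \<mu>) (r1 \<mu>)" using Q_E \<mu>(1) by blast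
  let ?H = "{n\<in>N. n = \<mu> \<or> ltN n \<mu>}"
  let ?u = "pad ?H r1 bt"
  obtain k where k: "k \<in> N" "ltN \<mu> k" using N_above2[OF \<mu>(1) \<mu>(1)] by metis
  have H: "?H \<subseteq> N" "k \<in> N" "\<And>n. n \<in> ?H \<Longrightarrow> ltN n k" using k by (auto intro: N_trans[OF _ \<mu>(1) k(1) _ k(2)])
  have r1spine: "r1 n = spine n" if "n \<in> N" "ltN n \<mu>" for n
    using that r1(2) \<mu>(3) unfolding cone_def by blast
  have "\<forall>d\<in>N. ?u d \<in> U"
  proof
    fix d assume d: "d \<in> N"
    have r1Q: "r1 \<in> Q" using r1(1) by blast
    have "{n\<in>?H. r1 n \<notin> EL} \<subseteq> {n\<in>N. r1 n \<notin> EL}" by blast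
    moreover have "countable {n\<in>N. r1 n \<notin> EL}" using r1Q unfolding Q_def by (elim CollectE conjE)
    ultimately have few: "countable {n\<in>?H. r1 n \<notin> EL}" by (rule countable_subset)
    have uQ: "?u d \<in> Q"
      by (rule pad_in_Q[OF H d EL(2) _ few]) (use Q_E[OF r1Q] in auto)
    have "?u d \<notin> D"
    proof
      assume "?u d \<in> D"
      moreover have "agree (?u d) r1 \<mu>" unfolding agree_def pad_def by auto
      ultimately show False using \<mu>(1,2) r1(1) unfolding split_levels_def by blast
    qed
    then show "?u d \<in> U" using uQ by blast
  qed
  moreover have "\<exists>m\<in>N. \<forall>d\<in>N. ltN m d \<longrightarrow> lex (?u d) r" if r: "r \<in> U" for r
  proof (cases "cone r \<and> r \<mu> = r1 \<mu>")
    case True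
    then have "r n = r1 n" if "n \<in> ?H" for n
      using that r1spine \<mu>(3) unfolding cone_def by auto
    then show ?thesis using pad_eventually[OF H, of r r1] r by blast
  next
    case False
    have "lex (?u d) r" for d
    proof (cases "cone r")
      case True
      then have "r \<mu> \<noteq> r1 \<mu>" using False by blast
      then have "ltE (r1 \<mu>) (r \<mu>)" using r1(3)[OF r True] E_total[OF Q_E Q_E] r r1(1) \<mu>(1) by blast
      then show ?thesis
        using \<mu>(1,3) True r1spine N_irrefl[OF \<mu>(1)] unfolding cone_def
        by (intro lexI[of \<mu>]) (auto simp: pad_def)
    next
      case False
      then obtain m where m: "m \<in> A" "ltE (spine m) (r m)" "\<forall>k\<in>N. ltN k m \<longrightarrow> r k = spine k"
        using high_leaves_cone r by blast
      have mm: "m \<in> N" "ltN m \<mu>" using m(1) \<mu>(3) by auto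
      show ?thesis
      proof (rule lexI[OF mm(1)])
        show "?u d n = r n" if n: "n \<in> N" "ltN n m" for n
          using N_trans[OF n(1) mm(1) \<mu>(1) n(2) mm(2)] m(3) n r1spine by (simp add: pad_def)
        show "ltE (?u d m) (r m)" using mm m(2) r1spine by (simp add: pad_def)
      qed
    qed
    then show ?thesis using \<mu>(1) by blast
  qed
  ultimately show ?thesis by blast
qed

text \<open>
  Otherwise the whole cone belongs to the lower part, and its upward padded functions are
  cofinal there. The hypothesis on \<open>EL\<close> ensures that they lie in \<open>Q\<close>.
\<close>

lemma low_cone:
  assumes "A \<noteq> N" and no: "\<And>r. r \<in> U \<Longrightarrow> \<not> cone r" and few: "countable {n\<in>A. spine n \<notin> EL}"
  shows "\<exists>v. (\<forall>d\<in>N. v d \<in> D) \<and> (\<forall>l\<in>D. \<exists>m\<in>N. \<forall>d\<in>N. ltN m d \<longrightarrow> lex l (v d))"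
proof -
  obtain \<mu> where \<mu>: "\<mu> \<in> N" "\<mu> \<notin> A" "A = {n\<in>N. ltN n \<mu>}" using assms(1) by (rule first_unsplit)
  let ?v = "pad A spine tp"
  have H: "A \<subseteq> N" "\<mu> \<in> N" "\<And>n. n \<in> A \<Longrightarrow> ltN n \<mu>" using \<mu> by auto
  have "\<forall>d\<in>N. ?v d \<in> D"
  proof
    fix d assume d: "d \<in> N"
    have "?v d \<in> Q" by (rule pad_in_Q[OF H d EL(4)]) (use spine_E few in auto)
    moreover have "cone (?v d)" unfolding cone_def pad_def using A_N by auto
    ultimately show "?v d \<in> D" using no by blast
  qed
  moreover have "\<exists>m\<in>N. \<forall>d\<in>N. ltN m d \<longrightarrow> lex l (?v d)" if l: "l \<in> D" for l
  proof (cases "cone l")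
    case True
    then have "l n = spine n" if "n \<in> A" for n using that unfolding cone_def by blast
    then show ?thesis using pad_eventually[OF H, of l spine] DQ[OF l] by blast
  next
    case False
    obtain m where m: "m \<in> A" "ltE (l m) (spine m)" "\<forall>k\<in>N. ltN k m \<longrightarrow> l k = spine k"
      using l False by (rule low_leaves_cone)
    have "lex l (?v d)" for d
      using m A_N[OF m(1)] A_initial[OF m(1)] by (intro lexI[of m]) (auto simp: pad_def)
    then show ?thesis using \<mu>(1) by blast
  qed
  ultimately show ?thesis by blast
qed

text \<open>
  Countable sets on both sides would, by the uncountable cofinality of \<open>N\<close>, make the spine bounded,
  and by agreement with members of the countable lower set it would have countably many values
  outside \<open>EL\<close>. Then one of the two parts contains a cone along which the padded functions run, and
  these escape from every countable set. The lower or upper part may be empty here.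
\<close>

theorem not_both_sides_countable:
  assumes L: "L \<subseteq> D" "countable L" "\<And>p. p \<in> D \<Longrightarrow> \<exists>l\<in>L. p = l \<or> lex p l"
    and R: "R \<subseteq> U" "countable R" "\<And>p. p \<in> U \<Longrightarrow> \<exists>r\<in>R. r = p \<or> lex r p"
  shows False
proof -
  have pairs: "\<exists>l\<in>L. \<exists>r\<in>R. agree l r b \<and> l b = spine b" if b: "b \<in> A" for b
  proof -
    have bN: "b \<in> N" using A_N[OF b] .
    note LH = Lo_Hi[OF b]
    obtain l where l: "l \<in> L" "Lo b = l \<or> lex (Lo b) l" using L(3)[OF LH(1)] by blast
    have 1: "agree (Lo b) l b"
    proof (cases "Lo b = l")
      case True then show ?thesis by (simp add: agree_def)
    next
      case False
      then show ?thesis using agree_low[OF LH(1) _ LH(2) bN LH(3)] l L(1) by blast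
    qed
    obtain r where r: "r \<in> R" "r = Hi b \<or> lex r (Hi b)" using R(3)[OF LH(2)] by blast
    have 2: "agree r (Hi b) b"
    proof (cases "r = Hi b")
      case True then show ?thesis by (simp add: agree_def)
    next
      case False
      then show ?thesis using agree_high[OF LH(1) _ LH(2) bN LH(3)] r R(1) by blast
    qed
    have "agree l r b" using 1 2 LH(3) unfolding agree_def by metis
    moreover from this have "l b = spine b" using spine_eq(1)[OF bN _ _ _ bN] l(1) r(1) L(1) R(1) by blast
    ultimately show ?thesis using l(1) r(1) by blast
  qed
  obtain d where d: "d \<in> N" "\<forall>lr\<in>L \<times> R. \<not> agree (fst lr) (snd lr) d"
  proof (rule common_bound[of "L \<times> R" "\<lambda>lr d. \<not> agree (fst lr) (snd lr) d"])
    show "countable (L \<times> R)" using L(2) R(2) by simp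
    fix lr assume "lr \<in> L \<times> R"
    then obtain l r where lr: "lr = (l, r)" "l \<in> Q" "r \<in> Q" "l \<noteq> r" using L(1) R(1) DQ by blast
    obtain m where m: "m \<in> N" "l m \<noteq> r m" "\<forall>n\<in>N. ltN n m \<longrightarrow> l n = r n"
      by (rule first_difference[of l r]) (use lr Q_Fn in auto)
    then have "\<forall>d\<in>N. ltN m d \<longrightarrow> \<not> agree (fst lr) (snd lr) d"
      unfolding lr(1) agree_def by auto
    then show "\<exists>m\<in>N. \<forall>d\<in>N. ltN m d \<longrightarrow> \<not> agree (fst lr) (snd lr) d" using m(1) by blast
  qed
  have AN: "A \<noteq> N"
  proof
    assume "A = N"
    then obtain l r where "l \<in> L" "r \<in> R" "agree l r d" using pairs d(1) by blast
    then show False using d(2) by fastforce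
  qed
  show False
  proof (cases "\<exists>r\<in>U. cone r")
    case True
    then obtain u where u: "\<forall>d\<in>N. u d \<in> U" "\<forall>r\<in>U. \<exists>m\<in>N. \<forall>d\<in>N. ltN m d \<longrightarrow> lex (u d) r"
      using high_cone[OF AN] by blast
    obtain d where d: "d \<in> N" "\<forall>r\<in>R. lex (u d) r"
      by (rule common_bound[OF R(2), of "\<lambda>r d. lex (u d) r"]) (use u(2) R(1) in blast)+
    have uQ: "u d \<in> U" using u(1) d(1) by blast
    then obtain r where r: "r \<in> R" "r = u d \<or> lex r (u d)" using R(3) by blast
    then show False using bspec[OF d(2) r(1)] Q_irrefl[of r] Q_asym[of r "u d"] uQ R(1) by blast
  next
    case False
    have "{n\<in>A. spine n \<notin> EL} \<subseteq> (\<Union>l\<in>L. {n\<in>N. l n \<notin> EL})"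
    proof
      fix n assume n: "n \<in> {n\<in>A. spine n \<notin> EL}"
      then have nA: "n \<in> A" "spine n \<notin> EL" by auto
      then obtain l where "l \<in> L" "l n = spine n" using pairs[of n] by blast
      then have "l \<in> L" "n \<in> {n\<in>N. l n \<notin> EL}" using nA A_N[OF nA(1)] by simp_all
      then show "n \<in> (\<Union>l\<in>L. {n\<in>N. l n \<notin> EL})" by blast
    qed
    moreover have "countable (\<Union>l\<in>L. {n\<in>N. l n \<notin> EL})"
      using L(1,2) DQ by (intro countable_UN) (auto simp: Q_def)
    ultimately have "countable {n\<in>A. spine n \<notin> EL}" by (rule countable_subset)
    then obtain v where v: "\<forall>d\<in>N. v d \<in> D" "\<forall>l\<in>D. \<exists>m\<in>N. \<forall>d\<in>N. ltN m d \<longrightarrow> lex l (v d)"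
      using low_cone[OF AN] False by blast
    obtain d where d: "d \<in> N" "\<forall>l\<in>L. lex l (v d)"
      by (rule common_bound[OF L(2), of "\<lambda>l d. lex l (v d)"]) (use v(2) L(1) in blast)+
    have vD: "v d \<in> D" using v(1) d(1) by blast
    then obtain l where l: "l \<in> L" "v d = l \<or> lex (v d) l" using L(3) by blast
    then show False using bspec[OF d(2) l(1)] Q_irrefl[of l] Q_asym[of l "v d"] DQ[OF vD] DQ L(1) by blast
  qed
qed

text \<open>
  If the spine runs through all of \<open>N\<close>, the functions \<open>Lo n\<close> are cofinal in the lower part. If it
  stops and its cone meets the upper part, the padded functions are coinitial there; otherwise the
  functions \<open>Hi n\<close> are.
\<close>

theorem short_side:
  assumes nomax: "\<And>p. p \<in> D \<Longrightarrow> \<exists>q\<in>D. lex p q" and ne: "U \<noteq> {}"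
  shows "\<exists>h\<in>Func N Q. D = {p\<in>Q. \<exists>n\<in>N. p = h n \<or> lex p (h n)} \<or>
           U = {p\<in>Q. \<exists>n\<in>N. h n = p \<or> lex (h n) p}"
proof -
  let ?r = "\<lambda>h n. if n \<in> N then h n else undefined"
  have res: "?r h \<in> Func N Q" if "\<And>n. n \<in> N \<Longrightarrow> h n \<in> Q" for h
    using that by (auto simp: Func_def)
  have low: ?thesis if h: "\<And>n. n \<in> N \<Longrightarrow> h n \<in> D" "\<And>p. p \<in> D \<Longrightarrow> \<exists>n\<in>N. p = h n \<or> lex p (h n)" for h
  proof -
    have "D = {p\<in>Q. \<exists>n\<in>N. p = h n \<or> lex p (h n)}"
    proof (intro equalityI subsetI)
      fix p assume "p \<in> D" then show "p \<in> {p\<in>Q. \<exists>n\<in>N. p = h n \<or> lex p (h n)}" using h(2) DQ by simp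
    next
      fix p assume "p \<in> {p\<in>Q. \<exists>n\<in>N. p = h n \<or> lex p (h n)}"
      then obtain n where "p \<in> Q" "n \<in> N" "p = h n \<or> lex p (h n)" by blast
      then show "p \<in> D" using h(1)[of n] D_initial[of "h n" p] by auto
    qed
    also have "\<dots> = {p\<in>Q. \<exists>n\<in>N. p = ?r h n \<or> lex p (?r h n)}" by (simp cong: bex_cong)
    finally have eq: "D = {p\<in>Q. \<exists>n\<in>N. p = ?r h n \<or> lex p (?r h n)}" .
    have "?r h \<in> Func N Q" by (rule res) (rule DQ[OF h(1)])
    with disjI1[OF eq] show ?thesis by (rule bexI)
  qed
  have high: ?thesis if h: "\<And>n. n \<in> N \<Longrightarrow> h n \<in> U" "\<And>p. p \<in> U \<Longrightarrow> \<exists>n\<in>N. h n = p \<or> lex (h n) p" for h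
  proof -
    have "U = {p\<in>Q. \<exists>n\<in>N. h n = p \<or> lex (h n) p}"
    proof (intro equalityI subsetI)
      fix p assume "p \<in> U" then show "p \<in> {p\<in>Q. \<exists>n\<in>N. h n = p \<or> lex (h n) p}" using h(2) by simp
    next
      fix p assume "p \<in> {p\<in>Q. \<exists>n\<in>N. h n = p \<or> lex (h n) p}"
      then obtain n where "p \<in> Q" "n \<in> N" "h n = p \<or> lex (h n) p" by blast
      then show "p \<in> U" using h(1)[of n] D_initial[of p "h n"] by auto
    qed
    also have "\<dots> = {p\<in>Q. \<exists>n\<in>N. ?r h n = p \<or> lex (?r h n) p}" by (simp cong: bex_cong)
    finally have eq: "U = {p\<in>Q. \<exists>n\<in>N. ?r h n = p \<or> lex (?r h n) p}" .
    have "?r h \<in> Func N Q" by (rule res) (rule DiffD1[OF h(1)])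
    with disjI2[OF eq] show ?thesis by (rule bexI)
  qed
  show ?thesis
  proof (cases "A = N")
    case True
    have leave: "\<exists>n\<in>N. lex p (Lo n)" if pl: "p \<in> D" "\<not> cone p" for p
    proof -
      obtain m where m: "m \<in> A" "ltE (p m) (spine m)" "\<forall>k\<in>N. ltN k m \<longrightarrow> p k = spine k"
        using pl by (rule low_leaves_cone)
      then have "lex p (Lo m)" using Lo_spine[OF m(1)] A_N[OF m(1)] by (intro lexI[of m]) auto
      then show ?thesis using A_N[OF m(1)] by blast
    qed
    have "\<not> cone p" if p: "p \<in> D" for p
    proof
      assume c: "cone p"
      obtain q where q: "q \<in> D" "lex p q" using nomax[OF p] by blast
      have "\<not> cone q"
      proof
        assume "cone q"
        then have "p n = q n" if "n \<in> N" for n using c that True unfolding cone_def by simp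
        then have "\<not> lex p q" using E_irrefl[OF Q_E[OF DQ[OF q(1)]]] unfolding lex_def by auto
        then show False using q(2) by blast
      qed
      then obtain n where n: "n \<in> N" "lex q (Lo n)" using leave[OF q(1)] by blast
      obtain m where m: "m \<in> A" "ltE (q m) (spine m)" "\<forall>k\<in>N. ltN k m \<longrightarrow> q k = spine k"
        using q(1) \<open>\<not> cone q\<close> by (rule low_leaves_cone)
      have "lex q p" using m c A_N[OF m(1)] True unfolding cone_def by (intro lexI[of m]) auto
      then show False using q(2) Q_asym DQ p q(1) by blast
    qed
    then have "\<exists>n\<in>N. p = Lo n \<or> lex p (Lo n)" if "p \<in> D" for p using leave[OF that] that by blast
    moreover have "Lo n \<in> D" if "n \<in> N" for n using Lo_Hi(1)[of n] that True by simp
    ultimately show ?thesis by (intro low[of Lo])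
  next
    case False
    show ?thesis
    proof (cases "\<exists>r\<in>U. cone r")
      case True
      then obtain u where u: "\<forall>d\<in>N. u d \<in> U" "\<forall>r\<in>U. \<exists>m\<in>N. \<forall>d\<in>N. ltN m d \<longrightarrow> lex (u d) r"
        using high_cone[OF False] by blast
      have "\<exists>n\<in>N. lex (u n) r" if r: "r \<in> U" for r
      proof -
        obtain m where m: "m \<in> N" "\<forall>d\<in>N. ltN m d \<longrightarrow> lex (u d) r" using u(2) r by blast
        obtain d where "d \<in> N" "ltN m d" using N_above2[OF m(1) m(1)] by metis
        then show ?thesis using m(2) by blast
      qed
      then have "\<exists>n\<in>N. u n = r \<or> lex (u n) r" if "r \<in> U" for r using that by blast
      moreover have "u n \<in> U" if "n \<in> N" for n using u(1) that by blast
      ultimately show ?thesis by (intro high[of u])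
    next
      case no: False
      have leave: "\<exists>m\<in>A. lex (Hi m) p" if p: "p \<in> U" for p
      proof -
        have "\<not> cone p" using no p by blast
        with p obtain m where m: "m \<in> A" "ltE (spine m) (p m)" "\<forall>k\<in>N. ltN k m \<longrightarrow> p k = spine k"
          by (rule high_leaves_cone)
        then have "lex (Hi m) p" using Hi_spine[OF m(1)] A_N[OF m(1)] by (intro lexI[of m]) auto
        then show ?thesis using m(1) by blast
      qed
      then obtain m0 where m0: "m0 \<in> A" using ne by blast
      show ?thesis
      proof (rule high[of "\<lambda>n. if n \<in> A then Hi n else Hi m0"])
        show "(if n \<in> A then Hi n else Hi m0) \<in> U" for n using Lo_Hi(2) m0 by auto
        show "\<exists>n\<in>N. (if n \<in> A then Hi n else Hi m0) = p \<or> lex (if n \<in> A then Hi n else Hi m0) p"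
          if "p \<in> U" for p
          using leave[OF that] A_N by auto
      qed
    qed
  qed
qed

end

section \<open>The coded linear orders\<close>

definition lexp :: "('a \<Rightarrow> 'a \<Rightarrow> bool) \<Rightarrow> ('b \<Rightarrow> 'b \<Rightarrow> bool) \<Rightarrow> 'a \<times> 'b \<Rightarrow> 'a \<times> 'b \<Rightarrow> bool" where
  "lexp R R' p q \<longleftrightarrow> R (fst p) (fst q) \<or> fst p = fst q \<and> R' (snd p) (snd q)"

lemma linear_on_subset: assumes "linear_on R X" "Y \<subseteq> X" shows "linear_on R Y"
proof -
  note l = assms(1)
  have in_X: "x \<in> Y \<Longrightarrow> x \<in> X" for x using assms(2) by blast
  show ?thesis
  proof (rule linear_onI)
    show "R x z" if "x \<in> Y" "y \<in> Y" "z \<in> Y" "R x y" "R y z" for x y z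
      by (rule l[THEN linear_on_trans, OF in_X in_X in_X]) (use that in auto)
    show "\<not> R x x" if "x \<in> Y" for x using l[THEN linear_on_irrefl] in_X that by blast
    show "R x y \<or> R y x" if "x \<in> Y" "y \<in> Y" "x \<noteq> y" for x y
      using l[THEN linear_on_total] in_X that by blast
  qed
qed

lemma linear_on_lexp:
  assumes "linear_on R A" "linear_on R' B" shows "linear_on (lexp R R') (A \<times> B)"
proof -
  note a = assms(1) and b = assms(2)
  show ?thesis
  proof (rule linear_onI)
    show "\<not> lexp R R' p p" if "p \<in> A \<times> B" for p
      using that a[THEN linear_on_irrefl] b[THEN linear_on_irrefl] by (auto simp: lexp_def)
    show "lexp R R' p q \<or> lexp R R' q p" if "p \<in> A \<times> B" "q \<in> A \<times> B" "p \<noteq> q" for p q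
    proof (cases "fst p = fst q")
      case True
      then have "snd p \<noteq> snd q" using that(3) by (simp add: prod_eq_iff)
      then have "R' (snd p) (snd q) \<or> R' (snd q) (snd p)"
        using b[THEN linear_on_total] that(1,2) by (auto simp: mem_Times_iff)
      then show ?thesis using True by (auto simp: lexp_def)
    next
      case False
      then have "R (fst p) (fst q) \<or> R (fst q) (fst p)"
        using a[THEN linear_on_total] that(1,2) by (auto simp: mem_Times_iff)
      then show ?thesis by (auto simp: lexp_def)
    qed
    fix p q r assume m: "p \<in> A \<times> B" "q \<in> A \<times> B" "r \<in> A \<times> B" and l: "lexp R R' p q" "lexp R R' q r"
    have ta: "R (fst p) (fst r)" if "R (fst p) (fst q)" "R (fst q) (fst r)"
      by (rule a[THEN linear_on_trans, of _ "fst q"]) (use m that in auto)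
    have tb: "R' (snd p) (snd r)" if "R' (snd p) (snd q)" "R' (snd q) (snd r)"
      by (rule b[THEN linear_on_trans, of _ "snd q"]) (use m that in auto)
    show "lexp R R' p r" using l ta tb unfolding lexp_def by auto
  qed
qed

lemma linear_on_int: "linear_on (<) (UNIV :: int set)"
  by (rule linear_onI) auto

lemma int_bounded_below_least:
  fixes a :: int
  assumes "n \<in> Z" "\<And>m. m \<in> Z \<Longrightarrow> a \<le> m"
  obtains m where "m \<in> Z" "\<forall>k\<in>Z. m \<le> k"
proof -
  obtain m where m: "m \<in> Z" "\<And>k. k \<in> Z \<Longrightarrow> nat (m - a) \<le> nat (k - a)"
    using ex_has_least_nat[of "\<lambda>m. m \<in> Z" n "\<lambda>m. nat (m - a)"] assms(1) by auto
  have "m \<le> k" if "k \<in> Z" for k using m(2)[OF that] assms(2)[OF that] assms(2)[OF m(1)] by linarith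
  then show ?thesis using that m(1) by blast
qed

context lex_functions
begin

lemma default_in_Q: "(\<lambda>_. e0) \<in> Q"
  using N_ne EL E_mem by (auto simp: Q_def Fn_def)

lemma update_in_Q:
  assumes f: "f \<in> Q" and d: "d \<in> N" and x: "x \<in> E" shows "f(d := x) \<in> Q"
proof -
  obtain a where a: "a \<in> N" "\<forall>n\<in>N. ltN a n \<longrightarrow> f n = e0" using f unfolding Q_def by blast
  obtain m where m: "m \<in> N" "ltN a m" "ltN d m" by (rule N_above2[OF a(1) d])
  have "(f(d := x)) n = e0" if n: "n \<in> N" "ltN m n" for n
  proof -
    have "ltN a n" "ltN d n" using N_trans[OF a(1) m(1) n(1) m(2) n(2)] N_trans[OF d m(1) n(1) m(3) n(2)] .
    then show ?thesis using a(2) n(1) N_irrefl[OF n(1)] by auto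
  qed
  moreover have "countable {n\<in>N. (f(d := x)) n \<notin> EL}"
  proof (rule countable_subset)
    show "{n\<in>N. (f(d := x)) n \<notin> EL} \<subseteq> insert d {n\<in>N. f n \<notin> EL}" by auto
    have "countable {n\<in>N. f n \<notin> EL}" using f unfolding Q_def by (elim CollectE conjE)
    then show "countable (insert d {n\<in>N. f n \<notin> EL})" by simp
  qed
  moreover have "f(d := x) \<in> Fn" using f d x by (auto simp: Q_def Fn_def)
  ultimately show ?thesis unfolding Q_def using m(1) by blast
qed

text \<open>
  Above \<open>f\<close> there are disjoint intervals indexed by the values above the default: change \<open>f\<close> to \<open>x\<close> at
  an argument beyond its support. If \<open>Pr\<close> fails, the argument is also chosen beyond the first
  difference to \<open>g\<close>, and the intervals lie below \<open>g\<close>; a true \<open>Pr\<close> drops this upper bound.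
\<close>

lemma disjoint_cones:
  assumes f: "f \<in> Q" and Pr: "Pr \<or> (g \<in> Fn \<and> lex f g)"
  shows "\<exists>u v. (\<forall>x\<in>{x\<in>E. ltE e0 x}. u x \<in> Q \<and> v x \<in> Q \<and> lex f (u x) \<and> lex (u x) (v x) \<and> (Pr \<or> lex (v x) g)) \<and>
     (\<forall>x\<in>{x\<in>E. ltE e0 x}. \<forall>y\<in>{x\<in>E. ltE e0 x}. x \<noteq> y \<longrightarrow> lex (v x) (u y) \<or> lex (v y) (u x))"
proof -
  obtain a where a: "a \<in> N" "\<forall>n\<in>N. ltN a n \<longrightarrow> f n = e0" using f unfolding Q_def by blast
  obtain b where b: "b \<in> N" "Pr \<or> (\<forall>n\<in>N. ltN n b \<longrightarrow> f n = g n) \<and> ltE (f b) (g b)"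
  proof (cases Pr)
    case True then show ?thesis using that[OF a(1)] by blast
  next
    case False
    then have "lex f g" using Pr by blast
    then obtain b where "b \<in> N" "\<forall>n\<in>N. ltN n b \<longrightarrow> f n = g n" "ltE (f b) (g b)" by (rule lexE)
    then show ?thesis using that[of b] by blast
  qed
  obtain d where d: "d \<in> N" "ltN a d" "ltN b d" by (rule N_above2[OF a(1) b(1)])
  obtain e where e: "e \<in> N" "ltN d e" using N_above2[OF d(1) d(1)] by metis
  have ae: "ltN a e" using N_trans[OF a(1) d(1) e(1) d(2) e(2)] .
  have be: "ltN b e" using N_trans[OF b(1) d(1) e(1) d(3) e(2)] .
  have fd: "f d = e0" "f e = e0" using a(2) d(1,2) e(1) ae by blast+
  have de: "d \<noteq> e" "b \<noteq> d" "b \<noteq> e"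
    using e d b N_irrefl[OF e(1)] N_irrefl[OF d(1)] be by auto
  have neq: "n \<noteq> d" "n \<noteq> e" if n: "n \<in> N" "ltN n b \<or> ltN n d" for n
  proof -
    have nd: "ltN n d" using n(2) N_trans[OF n(1) b(1) d(1) _ d(3)] by blast
    then have "ltN n e" using N_trans[OF n(1) d(1) e(1) _ e(2)] by blast
    then show "n \<noteq> d" "n \<noteq> e" using nd N_irrefl[OF n(1)] by auto
  qed
  have neq': "n \<noteq> e" if n: "n \<in> N" "ltN n e" for n using n N_irrefl[OF n(1)] by blast
  let ?u = "\<lambda>x. f(d := x)" and ?v = "\<lambda>x. f(d := x, e := tp)"
  have "?u x \<in> Q \<and> ?v x \<in> Q \<and> lex f (?u x) \<and> lex (?u x) (?v x) \<and> (Pr \<or> lex (?v x) g)"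
    if x: "x \<in> E" "ltE e0 x" for x
  proof (intro conjI)
    show u: "?u x \<in> Q" by (rule update_in_Q[OF f d(1) x(1)])
    show "?v x \<in> Q" by (rule update_in_Q[OF u e(1) E_mem(3)])
    show "lex f (?u x)" using neq fd x d(1) by (intro lexI[of d]) auto
    show "lex (?u x) (?v x)" using neq' fd e0_tp de e(1) by (intro lexI[of e]) auto
    show "Pr \<or> lex (?v x) g"
    proof (cases Pr)
      case False
      then have "(\<forall>n\<in>N. ltN n b \<longrightarrow> f n = g n) \<and> ltE (f b) (g b)" using b(2) by blast
      then have "lex (?v x) g" using neq de b(1) by (intro lexI[of b]) auto
      then show ?thesis ..
    qed blast
  qed
  moreover have "lex (?v x) (?u y)" if x: "ltE x y" for x y
    using neq de d(1) x by (intro lexI[of d]) auto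
  then have "lex (?v x) (?u y) \<or> lex (?v y) (?u x)" if "x \<in> E" "y \<in> E" "x \<noteq> y" for x y
    using E_total[OF that] by blast
  ultimately show ?thesis by (intro exI[of _ ?u] exI[of _ ?v]) auto
qed

lemma Q_greater: assumes "f \<in> Q" shows "\<exists>g\<in>Q. lex f g"
proof -
  have tp: "tp \<in> {x\<in>E. ltE e0 x}" using E_mem e0_tp by simp
  from disjoint_cones[OF assms disjI1[OF TrueI], of undefined]
  obtain u v where "\<forall>x\<in>{x\<in>E. ltE e0 x}. u x \<in> Q \<and> v x \<in> Q \<and> lex f (u x) \<and> lex (u x) (v x) \<and> (True \<or> lex (v x) undefined)"
    by (elim exE conjE)
  from bspec[OF this tp] show ?thesis by blast
qed

end

text \<open>
  \<open>C\<close> replaces each \<open>i\<close> other than \<open>i0\<close> by \<open>\<omega>\<close> many copies of \<open>\<int>\<close> if \<open>i\<close> is in \<open>S\<close>; if not, the first of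
  these copies is replaced by \<open>\<omega>\<close>. The least index \<open>i0\<close> is replaced by \<open>\<int>\<close> many copies of \<open>\<int>\<close>. In \<open>P\<close>
  every element of \<open>C\<close> becomes a block, a copy of \<open>Q\<close>.

  In the completion, a gap between two copies of \<open>\<int>\<close> is approached by a sequence from either side,
  so it is a marker. The markers accumulate from the left at the beginning of each \<open>i \<noteq> i0\<close>, and from
  the right only at the very beginning. The beginning of \<open>i\<close> has countable right character if the
  first copy is \<open>\<int>\<close>, but not if it is \<open>\<omega>\<close>, since then a block follows immediately.
\<close>

locale coded_order = lex_functions N ltN E ltE EL bt e0 tp
  for N :: "'n set" and ltN and E :: "'e set" and ltE EL bt e0 tp +
  fixes I :: "'i set" and ltI :: "'i \<Rightarrow> 'i \<Rightarrow> bool" and i0 :: 'i and S :: "'i set"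
  assumes I_linear: "linear_on ltI I" and I_wf: "wfp_on I ltI" and i0: "i0 \<in> I"
    and i0_least: "\<And>i. i \<in> I \<Longrightarrow> i \<noteq> i0 \<Longrightarrow> ltI i0 i"
    and I_greater: "\<And>i. i \<in> I \<Longrightarrow> \<exists>i'\<in>I. ltI i i'"
begin

definition C :: "('i \<times> int \<times> int) set" where
  "C = {(i, n, k). i \<in> I \<and> (i = i0 \<or> 0 \<le> n \<and> (n = 0 \<and> i \<notin> S \<longrightarrow> 0 \<le> k))}"

abbreviation "ltW \<equiv> lexp ltI ((<) :: int \<Rightarrow> int \<Rightarrow> bool)"
abbreviation "ltC \<equiv> lexp ltI (lexp ((<) :: int \<Rightarrow> int \<Rightarrow> bool) ((<) :: int \<Rightarrow> int \<Rightarrow> bool))"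
abbreviation "ltP \<equiv> lexp ltC lex"
abbreviation "P \<equiv> C \<times> Q"

lemma C_linear: "linear_on ltC C"
  by (rule linear_on_subset[OF linear_on_lexp[OF I_linear linear_on_lexp[OF linear_on_int linear_on_int]]])
    (auto simp: C_def)

lemma Q_linear: "linear_on lex Q" by (rule linear_on_subset[OF lex_linear_Fn Q_Fn])

lemma P_linear: "linear_on ltP P" by (rule linear_on_lexp[OF C_linear Q_linear])

lemma P_cells:
  assumes p: "p \<in> P" and pq: "q \<in> P \<and> ltP p q \<or> q = p"
  shows "\<exists>u v. (\<forall>x\<in>{x\<in>E. ltE e0 x}. u x \<in> P \<and> v x \<in> P \<and> ltP p (u x) \<and> ltP (u x) (v x) \<and> (q = p \<or> ltP (v x) q)) \<and>
     (\<forall>x\<in>{x\<in>E. ltE e0 x}. \<forall>y\<in>{x\<in>E. ltE e0 x}. x \<noteq> y \<longrightarrow> ltP (v x) (u y) \<or> ltP (v y) (u x))"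
proof -
  obtain c f where pc: "p = (c, f)" "c \<in> C" "f \<in> Q" using p by auto
  let ?Pr = "q = p \<or> ltC c (fst q)"
  have "?Pr \<or> (snd q \<in> Fn \<and> lex f (snd q))"
    using pq pc Q_Fn by (auto simp: lexp_def[of ltC lex])
  from disjoint_cones[OF pc(3) this] obtain u v where
    uv: "\<forall>x\<in>{x\<in>E. ltE e0 x}. u x \<in> Q \<and> v x \<in> Q \<and> lex f (u x) \<and> lex (u x) (v x) \<and> (?Pr \<or> lex (v x) (snd q))"
    and sep: "\<forall>x\<in>{x\<in>E. ltE e0 x}. \<forall>y\<in>{x\<in>E. ltE e0 x}. x \<noteq> y \<longrightarrow> lex (v x) (u y) \<or> lex (v y) (u x)"
    by (elim exE conjE)
  have "q = p \<or> ltP (c, g) q" if "?Pr \<or> lex g (snd q)" for g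
    using that pq pc(1) by (auto simp: lexp_def[of ltC lex])
  moreover have same: "ltP (c, g) (c, h)" if "lex g h" for g h
    using that by (simp add: lexp_def[of ltC lex])
  ultimately have "(c, u x) \<in> P \<and> (c, v x) \<in> P \<and> ltP p (c, u x) \<and> ltP (c, u x) (c, v x) \<and> (q = p \<or> ltP (c, v x) q)"
    if "x \<in> {x\<in>E. ltE e0 x}" for x
    using bspec[OF uv that] pc(1,2) by simp
  moreover have "ltP (c, v x) (c, u y) \<or> ltP (c, v y) (c, u x)"
    if "x \<in> {x\<in>E. ltE e0 x}" "y \<in> {x\<in>E. ltE e0 x}" "x \<noteq> y" for x y
    using bspec[OF bspec[OF sep that(1)] that(2)] that(3) same by blast
  ultimately show ?thesis
    by (intro exI[of _ "\<lambda>x. (c, u x)"] exI[of _ "\<lambda>x. (c, v x)"]) blast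
qed

lemma P_dense: assumes "p \<in> P" "q \<in> P" "ltP p q" shows "\<exists>z\<in>P. ltP p z \<and> ltP z q"
proof -
  have tp: "tp \<in> {x\<in>E. ltE e0 x}" using E_mem e0_tp by simp
  have pq: "q \<noteq> p" using P_linear[THEN linear_on_irrefl] assms by blast
  from P_cells[OF assms(1) disjI1[OF conjI[OF assms(2,3)]]]
  obtain u v where "\<forall>x\<in>{x\<in>E. ltE e0 x}. u x \<in> P \<and> v x \<in> P \<and> ltP p (u x) \<and> ltP (u x) (v x) \<and> (q = p \<or> ltP (v x) q)"
    by (elim exE conjE)
  from bspec[OF this tp] have "v tp \<in> P" "ltP (v tp) q" "u tp \<in> P" "ltP p (u tp)" "ltP (u tp) (v tp)"
    using pq by simp_all
  moreover have "ltP p (v tp)"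
    by (rule P_linear[THEN linear_on_trans, of _ "u tp"])
      (use calculation assms in auto)
  ultimately show ?thesis by (intro bexI[of _ "v tp"] conjI)
qed

lemma P_greater: assumes "p \<in> P" shows "\<exists>z\<in>P. ltP p z"
proof -
  have tp: "tp \<in> {x\<in>E. ltE e0 x}" using E_mem e0_tp by simp
  from P_cells[OF assms disjI2[OF refl]]
  obtain u v where "\<forall>x\<in>{x\<in>E. ltE e0 x}. u x \<in> P \<and> v x \<in> P \<and> ltP p (u x) \<and> ltP (u x) (v x) \<and> (p = p \<or> ltP (v x) p)"
    by (elim exE conjE)
  from bspec[OF this tp] show ?thesis by (intro bexI[of _ "u tp"]) (elim conjE, assumption)+
qed

lemma C_i0: "(i0, n, k) \<in> C" using i0 by (simp add: C_def)

lemma P_ne: "P \<noteq> {}" using C_i0[of 0 0] default_in_Q by blast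

end

section \<open>Cuts of the coded orders and their markers\<close>

locale coded_completion =
  coded_order N ltN E ltE EL bt e0 tp I ltI i0 S + completion X P ltP j
  for N :: "'n set" and ltN and E :: "'e set" and ltE EL bt e0 tp and I :: "'i set" and ltI i0 S
    and X :: "'a::complete_lattice set" and j
begin

text \<open>
  The position of the copy of \<open>\<int>\<close> or \<open>\<omega>\<close> that contains the block of \<open>p\<close>.
\<close>

definition col :: "('i \<times> int \<times> int) \<times> ('n \<Rightarrow> 'e) \<Rightarrow> 'i \<times> int" where
  "col p = (fst (fst p), fst (snd (fst p)))"

lemma col_simp [simp]: "col ((i, n, k), f) = (i, n)" by (simp add: col_def)

lemma fst_col: "p \<in> P \<Longrightarrow> fst (col p) \<in> I" by (auto simp: C_def)

lemma W_linear: "linear_on ltW (I \<times> UNIV)" by (rule linear_on_lexp[OF I_linear linear_on_int])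

lemma W_irrefl: "fst w \<in> I \<Longrightarrow> \<not> ltW w w"
  using W_linear[THEN linear_on_irrefl] by (cases w) simp

lemma W_trans: "ltW u v \<Longrightarrow> ltW v w \<Longrightarrow> fst u \<in> I \<Longrightarrow> fst v \<in> I \<Longrightarrow> fst w \<in> I \<Longrightarrow> ltW u w"
  by (rule W_linear[THEN linear_on_trans])
    (simp_all add: mem_Times_iff)

lemma W_total: "fst u \<in> I \<Longrightarrow> fst v \<in> I \<Longrightarrow> u = v \<or> ltW u v \<or> ltW v u"
  using W_linear[THEN linear_on_total, of u v]
  by (cases "u = v") (simp_all add: mem_Times_iff)

lemma ltP_col: "ltP p q \<Longrightarrow> col p = col q \<or> ltW (col p) (col q)"
  by (auto simp: lexp_def col_def)

lemma ltP_third: "k < k' \<Longrightarrow> ltP ((i, n, k), f) ((i, n, k'), g)"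
  by (auto simp: lexp_def)

lemma ltP_block: "lex f g \<Longrightarrow> ltP (c, f) (c, g)" "ltC c c' \<Longrightarrow> ltP (c, f) (c', g)"
  by (auto simp: lexp_def)

lemma I_trans: "a \<in> I \<Longrightarrow> b \<in> I \<Longrightarrow> c \<in> I \<Longrightarrow> ltI a b \<Longrightarrow> ltI b c \<Longrightarrow> ltI a c"
  by (rule I_linear[THEN linear_on_trans])
lemma I_irrefl: "a \<in> I \<Longrightarrow> \<not> ltI a a"
  by (rule I_linear[THEN linear_on_irrefl])
lemma not_below_i0: "i \<in> I \<Longrightarrow> \<not> ltI i i0"
  using i0_least[of i] I_trans[of i i0 i] I_irrefl[of i] i0 by blast

text \<open>
  \<open>B w\<close> is the point of the completion at the beginning of the copy at position \<open>w\<close>.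
\<close>

definition seg :: "'i \<times> int \<Rightarrow> (('i \<times> int \<times> int) \<times> ('n \<Rightarrow> 'e)) set" where
  "seg w = {p\<in>P. ltW (col p) w}"

definition B :: "'i \<times> int \<Rightarrow> 'a" where "B w = Sup (j ` seg w)"

lemma assumes w: "fst w \<in> I" shows B_in: "B w \<in> X" and below_B: "below (B w) = seg w"
proof -
  have 1: "seg w \<subseteq> P" by (auto simp: seg_def)
  have 2: "p \<in> seg w" if q: "q \<in> seg w" and p: "p \<in> P" "ltP p q" for p q
  proof -
    have "q \<in> P" "ltW (col q) w" using q by (simp_all add: seg_def)
    then have "ltW (col p) w" using ltP_col[OF p(2)] W_trans[of "col p" "col q" w] fst_col p(1) w by auto
    then show ?thesis using p(1) unfolding seg_def by blast
  qed
  have 3: "\<exists>q\<in>seg w. ltP p q" if "p \<in> seg w" for p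
  proof -
    have pw: "p \<in> P" "ltW (col p) w" using that by (simp_all add: seg_def)
    from pw(1) obtain c f where p: "p = (c, f)" "c \<in> C" "f \<in> Q" by (elim SigmaE)
    obtain g where g: "g \<in> Q" "lex f g" using Q_greater[OF p(3)] by blast
    have "(c, g) \<in> seg w" using p g pw(2) by (simp add: seg_def col_def)
    moreover have "ltP p (c, g)" unfolding p(1) by (rule ltP_block(1)[OF g(2)])
    ultimately show ?thesis by (rule bexI[rotated])
  qed
  show "B w \<in> X" unfolding B_def by (rule below_Sup(1)[OF 1 2 3])
  show "below (B w) = seg w" unfolding B_def by (rule below_Sup(2)[OF 1 2 3])
qed

lemma j_less_B: "fst w \<in> I \<Longrightarrow> p \<in> P \<Longrightarrow> j p < B w \<longleftrightarrow> ltW (col p) w"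
  using below_B[of w] by (auto simp: below_def seg_def)

lemma B_le_j: "fst w \<in> I \<Longrightarrow> p \<in> P \<Longrightarrow> \<not> ltW (col p) w \<Longrightarrow> B w \<le> j p"
  using j_less_B[of w p] not_less[of "j p" "B w"] j_in B_in by blast

lemma B_mono: assumes w: "fst w \<in> I" "fst w' \<in> I" "ltW w w'" shows "B w \<le> B w'"
proof -
  have "seg w \<subseteq> seg w'"
  proof
    fix p assume "p \<in> seg w"
    then have p: "p \<in> P" "ltW (col p) w" by (simp_all add: seg_def)
    then have "ltW (col p) w'" using W_trans[OF p(2) w(3) fst_col] w by simp
    then show "p \<in> seg w'" using p(1) unfolding seg_def by blast
  qed
  then show ?thesis using below_subset_iff[OF B_in B_in] below_B w by simp
qed

lemma B_less_imp: assumes w: "fst w \<in> I" "fst w' \<in> I" "B w < B w'" shows "ltW w w'"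
  using W_total[OF w(1,2)] B_mono[OF w(2,1)] w(3) by auto

lemma B_less:
  assumes w: "fst w \<in> I" "fst w' \<in> I" and p: "p \<in> P" "\<not> ltW (col p) w" "ltW (col p) w'"
  shows "B w < B w'"
proof -
  have "B w \<le> j p" using B_le_j w p by blast
  also have "j p < B w'" using j_less_B w p by blast
  finally show ?thesis .
qed

lemma below_bot: "below bot = {}" by (auto simp: below_def)

lemma below_top: "below (Sup X) = P"
proof -
  have "j p < Sup X" if p: "p \<in> P" for p
  proof -
    obtain q where q: "q \<in> P" "ltP p q" using P_greater[OF p] by (elim bexE)
    then have "j p < j q" using j_less[OF p q(1)] by simp
    also have "j q \<le> Sup X" by (rule top_greatest[OF j_in[OF q(1)]])
    finally show ?thesis .
  qed
  then show ?thesis by (auto simp: below_def)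
qed

lemma below_vs_above: "q \<in> below x \<Longrightarrow> p \<in> P \<Longrightarrow> p \<notin> below x \<Longrightarrow> ltP q p"
proof -
  assume q: "q \<in> below x" and p: "p \<in> P" "p \<notin> below x"
  have qP: "q \<in> P" using q by (simp add: below_def)
  have "q \<noteq> p" using q p by blast
  then show ?thesis using lt_total[OF qP p(1)] below_initial[OF q p(1)] p(2) by blast
qed

text \<open>
  The cut runs through the block of \<open>c\<close>, or is at its left end.
\<close>

definition splits_block :: "'a \<Rightarrow> ('i \<times> int \<times> int) \<Rightarrow> bool" where
  "splits_block x c \<longleftrightarrow> c \<in> C \<and> (\<exists>f\<in>Q. (c, f) \<notin> below x) \<and> (\<forall>p\<in>P. ltC (fst p) c \<longrightarrow> p \<in> below x)"

abbreviation block_trace :: "'a \<Rightarrow> ('i \<times> int \<times> int) \<Rightarrow> ('n \<Rightarrow> 'e) set" where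
  "block_trace x c \<equiv> {f\<in>Q. (c, f) \<in> below x}"

text \<open>
  Take the least first coordinate and then the least second coordinate of blocks not entirely below
  the cut. If the third coordinates have a least element, they determine the block that is split;
  otherwise the cut is the beginning of a copy of \<open>\<int>\<close>. The second coordinates are bounded below even
  for \<open>i0\<close>, because some element lies below the cut.
\<close>

lemma cut_cases:
  assumes x: "x \<in> X" "x \<noteq> bot" "x \<noteq> Sup X"
  obtains (block) c where "splits_block x c"
    | (gap) i n where "i \<in> I" "\<forall>k. (i, n, k) \<in> C" "x = B (i, n)"
proof -
  have ne: "below x \<noteq> {}" using below_inj[OF x(1) bot_in] x(2) below_bot by auto
  have "below x \<noteq> P" using below_inj[OF x(1) top_in] x(3) below_top by auto
  moreover have "below x \<subseteq> P" by (auto simp: below_def)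
  ultimately obtain p0 where p0: "p0 \<in> P" "p0 \<notin> below x" by blast
  let ?K = "P - below x"
  obtain q where q: "q \<in> below x" using ne by blast
  have qP: "q \<in> P" using q by (simp add: below_def)
  have p0I: "fst (col p0) \<in> I" by (rule fst_col[OF p0(1)])
  obtain i where i: "i \<in> I" "\<exists>p\<in>?K. fst (col p) = i" "\<forall>i'\<in>I. ltI i' i \<longrightarrow> \<not> (\<exists>p\<in>?K. fst (col p) = i')"
    using wfp_on_minimal[OF I_wf p0I, of "\<lambda>i. \<exists>p\<in>?K. fst (col p) = i"] p0 by blast
  let ?Z = "{n. \<exists>p\<in>?K. col p = (i, n)}"
  obtain p1 where "p1 \<in> ?K" "fst (col p1) = i" using i(2) by (elim bexE)
  then have n0: "snd (col p1) \<in> ?Z" by (intro CollectI bexI[of _ p1]) (simp_all add: prod_eq_iff)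
  have "\<exists>a. \<forall>m\<in>?Z. a \<le> m"
  proof (cases "i = i0")
    case False
    have "0 \<le> m" if mZ: "m \<in> ?Z" for m
    proof -
      obtain p where p: "p \<in> P" "col p = (i, m)" using mZ by blast
      obtain c f where "p = (c, f)" "c \<in> C" using p(1) by (elim SigmaE)
      then show ?thesis using p(2) False by (auto simp: C_def col_def)
    qed
    then show ?thesis by (intro exI[of _ 0] ballI)
  next
    case True
    have "snd (col q) \<le> m" if mZ: "m \<in> ?Z" for m
    proof -
      obtain p where p: "p \<in> ?K" "col p = (i, m)" using mZ by blast
      have "ltP q p" using below_vs_above[OF q] p(1) by blast
      then have "col q = (i0, m) \<or> ltW (col q) (i0, m)" using ltP_col[OF \<open>ltP q p\<close>] p(2) True by simp
      then show ?thesis using not_below_i0[OF fst_col[OF qP]] by (auto simp: lexp_def)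
    qed
    then show ?thesis by (intro exI[of _ "snd (col q)"] ballI)
  qed
  then obtain a where "\<forall>m\<in>?Z. a \<le> m" by (elim exE)
  then have a: "a \<le> m" if "m \<in> ?Z" for m using that by (rule bspec)
  obtain n where n: "n \<in> ?Z" "\<forall>m\<in>?Z. n \<le> m" by (rule int_bounded_below_least[OF n0 a])
  have before: "p \<in> below x" if p: "p \<in> P" "ltW (col p) (i, n)" for p
  proof (rule ccontr)
    assume "p \<notin> below x"
    then have pK: "p \<in> ?K" using p(1) by blast
    from p(2) have "ltI (fst (col p)) i \<or> fst (col p) = i \<and> snd (col p) < n" by (simp add: lexp_def)
    then show False
    proof
      assume "ltI (fst (col p)) i"
      then have "\<not> (\<exists>p'\<in>?K. fst (col p') = fst (col p))" using i(3) fst_col[OF p(1)] by simp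
      moreover have "\<exists>p'\<in>?K. fst (col p') = fst (col p)" by (rule bexI[of _ p]) (rule refl, rule pK)
      ultimately show False by (rule notE)
    next
      assume 1: "fst (col p) = i \<and> snd (col p) < n"
      then have "col p = (i, snd (col p))" by (simp add: prod_eq_iff)
      then have "snd (col p) \<in> ?Z" using pK by (intro CollectI bexI[of _ p])
      then have "n \<le> snd (col p)" using n(2) by (elim bspec[rotated])
      then show False using 1 by simp
    qed
  qed
  let ?Y = "{k. \<exists>f. ((i, n, k), f) \<in> ?K}"
  obtain p2 where p2: "p2 \<in> ?K" "col p2 = (i, n)" using n(1) by (elim CollectE bexE)
  have "p2 = ((i, n, snd (snd (fst p2))), snd p2)" using p2(2) by (simp add: col_def prod_eq_iff)
  then have k0: "snd (snd (fst p2)) \<in> ?Y" using p2(1) by (intro CollectI exI[of _ "snd p2"]) metis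
  show thesis
  proof (cases "\<exists>k1. \<forall>k\<in>?Y. k1 \<le> k")
    case True
    then obtain k1 where "\<forall>k\<in>?Y. k1 \<le> k" by (elim exE)
    then have k1: "k1 \<le> k" if "k \<in> ?Y" for k using that by (rule bspec)
    obtain k where k: "k \<in> ?Y" "\<forall>k'\<in>?Y. k \<le> k'" by (rule int_bounded_below_least[OF k0 k1])
    have "p \<in> below x" if p: "p \<in> P" "ltC (fst p) (i, n, k)" for p
    proof -
      obtain i' n' k' f where pe: "p = ((i', n', k'), f)" by (metis surj_pair)
      have "ltW (col p) (i, n) \<or> i' = i \<and> n' = n \<and> k' < k" using p(2) pe by (auto simp: lexp_def)
      then show ?thesis
      proof
        assume "ltW (col p) (i, n)" then show ?thesis by (rule before[OF p(1)])
      next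
        assume 1: "i' = i \<and> n' = n \<and> k' < k"
        then have "k' \<notin> ?Y" using k(2) by force
        then show ?thesis using 1 pe p(1) by blast
      qed
    qed
    moreover obtain f where "((i, n, k), f) \<in> ?K" using k(1) by blast
    ultimately have "splits_block x (i, n, k)" unfolding splits_block_def by blast
    then show thesis by (rule block)
  next
    case False
    have Yall: "\<exists>k'\<in>?Y. k' < k" for k using False by (meson not_less linorder_not_less)
    have "(i, n, k) \<in> C" for k
    proof -
      obtain k' f where "k' < k" "((i, n, k'), f) \<in> P" using Yall[of k] by blast
      then show ?thesis by (auto simp: C_def)
    qed
    moreover have "below x = seg (i, n)"
    proof (intro equalityI subsetI)
      fix p assume "p \<in> seg (i, n)"
      then have "p \<in> P" "ltW (col p) (i, n)" by (simp_all add: seg_def)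
      then show "p \<in> below x" by (rule before)
    next
      fix p assume p: "p \<in> below x"
      then have pP: "p \<in> P" by (simp add: below_def)
      obtain i' n' k' f where pe: "p = ((i', n', k'), f)" by (metis surj_pair)
      obtain k g where k: "k < k'" "((i, n, k), g) \<in> ?K" using Yall[of k'] by blast
      have "ltP p ((i, n, k), g)" using below_vs_above[OF p] k(2) by blast
      then have "ltW (col p) (i, n)" using k(1) unfolding pe by (auto simp: lexp_def)
      then show "p \<in> seg (i, n)" using pP unfolding seg_def by blast
    qed
    then have "x = B (i, n)" using below_inj[OF x(1) B_in] below_B[of "(i, n)"] i(1) by simp
    ultimately show thesis by (intro gap[OF i(1)]) blast+
  qed
qed

lemma block_cut:
  assumes "splits_block x c"
  shows "lex_cut N ltN E ltE EL bt e0 tp (block_trace x c)"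
proof
  fix p q assume "q \<in> block_trace x c" "p \<in> Q" "lex p q"
  moreover have "c \<in> C" using assms by (simp add: splits_block_def)
  ultimately show "p \<in> block_trace x c"
    using below_initial[of "(c, q)" x "(c, p)"] ltP_block(1)[of p q c] by simp
qed simp

lemma block_below:
  assumes "splits_block x c" "p \<in> below x" shows "fst p = c \<or> ltC (fst p) c"
proof -
  obtain f where f: "f \<in> Q" "c \<in> C" "(c, f) \<notin> below x" using assms unfolding splits_block_def by blast
  then have "ltP p (c, f)" using below_vs_above[OF assms(2)] by blast
  then show ?thesis by (auto simp: lexp_def)
qed

lemma block_not_below:
  assumes "splits_block x c" "p \<in> P" "p \<notin> below x" shows "\<not> ltC (fst p) c"
  using assms unfolding splits_block_def by blast

lemma ltP_cases: "ltP p q \<Longrightarrow> ltC (fst p) (fst q) \<or> fst p = fst q \<and> lex (snd p) (snd q)"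
  by (simp add: lexp_def[of ltC lex])

text \<open>
  Within the block, countable characters on both sides contradict the rigidity of \<open>Q\<close>. At the
  left end of the block the lower part is empty, and countable right character alone is
  impossible.
\<close>

lemma block_not_both_countable:
  assumes x: "x \<in> X" and sb: "splits_block x c" and right: "countable_side (<) X x"
    and left: "countable_side (>) X x \<or> (\<forall>f\<in>Q. (c, f) \<notin> below x)"
  shows False
proof -
  interpret cut: lex_cut N ltN E ltE EL bt e0 tp "block_trace x c" by (rule block_cut[OF sb])
  have cC: "c \<in> C" using sb by (simp add: splits_block_def)
  obtain R where R: "R \<subseteq> P - below x" "countable R" "\<And>p. p \<in> P - below x \<Longrightarrow> \<exists>r\<in>R. r = p \<or> ltP r p"
    using countable_coinitial_above[OF right x] by metis
  have "\<exists>L. L \<subseteq> below x \<and> countable L \<and> (\<forall>f\<in>Q. (c, f) \<in> below x \<longrightarrow> (\<exists>l\<in>L. (c, f) = l \<or> ltP (c, f) l))"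
    using left
  proof
    assume "countable_side (>) X x"
    then obtain L where "L \<subseteq> below x" "countable L" "\<And>p. p \<in> below x \<Longrightarrow> \<exists>l\<in>L. p = l \<or> ltP p l"
      using countable_cofinal_below[OF _ x] by metis
    then show ?thesis by (intro exI[of _ L]) simp
  next
    assume "\<forall>f\<in>Q. (c, f) \<notin> below x"
    then show ?thesis by (intro exI[of _ "{}"]) simp
  qed
  then obtain L where L: "L \<subseteq> below x" "countable L"
    "\<And>f. f \<in> Q \<Longrightarrow> (c, f) \<in> below x \<Longrightarrow> \<exists>l\<in>L. (c, f) = l \<or> ltP (c, f) l" by blast
  let ?L = "snd ` {l\<in>L. fst l = c}" and ?R = "snd ` {r\<in>R. fst r = c}"
  show False
  proof (rule cut.not_both_sides_countable[of ?L ?R])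
    show "countable ?L" "countable ?R" using L(2) R(2) by simp_all
    show "?L \<subseteq> block_trace x c"
    proof
      fix f assume "f \<in> ?L"
      then have "(c, f) \<in> L" by force
      then have "(c, f) \<in> below x" using L(1) by blast
      then show "f \<in> block_trace x c" by (simp add: below_def)
    qed
    show "?R \<subseteq> Q - block_trace x c"
    proof
      fix f assume "f \<in> ?R"
      then have "(c, f) \<in> R" by force
      then have "(c, f) \<in> P - below x" using R(1) by blast
      then show "f \<in> Q - block_trace x c" by simp
    qed
    show "\<exists>l\<in>?L. p = l \<or> lex p l" if p: "p \<in> block_trace x c" for p
    proof -
      obtain l where l: "l \<in> L" "(c, p) = l \<or> ltP (c, p) l" using L(3)[of p] p by blast
      have lb: "l \<in> below x" using l(1) L(1) by blast
      have lP: "fst l \<in> C" using lb by (auto simp: below_def)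
      from l(2) have "fst l = c \<and> (p = snd l \<or> lex p (snd l)) \<or> ltC c (fst l)"
        using ltP_cases[of "(c, p)" l] by auto
      moreover have "\<not> ltC c (fst l)"
      proof
        assume cl: "ltC c (fst l)"
        have "ltC (fst l) c \<or> fst l = c" using block_below[OF sb lb] by blast
        then have "ltC c c"
          using C_linear[THEN linear_on_trans, OF cC lP cC cl] cl by auto
        then show False using C_linear[THEN linear_on_irrefl] cC by blast
      qed
      ultimately show ?thesis using l(1) by blast
    qed
    show "\<exists>r\<in>?R. r = p \<or> lex r p" if p: "p \<in> Q - block_trace x c" for p
    proof -
      have "(c, p) \<in> P - below x" using p cC by simp
      then obtain r where r: "r \<in> R" "r = (c, p) \<or> ltP r (c, p)" using R(3) by blast
      have "\<not> ltC (fst r) c" using block_not_below[OF sb] r(1) R(1) by blast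
      then have "fst r = c \<and> (snd r = p \<or> lex (snd r) p)" using r(2) ltP_cases[of r "(c, p)"] by auto
      then show ?thesis using r(1) by blast
    qed
  qed
qed

end


context coded_completion
begin

abbreviation "z \<equiv> \<lambda>_ :: 'n. e0"

lemma mem_P: "c \<in> C \<Longrightarrow> (c, z) \<in> P" using default_in_Q by simp

lemma gap_right_countable:
  assumes i: "i \<in> I" and C: "\<forall>k. (i, n, k) \<in> C"
  shows "countable_side (<) X (B (i, n))"
    and "below (B (i, n)) = {p\<in>P. \<not> (\<exists>k. ((i, n, k), z) = p \<or> ltP ((i, n, k), z) p)}"
proof -
  let ?r = "\<lambda>k. ((i, n, k), z)"
  have rP: "?r k \<in> P" for k by (rule mem_P) (use C in simp)
  have above: "B (i, n) < j (?r k)" for k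
  proof -
    have "B (i, n) \<le> j (?r (k - 1))"
      by (rule B_le_j[OF _ rP]) (use i W_irrefl[of "(i, n)"] in auto)
    also have "j (?r (k - 1)) < j (?r k)"
      using j_less[OF rP rP] ltP_third[of "k - 1" k] by simp
    finally show ?thesis .
  qed
  have initial: "\<exists>k. ?r k = p \<or> ltP (?r k) p" if p: "p \<in> P" "\<not> ltW (col p) (i, n)" for p
  proof -
    obtain i' n' k' f where pe: "p = ((i', n', k'), f)" by (metis surj_pair)
    have "(i, n) = col p \<or> ltW (i, n) (col p)" using W_total[of "(i, n)" "col p"] fst_col[OF p(1)] i p(2) by auto
    then have "ltP (?r (k' - 1)) p" using pe by (auto simp: lexp_def)
    then show ?thesis by blast
  qed
  show "countable_side (<) X (B (i, n))"
  proof (rule countable_sideI_above[of _ "j (?r 0)" "range ?r"])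
    show "B (i, n) \<in> X" using B_in i by simp
    show "j (?r 0) \<in> X" by (rule j_in[OF rP])
    show "B (i, n) < j (?r 0)" by (rule above)
    show "range ?r \<subseteq> P" using rP by blast
    show "B (i, n) < j r" if "r \<in> range ?r" for r using that above by auto
    show "\<exists>r\<in>range ?r. r = p \<or> ltP r p" if "p \<in> P" "B (i, n) < j p" for p
    proof -
      have "\<not> ltW (col p) (i, n)" using j_less_B[of "(i, n)" p] that i by auto
      then show ?thesis using initial[OF that(1)] by auto
    qed
  qed simp
  show "below (B (i, n)) = {p\<in>P. \<not> (\<exists>k. ?r k = p \<or> ltP (?r k) p)}"
  proof (intro equalityI subsetI)
    fix p assume "p \<in> below (B (i, n))"
    then have p: "p \<in> P" "j p < B (i, n)" by (simp_all add: below_def)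
    have "\<not> (\<exists>k. ?r k = p \<or> ltP (?r k) p)"
    proof
      assume "\<exists>k. ?r k = p \<or> ltP (?r k) p"
      then obtain k where "?r k = p \<or> ltP (?r k) p" by blast
      then have "j (?r k) \<le> j p" using j_less[OF rP p(1), of k] by auto
      then show False using above[of k] p(2) by auto
    qed
    then show "p \<in> {p\<in>P. \<not> (\<exists>k. ?r k = p \<or> ltP (?r k) p)}" using p(1) by simp
  next
    fix p assume "p \<in> {p\<in>P. \<not> (\<exists>k. ?r k = p \<or> ltP (?r k) p)}"
    then have p: "p \<in> P" "\<not> (\<exists>k. ?r k = p \<or> ltP (?r k) p)" by simp_all
    then have "ltW (col p) (i, n)" using initial by blast
    then show "p \<in> below (B (i, n))" using below_B[of "(i, n)"] i p(1) by (simp add: seg_def)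
  qed
qed

lemma gap_left_countable:
  assumes i: "i \<in> I" and C: "(i, n, 0) \<in> C"
  shows "countable_side (>) X (B (i, n + 1))"
proof (rule countable_sideI_below[of _ bot "(\<lambda>k :: nat. ((i, n, int k), z)) ` UNIV"])
  have Ck: "(i, n, int k) \<in> C" for k using C by (auto simp: C_def)
  have inseg: "((i, n, int k), z) \<in> below (B (i, n + 1))" for k
    using mem_P[OF Ck] below_B[of "(i, n + 1)"] i by (simp add: seg_def lexp_def)
  show "B (i, n + 1) \<in> X" using B_in i by simp
  show "bot \<in> X" by (rule bot_in)
  have "j ((i, n, int 0), z) < B (i, n + 1)" using inseg[of 0] by (simp add: below_def)
  then show "bot < B (i, n + 1)" by (rule le_less_trans[OF bot_least])
  show "(\<lambda>k :: nat. ((i, n, int k), z)) ` UNIV \<subseteq> below (B (i, n + 1))" using inseg by blast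
  show "countable ((\<lambda>k :: nat. ((i, n, int k), z)) ` UNIV)" by simp
  show "\<exists>l\<in>(\<lambda>k :: nat. ((i, n, int k), z)) ` UNIV. p = l \<or> ltP p l" if p: "p \<in> below (B (i, n + 1))" for p
  proof -
    have pP: "p \<in> P" "ltW (col p) (i, n + 1)" using p below_B[of "(i, n + 1)"] i by (simp_all add: seg_def)
    obtain i' n' k' f where pe: "p = ((i', n', k'), f)" by (metis surj_pair)
    have "ltP p ((i, n, int (nat k' + 1)), z)" using pP(2) pe by (auto simp: lexp_def)
    then show ?thesis by blast
  qed
qed

lemma marker_gap:
  assumes i: "i \<in> I" and n: "i = i0 \<or> 0 \<le> n" and C: "(i, n, 0) \<in> C"
  shows "marker X (B (i, n + 1))"
proof -
  have "\<forall>k. (i, n + 1, k) \<in> C" using i n by (auto simp: C_def)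
  then show ?thesis
    unfolding marker_def using gap_right_countable(1)[OF i] gap_left_countable[OF i C] by simp
qed

text \<open>
  A cut in a block is not a marker, so by the classification of cuts only gaps remain.
\<close>

lemma markerD:
  assumes x: "x \<in> X" "marker X x"
  obtains i n where "i \<in> I" "i = i0 \<or> 0 \<le> n" "x = B (i, n)"
proof -
  have r: "countable_side (<) X x" and l: "countable_side (>) X x" using x(2) by (simp_all add: marker_def)
  have "x \<noteq> bot" using l unfolding countable_side_def by (auto simp: not_less_bot)
  moreover have "x \<noteq> Sup X" using r top_greatest unfolding countable_side_def by (auto simp: leD)
  ultimately show ?thesis
  proof (cases rule: cut_cases[OF x(1), case_names _ _ block gap])
    case (block c)
    then show ?thesis using block_not_both_countable[OF x(1) block r] l by blast
  next
    case (gap i n)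
    have "(i, n, 0) \<in> C" using gap(2) by blast
    then have "i = i0 \<or> 0 \<le> n" by (auto simp: C_def)
    then show ?thesis using that gap by blast
  qed
qed

text \<open>
  Below every element there is a gap \<open>B (i0, n)\<close>, because \<open>n\<close> ranges over all of \<open>\<int>\<close>.
\<close>

lemma bot_right_limit: "marker_limit (<) X bot"
  unfolding marker_limit_def
proof (intro conjI ballI impI)
  have "bot < Sup X" using nontrivial bot.not_eq_extremum[of "Sup X"] by blast
  then show "\<exists>y\<in>X. bot < y" using top_in by blast
  fix y assume y: "y \<in> X" "bot < y"
  obtain p where p: "p \<in> P" "bot < j p" "j p < y" using j_dense[OF bot_in y] by blast
  obtain i n k f where pe: "p = ((i, n, k), f)" by (metis surj_pair)
  let ?m = "B (i0, n)"
  have "marker X ?m" using marker_gap[OF i0, of "n - 1"] C_i0 by simp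
  moreover have "?m \<le> j p"
  proof (rule B_le_j[OF _ p(1)])
    show "\<not> ltW (col p) (i0, n)" using pe not_below_i0[of i] fst_col[OF p(1)] by (auto simp: lexp_def)
  qed (use i0 in simp)
  then have "?m < y" using p(3) by simp
  moreover have "j ((i0, n - 1, 0), z) < ?m"
    using j_less_B[of "(i0, n)"] mem_P[OF C_i0] i0 by (simp add: lexp_def)
  then have "bot < ?m" by (rule le_less_trans[OF bot_least])
  moreover have "?m \<in> X" using B_in i0 by simp
  ultimately show "\<exists>m\<in>X. marker X m \<and> bot < m \<and> m < y" by blast
qed

text \<open>
  Markers above a point other than the least one have positions bounded below by that of some
  element, and such positions are well-ordered. So there is a least marker above the point.
\<close>

lemma right_limitD:
  assumes x: "x \<in> X" and lim: "marker_limit (<) X x" shows "x = bot"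
proof (rule ccontr)
  assume "x \<noteq> bot"
  then have "below x \<noteq> {}" using below_inj[OF x bot_in] below_bot by auto
  then obtain q where q: "q \<in> below x" by blast
  then have qP: "q \<in> P" "j q < x" by (simp_all add: below_def)
  let ?G = "\<lambda>i n. i \<in> I \<and> (i = i0 \<or> 0 \<le> n) \<and> x < B (i, n)"
  have markers: "\<exists>i n. ?G i n \<and> m = B (i, n)" if m: "m \<in> X" "marker X m" "x < m" for m
  proof -
    obtain i n where "i \<in> I" "i = i0 \<or> 0 \<le> n" "m = B (i, n)" using m(1,2) by (rule markerD)
    then show ?thesis using m(3) by blast
  qed
  obtain y where "y \<in> X" "x < y" using lim unfolding marker_limit_def by blast
  then obtain m0 where m0: "m0 \<in> X" "marker X m0" "x < m0" using lim unfolding marker_limit_def by blast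
  then obtain i1 n1 where "?G i1 n1" using markers by blast
  then have 1: "i1 \<in> I" "\<exists>n. ?G i1 n" by blast+
  obtain i where i: "i \<in> I" "\<exists>n. ?G i n" "\<forall>i'\<in>I. ltI i' i \<longrightarrow> \<not> (\<exists>n. ?G i' n)"
    using wfp_on_minimal[OF I_wf 1(1), of "\<lambda>i. \<exists>n. ?G i n", OF 1(2)] by blast
  obtain n0 where n0: "n0 \<in> {n. ?G i n}" using i(2) by blast
  have bound: "min 0 (snd (col q)) \<le> n" if "n \<in> {n. ?G i n}" for n
  proof -
    have n: "i = i0 \<or> 0 \<le> n" "x < B (i, n)" using that by simp_all
    have "j q < B (i, n)" using qP(2) n(2) by (rule less_trans)
    then have "ltW (col q) (i, n)" using j_less_B[of "(i, n)" q] qP(1) i(1) by simp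
    then show ?thesis using n(1) not_below_i0[OF fst_col[OF qP(1)]] by (auto simp: lexp_def)
  qed
  obtain n where n: "n \<in> {n. ?G i n}" "\<forall>n'\<in>{n. ?G i n}. n \<le> n'"
    by (rule int_bounded_below_least[OF n0 bound])
  have Bn: "B (i, n) \<in> X" "x < B (i, n)" using n(1) B_in by simp_all
  obtain m where m: "m \<in> X" "marker X m" "x < m" "m < B (i, n)"
    using lim Bn unfolding marker_limit_def by blast
  obtain i' n' where G: "?G i' n'" "m = B (i', n')" using markers[OF m(1-3)] by blast
  have "ltW (i', n') (i, n)" using B_less_imp[of "(i', n')" "(i, n)"] G m(4) i(1) by simp
  then have "ltI i' i \<or> i' = i \<and> n' < n" by (simp add: lexp_def)
  then show False
  proof
    assume "ltI i' i" then show False using i(3) G(1) by blast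
  next
    assume e: "i' = i \<and> n' < n"
    then have "n' \<in> {n. ?G i n}" using G(1) by simp
    then have "n \<le> n'" using n(2) by (rule bspec[rotated])
    then show False using e by simp
  qed
qed

lemma column_left_limit:
  assumes i: "i \<in> I" "i \<noteq> i0" shows "marker_limit (>) X (B (i, 0))"
  unfolding marker_limit_def
proof (intro conjI ballI impI)
  have "j ((i0, 0, 0), z) < B (i, 0)"
    using j_less_B[of "(i, 0)"] mem_P[OF C_i0] i i0_least[OF i] by (simp add: lexp_def)
  then show "\<exists>y\<in>X. B (i, 0) > y" using bot_in le_less_trans[OF bot_least] by blast
  fix y assume y: "y \<in> X" "B (i, 0) > y"
  have BX: "B (i, 0) \<in> X" using B_in i by simp
  obtain p where p: "p \<in> P" "y < j p" "j p < B (i, 0)" using j_dense[OF y(1) BX y(2)] by blast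
  obtain i' n' k' f where pe: "p = ((i', n', k'), f)" by (metis surj_pair)
  have cC: "(i', n', k') \<in> C" "i' \<in> I" using p(1) pe by (auto simp: C_def)
  have "ltW (i', n') (i, 0)" using j_less_B[of "(i, 0)" p] p pe i by simp
  then have "ltI i' i \<or> i' = i \<and> n' < 0" by (simp add: lexp_def)
  then have less: "ltI i' i" using cC i(2) by (auto simp: C_def)
  have n': "i' = i0 \<or> 0 \<le> n'" using cC by (auto simp: C_def)
  let ?m = "B (i', n' + 1)"
  have C0: "(i', n', 0) \<in> C" using cC by (auto simp: C_def)
  have "marker X ?m" by (rule marker_gap[OF cC(2) n' C0])
  moreover have "j p < ?m" using j_less_B[of "(i', n' + 1)" p] p(1) pe cC(2) by (simp add: lexp_def)
  then have "y < ?m" by (rule less_trans[OF p(2)])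
  moreover have "?m < B (i, 0)"
  proof (rule B_less)
    have "(i', n' + 1, 0) \<in> C" using cC n' by (auto simp: C_def)
    then show "((i', n' + 1, 0), z) \<in> P" by (rule mem_P)
  qed (use cC(2) i less I_irrefl in \<open>auto simp: lexp_def\<close>)
  moreover have "?m \<in> X" using B_in cC(2) by simp
  ultimately show "\<exists>m\<in>X. marker X m \<and> B (i, 0) > m \<and> m > y" by blast
qed

text \<open>
  Let \<open>i\<close> be least with \<open>x \<le> B (i, 0)\<close>. If \<open>x\<close> were smaller, it would lie between \<open>B (i', n - 1)\<close> and
  \<open>B (i', n)\<close> for some \<open>i'\<close> and some integer \<open>n\<close>, with no gap in between.
\<close>

lemma left_limitD:
  assumes x: "x \<in> X" and lim: "marker_limit (>) X x"
  shows "x = Sup X \<or> (\<exists>i\<in>I - {i0}. x = B (i, 0))"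
proof (cases "x = Sup X")
  case True then show ?thesis ..
next
  case False
  then have "x \<noteq> Sup X" .
  obtain y where "y \<in> X" "x > y" using lim unfolding marker_limit_def by blast
  then have "x \<noteq> bot" by auto
  then have "below x \<noteq> {}" using below_inj[OF x bot_in] below_bot by auto
  then obtain q where q: "q \<in> below x" by blast
  then have qP: "q \<in> P" "j q < x" by (simp_all add: below_def)
  have "below x \<noteq> P" using below_inj[OF x top_in] below_top \<open>x \<noteq> Sup X\<close> by auto
  moreover have "below x \<subseteq> P" by (auto simp: below_def)
  ultimately obtain p0 where p0: "p0 \<in> P" "p0 \<notin> below x" by blast
  have p0I: "fst (col p0) \<in> I" by (rule fst_col[OF p0(1)])
  obtain i1 where i1: "i1 \<in> I" "ltI (fst (col p0)) i1" using I_greater[OF p0I] by blast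
  have "x \<le> B (i1, 0)"
  proof -
    have "x \<le> j p0" using p0 not_less[OF j_in[OF p0(1)] x] by (simp add: below_def)
    also have "j p0 < B (i1, 0)" using j_less_B[of "(i1, 0)" p0] p0(1) i1 by (simp add: lexp_def)
    finally show ?thesis by simp
  qed
  moreover have "i1 \<noteq> i0" using i1 not_below_i0[OF p0I] by auto
  ultimately have G1: "i1 \<noteq> i0 \<and> x \<le> B (i1, 0)" by simp
  obtain i where i: "i \<in> I" "i \<noteq> i0 \<and> x \<le> B (i, 0)" "\<forall>i'\<in>I. ltI i' i \<longrightarrow> \<not> (i' \<noteq> i0 \<and> x \<le> B (i', 0))"
    using wfp_on_minimal[OF I_wf i1(1), of "\<lambda>i. i \<noteq> i0 \<and> x \<le> B (i, 0)", OF G1] by blast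
  have BX: "B (i', n) \<in> X" if "i' \<in> I" for i' n using B_in that by simp
  have "x = B (i, 0)"
  proof (rule ccontr)
    assume "x \<noteq> B (i, 0)"
    then have "x < B (i, 0)" using i(2) by (simp add: less_le)
    then obtain p where p: "p \<in> P" "x < j p" "j p < B (i, 0)" using j_dense[OF x BX[OF i(1)]] by blast
    obtain i' n' k' f where pe: "p = ((i', n', k'), f)" by (metis surj_pair)
    have cC: "(i', n', k') \<in> C" "i' \<in> I" using p(1) pe by (auto simp: C_def)
    have "ltW (i', n') (i, 0)" using j_less_B[of "(i, 0)" p] p pe i(1) by simp
    then have "ltI i' i \<or> i' = i \<and> n' < 0" by (simp add: lexp_def)
    then have less: "ltI i' i" using cC i(2) by (auto simp: C_def)
    let ?Z = "{n. x \<le> B (i', n)}"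
    have "j p < B (i', n' + 1)" using j_less_B[of "(i', n' + 1)" p] p(1) pe cC(2) by (simp add: lexp_def)
    then have z0: "n' + 1 \<in> ?Z" using p(2) by simp
    have bound: "min 0 (snd (col q)) \<le> n" if "n \<in> ?Z" for n
    proof (cases "i' = i0")
      case True
      have "j q < B (i', n)" using qP(2) that by simp
      then have "ltW (col q) (i0, n)" using j_less_B[of "(i', n)" q] qP(1) cC(2) True by simp
      then show ?thesis using not_below_i0[OF fst_col[OF qP(1)]] by (auto simp: lexp_def)
    next
      case False
      have "B (i', 0) < x" using i(3) cC(2) less False not_le[OF x BX[OF cC(2)]] by blast
      also have "x \<le> B (i', n)" using that by simp
      finally have "ltW (i', 0) (i', n)" by (intro B_less_imp) (use cC in simp_all)
      then show ?thesis using I_irrefl[OF cC(2)] by (auto simp: lexp_def)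
    qed
    obtain n where n: "n \<in> ?Z" "\<forall>k\<in>?Z. n \<le> k" by (rule int_bounded_below_least[OF z0 bound])
    have "n - 1 \<notin> ?Z"
    proof
      assume "n - 1 \<in> ?Z"
      then have "n \<le> n - 1" using n(2) by (rule bspec[rotated])
      then show False by simp
    qed
    then have lower: "B (i', n - 1) < x" using not_le[OF x BX[OF cC(2)]] by simp
    obtain m where m: "m \<in> X" "marker X m" "x > m" "m > B (i', n - 1)"
      using lim lower BX[OF cC(2)] unfolding marker_limit_def by blast
    obtain a b where ab: "a \<in> I" "m = B (a, b)" using m(1,2) by (rule markerD)
    have "ltW (i', n - 1) (a, b)" using m(4) ab cC(2) by (intro B_less_imp) simp_all
    moreover have "m < B (i', n)" using m(3) n(1) by simp
    then have "ltW (a, b) (i', n)" using ab cC(2) by (intro B_less_imp) simp_all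
    ultimately show False
      using I_irrefl[OF cC(2)] I_trans[OF cC(2) ab(1) cC(2)] by (auto simp: lexp_def)
  qed
  then have "\<exists>i\<in>I - {i0}. x = B (i, 0)" using i(1,2) by blast
  then show ?thesis ..
qed

text \<open>
  If \<open>i\<close> is not in \<open>S\<close>, the gap \<open>B (i, 0)\<close> is the left end of the block of \<open>(i, 0, 0)\<close>.
\<close>

lemma code_iff:
  assumes i: "i \<in> I" "i \<noteq> i0" shows "countable_side (<) X (B (i, 0)) \<longleftrightarrow> i \<in> S"
proof
  assume "i \<in> S"
  then have "\<forall>k. (i, 0, k) \<in> C" using i by (simp add: C_def)
  then show "countable_side (<) X (B (i, 0))" by (rule gap_right_countable(1)[OF i(1)])
next
  assume r: "countable_side (<) X (B (i, 0))"
  show "i \<in> S"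
  proof (rule ccontr)
    assume S: "i \<notin> S"
    have bB: "below (B (i, 0)) = seg (i, 0)" using below_B i(1) by simp
    have BX: "B (i, 0) \<in> X" using B_in i(1) by simp
    have no: "((i, 0, 0), f) \<notin> below (B (i, 0))" for f
      using bB I_irrefl[OF i(1)] by (simp add: seg_def lexp_def)
    have cC: "(i, 0, 0) \<in> C" using i by (simp add: C_def)
    have "p \<in> below (B (i, 0))" if p: "p \<in> P" "ltC (fst p) (i, 0, 0)" for p
    proof -
      obtain i' n' k' f where pe: "p = ((i', n', k'), f)" by (metis surj_pair)
      have "(i', n', k') \<in> C" using p(1) pe by simp
      then have "ltW (col p) (i, 0)" using p(2) pe i(2) S by (auto simp: lexp_def C_def)
      then show ?thesis using bB p(1) by (simp add: seg_def)
    qed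
    then have "splits_block (B (i, 0)) (i, 0, 0)"
      unfolding splits_block_def using cC no default_in_Q by blast
    then show False using block_not_both_countable[OF BX _ r] no by blast
  qed
qed

lemma coded: "coded_chain X ltI (I - {i0}) (\<lambda>i. B (i, 0)) S"
proof unfold_locales
  show "B (i, 0) \<in> X" if "i \<in> I - {i0}" for i using that B_in by simp
  show "B (i, 0) < B (i', 0)" if "i \<in> I - {i0}" "i' \<in> I - {i0}" "ltI i i'" for i i'
  proof (rule B_less)
    have "(i, 1, 0) \<in> C" using that by (simp add: C_def)
    then show "((i, 1, 0), z) \<in> P" by (rule mem_P)
  qed (use that I_irrefl in \<open>auto simp: lexp_def\<close>)
  show "B (i, 0) < Sup X" if i: "i \<in> I - {i0}" for i
  proof -
    have "(i, 1, 0) \<in> C" using i by (simp add: C_def)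
    then have P: "((i, 1, 0), z) \<in> P" by (rule mem_P)
    have "B (i, 0) \<le> j ((i, 1, 0), z)"
      by (rule B_le_j[OF _ P]) (use i I_irrefl in \<open>auto simp: lexp_def\<close>)
    also have "j ((i, 1, 0), z) < Sup X" using below_top P by (auto simp: below_def)
    finally show ?thesis .
  qed
  show "marker_limit (<) X bot" by (rule bot_right_limit)
  show "x = bot" if "x \<in> X" "marker_limit (<) X x" for x using that by (rule right_limitD)
  show "marker_limit (>) X (B (i, 0))" if "i \<in> I - {i0}" for i using that column_left_limit by simp
  show "x = Sup X \<or> (\<exists>i\<in>I - {i0}. x = B (i, 0))" if "x \<in> X" "marker_limit (>) X x" for x
    using that by (rule left_limitD)
  show "countable_side (<) X (B (i, 0)) \<longleftrightarrow> i \<in> S" if "i \<in> I - {i0}" for i using that code_iff by simp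
qed

end

section \<open>Cardinality and weight of the completions\<close>

context lex_functions
begin

lemma N_onto_int: "\<exists>\<sigma>. \<forall>k :: int. \<exists>n\<in>N. \<sigma> n = k"
proof -
  have "infinite N"
  proof
    assume "finite N"
    then obtain n where "n \<in> N" "\<forall>k\<in>N. ltN k n" using N_bounded[of N] countable_finite by blast
    then show False using N_irrefl by blast
  qed
  then obtain g :: "nat \<Rightarrow> 'n" where g: "inj g" "range g \<subseteq> N" using infinite_countable_subset by blast
  have "\<exists>n\<in>N. from_nat (inv g n) = k" for k :: int
    using g by (intro bexI[of _ "g (to_nat k)"]) auto
  then show ?thesis by (intro exI[of _ "\<lambda>n. from_nat (inv g n)"] allI)
qed

text \<open>
  Follow \<open>g'\<close> up to and including its first difference to \<open>g\<close>, and then continue with \<open>bt\<close>, which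
  \<open>g'\<close> avoids, for at least one more step.
\<close>

lemma lex_interpolate:
  assumes g: "g \<in> Fn" and g': "g' \<in> Fn" "\<forall>n\<in>N. g' n \<in> EL - {bt}" and less: "lex g g'"
  shows "\<exists>h\<in>Q. lex g h \<and> lex h g'"
proof -
  obtain d where d: "d \<in> N" "\<forall>n\<in>N. ltN n d \<longrightarrow> g n = g' n" "ltE (g d) (g' d)" using less by (rule lexE)
  obtain k where k: "k \<in> N" "ltN d k" using N_above2[OF d(1) d(1)] by metis
  obtain e where e: "e \<in> N" "ltN k e" using N_above2[OF k(1) k(1)] by metis
  let ?H = "{n\<in>N. n = d \<or> ltN n d}"
  let ?h = "pad ?H g' bt e"
  have H: "?H \<subseteq> N" "k \<in> N" "\<And>n. n \<in> ?H \<Longrightarrow> ltN n k"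
    using k by (auto intro: N_trans[OF _ d(1) k(1) _ k(2)])
  have "{n\<in>?H. g' n \<notin> EL} = {}" using g'(2) by blast
  then have few: "countable {n\<in>?H. g' n \<notin> EL}" by (simp only: countable_empty)
  have "?h \<in> Q"
    by (rule pad_in_Q[OF H e(1) EL(2) _ few]) (use Fn_E[OF g'(1)] in auto)
  moreover have "lex g ?h"
    using d by (intro lexI[of d]) (auto simp: pad_def)
  moreover have "lex ?h g'"
  proof -
    have kH: "k \<notin> ?H" using k d(1) N_irrefl[OF k(1)] N_asym[OF d(1) k(1)] by auto
    then have "?h k = bt" using k(1) e(2) by (simp add: pad_def)
    then have hk: "?h k \<noteq> g' k" using g'(2) k(1) by auto
    obtain m where m: "m \<in> N" "?h m \<noteq> g' m" "\<forall>n\<in>N. ltN n m \<longrightarrow> \<not> ?h n \<noteq> g' n"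
      by (rule N_least[of k "\<lambda>n. ?h n \<noteq> g' n", OF k(1) hk])
    have "m = k \<or> ltN m k" using N_total[OF m(1) k(1)] m(3) k(1) hk by blast
    then have "ltN m e" using N_trans[OF m(1) k(1) e(1) _ e(2)] e(2) by blast
    moreover have "m \<notin> ?H" using m(1,2) by (auto simp: pad_def)
    ultimately have "?h m = bt" using m(1) by (simp add: pad_def)
    then have "ltE (?h m) (g' m)" using bt_least[OF Fn_E[OF g'(1) m(1)]] g'(2) m(1) by auto
    then show ?thesis using m by (intro lexI[of m]) auto
  qed
  ultimately show ?thesis by blast
qed

lemma lex_dense_below:
  assumes "f \<in> Q" "g \<in> Fn" "lex f g" shows "\<exists>h\<in>Q. lex f h \<and> lex h g"
proof -
  have tp: "tp \<in> {x\<in>E. ltE e0 x}" using E_mem e0_tp by simp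
  from disjoint_cones[OF assms(1) disjI2[OF conjI[OF assms(2,3)]], of False]
  obtain u v where uv: "\<forall>x\<in>{x\<in>E. ltE e0 x}. u x \<in> Q \<and> v x \<in> Q \<and> lex f (u x) \<and> lex (u x) (v x) \<and> (False \<or> lex (v x) g)"
    by (elim exE conjE)
  from bspec[OF uv tp] have u: "u tp \<in> Q" "v tp \<in> Q" "lex f (u tp)" "lex (u tp) (v tp)" "lex (v tp) g" by simp_all
  have "lex f (v tp)" by (rule Q_trans[OF assms(1) u(1,2,3,4)])
  then show ?thesis using u(2,5) by blast
qed

end

context coded_completion
begin

text \<open>
  In a block this is the corresponding property of \<open>Q\<close>. At a gap, the upper part has a countable
  coinitial set indexed by \<open>\<int>\<close>, and \<open>N\<close> maps onto \<open>\<int>\<close>.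
\<close>

lemma short_sides:
  assumes x: "x \<in> X" and ne: "below x \<noteq> {}" "below x \<noteq> P"
  shows "\<exists>h\<in>Func N P. below x = {p\<in>P. \<exists>n\<in>N. p = h n \<or> ltP p (h n)} \<or>
    below x = {p\<in>P. \<not> (\<exists>n\<in>N. h n = p \<or> ltP (h n) p)}"
proof -
  have proper: "x \<noteq> bot" "x \<noteq> Sup X" using ne below_bot below_top by auto
  show ?thesis
  proof (cases rule: cut_cases[OF x proper, case_names block gap])
    case (block c)
    interpret cut: lex_cut N ltN E ltE EL bt e0 tp "block_trace x c" by (rule block_cut[OF block])
    have cC: "c \<in> C" using block by (simp add: splits_block_def)
    have sub: "below x \<subseteq> P" by (auto simp: below_def)
    have nomax: "\<exists>g\<in>(block_trace x c). lex f g" if f: "f \<in> block_trace x c" for f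
    proof -
      obtain q where q: "q \<in> below x" "ltP (c, f) q" using below_no_max[OF x, of "(c, f)"] f by blast
      have qP: "fst q \<in> C" "snd q \<in> Q" using q(1) sub by auto
      have "\<not> ltC c (fst q)"
      proof
        assume cl: "ltC c (fst q)"
        have "ltC (fst q) c \<or> fst q = c" using block_below[OF block q(1)] by blast
        then have "ltC c c"
          using C_linear[THEN linear_on_trans, OF cC qP(1) cC cl] cl by auto
        then show False using C_linear[THEN linear_on_irrefl] cC by blast
      qed
      then have "c = fst q" "lex f (snd q)" using ltP_cases[OF q(2)] by auto
      then show ?thesis using q(1) qP(2) by (intro bexI[of _ "snd q"]) auto
    qed
    have "Q - block_trace x c \<noteq> {}" using block unfolding splits_block_def by blast
    from cut.short_side[OF nomax this] obtain h where h: "h \<in> Func N Q"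
      and or: "block_trace x c = {p\<in>Q. \<exists>n\<in>N. p = h n \<or> lex p (h n)} \<or>
         Q - block_trace x c = {p\<in>Q. \<exists>n\<in>N. h n = p \<or> lex (h n) p}" by blast
    have hQ: "h n \<in> Q" if "n \<in> N" for n using h that by (auto simp: Func_def)
    let ?h = "\<lambda>n. if n \<in> N then (c, h n) else undefined"
    have hF: "?h \<in> Func N P" using hQ cC by (auto simp: Func_def)
    obtain n0 where n0: "n0 \<in> N" using N_ne by blast
    have low: "ltC (fst p) c \<Longrightarrow> ltP p (c, g)" for p g by (simp add: lexp_def[of ltC lex])
    show ?thesis using or
    proof
      assume D: "block_trace x c = {p\<in>Q. \<exists>n\<in>N. p = h n \<or> lex p (h n)}"
      have "below x = {p\<in>P. \<exists>n\<in>N. p = ?h n \<or> ltP p (?h n)}"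
      proof (intro equalityI subsetI)
        fix p assume p: "p \<in> below x"
        then have pP: "p \<in> P" using sub by blast
        from block_below[OF block p] have "\<exists>n\<in>N. p = (c, h n) \<or> ltP p (c, h n)"
        proof
          assume c: "fst p = c"
          then have "snd p \<in> block_trace x c" using p pP by auto
          then obtain n where n: "n \<in> N" "snd p = h n \<or> lex (snd p) (h n)" unfolding D by blast
          then have "p = (c, h n) \<or> ltP p (c, h n)" using c by (auto simp: lexp_def[of ltC lex] prod_eq_iff)
          then show ?thesis using n(1) by blast
        next
          assume "ltC (fst p) c"
          then show ?thesis using low n0 by blast
        qed
        then show "p \<in> {p\<in>P. \<exists>n\<in>N. p = ?h n \<or> ltP p (?h n)}" using pP by (simp cong: bex_cong)
      next
        fix p assume "p \<in> {p\<in>P. \<exists>n\<in>N. p = ?h n \<or> ltP p (?h n)}"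
        then obtain n where n: "p \<in> P" "n \<in> N" "p = (c, h n) \<or> ltP p (c, h n)" by (auto cong: bex_cong)
        have "h n \<in> {p\<in>Q. \<exists>n\<in>N. p = h n \<or> lex p (h n)}" using n(2) hQ by blast
        then have "(c, h n) \<in> below x" unfolding D[symmetric] by simp
        then show "p \<in> below x" using n(3) below_initial[OF _ n(1)] by blast
      qed
      from disjI1[OF this] hF show ?thesis by (rule bexI)
    next
      assume U: "Q - block_trace x c = {p\<in>Q. \<exists>n\<in>N. h n = p \<or> lex (h n) p}"
      have hU: "(c, h n) \<notin> below x" if "n \<in> N" for n
      proof -
        have "h n \<in> {p\<in>Q. \<exists>n\<in>N. h n = p \<or> lex (h n) p}" using that hQ by blast
        then show ?thesis unfolding U[symmetric] by simp
      qed
      have "below x = {p\<in>P. \<not> (\<exists>n\<in>N. ?h n = p \<or> ltP (?h n) p)}"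
      proof (intro equalityI subsetI)
        fix p assume p: "p \<in> below x"
        then have pP: "p \<in> P" using sub by blast
        have "\<not> (\<exists>n\<in>N. (c, h n) = p \<or> ltP (c, h n) p)"
        proof
          assume "\<exists>n\<in>N. (c, h n) = p \<or> ltP (c, h n) p"
          then obtain n where n: "n \<in> N" "(c, h n) = p \<or> ltP (c, h n) p" by blast
          have "(c, h n) \<in> P" using cC hQ[OF n(1)] by simp
          then have "(c, h n) \<in> below x" using n(2) p below_initial[OF p] by blast
          then show False using hU[OF n(1)] by blast
        qed
        then show "p \<in> {p\<in>P. \<not> (\<exists>n\<in>N. ?h n = p \<or> ltP (?h n) p)}" using pP by (simp cong: bex_cong)
      next
        fix p assume "p \<in> {p\<in>P. \<not> (\<exists>n\<in>N. ?h n = p \<or> ltP (?h n) p)}"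
        then have p: "p \<in> P" "\<And>n. n \<in> N \<Longrightarrow> \<not> ((c, h n) = p \<or> ltP (c, h n) p)" by (auto cong: bex_cong)
        show "p \<in> below x"
        proof (rule ccontr)
          assume np: "p \<notin> below x"
          have pC: "fst p \<in> C" "snd p \<in> Q" using p(1) by auto
          have "\<not> ltC (fst p) c" by (rule block_not_below[OF block p(1) np])
          then consider "fst p = c" | "ltC c (fst p)"
            using C_linear[THEN linear_on_total] pC(1) cC by blast
          then show False
          proof cases
            case 1
            then have "(c, snd p) \<notin> below x" using np by auto
            then have "snd p \<in> Q - block_trace x c" using pC(2) by simp
            then obtain n where "n \<in> N" "h n = snd p \<or> lex (h n) (snd p)" unfolding U by blast
            then show False using p(2)[of n] 1 by (auto simp: lexp_def[of ltC lex] prod_eq_iff)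
          next
            case 2
            then show False using p(2)[OF n0] by (simp add: lexp_def[of ltC lex])
          qed
        qed
      qed
      from disjI2[OF this] hF show ?thesis by (rule bexI)
    qed
  next
    case (gap i n)
    obtain \<sigma> where \<sigma>: "\<forall>k :: int. \<exists>m\<in>N. \<sigma> m = k" using N_onto_int by blast
    let ?h = "\<lambda>m. if m \<in> N then ((i, n, \<sigma> m), z) else undefined"
    have "?h \<in> Func N P" using gap(2) default_in_Q by (auto simp: Func_def)
    moreover have "(\<exists>k. ((i, n, k), z) = p \<or> ltP ((i, n, k), z) p) \<longleftrightarrow> (\<exists>m\<in>N. ?h m = p \<or> ltP (?h m) p)" for p
      using \<sigma> by (simp cong: bex_cong) metis
    then have "below x = {p\<in>P. \<not> (\<exists>m\<in>N. ?h m = p \<or> ltP (?h m) p)}"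
      using gap_right_countable(2)[OF gap(1,2)] gap(3) by simp
    from disjI2[OF this] \<open>?h \<in> Func N P\<close> show ?thesis by (rule bexI)
  qed
qed

lemma card_le:
  assumes "Cinfinite \<mu>" "|Func N P| \<le>o \<mu>" shows "|X| \<le>o \<mu>"
proof (rule card_le_if_short_sides[OF _ assms])
  fix x assume "x \<in> X" "below x \<noteq> {}" "below x \<noteq> P"
  then show "\<exists>h\<in>Func N P. below x = {p\<in>P. \<exists>n\<in>N. p = h n \<or> ltP p (h n)} \<or>
    below x = {p\<in>P. \<not> (\<exists>n\<in>N. h n = p \<or> ltP (h n) p)}" by (rule short_sides)
qed

text \<open>
  Each function into \<open>EL\<close> that avoids \<open>bt\<close> determines a cut in the block of \<open>(i0, 0, 0)\<close>. Avoiding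
  \<open>bt\<close> ensures that different functions are separated by an element of \<open>Q\<close>.
\<close>

lemma card_ge: "|Func N (EL - {bt})| \<le>o |X|"
proof -
  let ?G = "{g\<in>Fn. \<forall>n\<in>N. g n \<in> EL - {bt}}"
  let ?c = "(i0, 0, 0)"
  let ?I = "\<lambda>g. {p\<in>P. ltC (fst p) ?c \<or> fst p = ?c \<and> lex (snd p) g}"
  have below_I: "Sup (j ` ?I g) \<in> X" "below (Sup (j ` ?I g)) = ?I g" if g: "g \<in> ?G" for g
  proof -
    have gF: "g \<in> Fn" using g by simp
    have 1: "?I g \<subseteq> P" by blast
    have 2: "p \<in> ?I g" if q: "q \<in> ?I g" and p: "p \<in> P" "ltP p q" for p q
    proof -
      have mem: "fst p \<in> C" "fst q \<in> C" "snd p \<in> Fn" "snd q \<in> Fn" using p(1) q Q_Fn by auto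
      note tr = C_linear[THEN linear_on_trans, OF mem(1,2) C_i0]
      have "ltC (fst q) ?c \<or> fst q = ?c \<and> lex (snd q) g" using q by blast
      then have "ltC (fst p) ?c \<or> fst p = ?c \<and> lex (snd p) g"
        using ltP_cases[OF p(2)] tr lex_trans[OF mem(3,4) gF] by auto
      then show ?thesis using p(1) by blast
    qed
    have 3: "\<exists>q\<in>?I g. ltP p q" if p: "p \<in> ?I g" for p
    proof -
      have pP: "fst p \<in> C" "snd p \<in> Q" using p by auto
      have "\<exists>h\<in>Q. lex (snd p) h \<and> (ltC (fst p) ?c \<or> fst p = ?c \<and> lex h g)"
        using p Q_greater[OF pP(2)] lex_dense_below[OF pP(2) gF] by blast
      then obtain h where h: "h \<in> Q" "lex (snd p) h" "ltC (fst p) ?c \<or> fst p = ?c \<and> lex h g" by blast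
      then have "(fst p, h) \<in> ?I g" using pP by simp
      moreover have "ltP p (fst p, h)" using h(2) by (simp add: lexp_def[of ltC lex])
      ultimately show ?thesis by (rule bexI[rotated])
    qed
    show "Sup (j ` ?I g) \<in> X" by (rule below_Sup(1)[OF 1 2 3])
    show "below (Sup (j ` ?I g)) = ?I g" by (rule below_Sup(2)[OF 1 2 3])
  qed
  have differ: "?I g \<noteq> ?I g'" if g: "g \<in> ?G" "g' \<in> ?G" "lex g g'" for g g'
  proof -
    obtain h where h: "h \<in> Q" "lex g h" "lex h g'" using lex_interpolate[of g g'] g by auto
    have hF: "h \<in> Fn" "g \<in> Fn" using h(1) Q_Fn g(1) by auto
    have "\<not> ltC ?c ?c" using C_linear[THEN linear_on_irrefl] C_i0 by blast
    moreover have "\<not> lex h g" using lex_trans[OF hF(2,1,2) h(2)] lex_irrefl[OF hF(2)] by blast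
    ultimately have "(?c, h) \<notin> ?I g" by simp
    moreover have "(?c, h) \<in> ?I g'" using h C_i0 by simp
    ultimately show ?thesis by blast
  qed
  let ?F = "\<lambda>f n. if n \<in> N then f n else e0"
  have FG: "?F f \<in> ?G" if "f \<in> Func N (EL - {bt})" for f
    using that EL by (auto simp: Func_def Fn_def)
  have "inj_on (\<lambda>f. Sup (j ` ?I (?F f))) (Func N (EL - {bt}))"
  proof (rule inj_onI)
    fix f f' assume f: "f \<in> Func N (EL - {bt})" "f' \<in> Func N (EL - {bt})"
      and eq: "Sup (j ` ?I (?F f)) = Sup (j ` ?I (?F f'))"
    have "?I (?F f) = ?I (?F f')" using below_I(2)[OF FG[OF f(1)]] below_I(2)[OF FG[OF f(2)]] eq by metis
    then have "\<not> lex (?F f) (?F f')" "\<not> lex (?F f') (?F f)"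
      using differ[OF FG[OF f(1)] FG[OF f(2)]] differ[OF FG[OF f(2)] FG[OF f(1)]] by metis+
    moreover have "?F f \<in> Fn" "?F f' \<in> Fn" using FG f by blast+
    ultimately have e: "?F f = ?F f'" using lex_total by blast
    have "f n = f' n" for n
    proof (cases "n \<in> N")
      case True then show ?thesis using fun_cong[OF e, of n] by simp
    next
      case False then show ?thesis using f by (simp add: Func_def)
    qed
    then show "f = f'" by blast
  qed
  moreover have "(\<lambda>f. Sup (j ` ?I (?F f))) ` Func N (EL - {bt}) \<subseteq> X" using below_I(1) FG by blast
  ultimately show ?thesis using card_of_ordLeq by blast
qed

lemma weights_eq:
  fixes \<kappa> :: "'k rel"
  assumes \<kappa>: "Cinfinite \<kappa>" and "|P| \<le>o \<kappa>" and T: "\<kappa> \<le>o |{x\<in>E. ltE e0 x}|"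
  shows "weight (chain_topology X) =o \<kappa>"
    and "min_open_weight (chain_topology X) =o weight (chain_topology X)"
proof -
  have cell: "\<exists>(T :: 'e set) u v. \<kappa> \<le>o |T| \<and> (\<forall>e\<in>T. u e \<in> P \<and> v e \<in> P \<and> ltP p (u e) \<and> ltP (u e) (v e) \<and> ltP (v e) q) \<and>
        (\<forall>d\<in>T. \<forall>e\<in>T. d \<noteq> e \<longrightarrow> ltP (v d) (u e) \<or> ltP (v e) (u d))"
    if pq: "p \<in> P" "q \<in> P" "ltP p q" for p q
  proof -
    have "q \<noteq> p" using pq lt_irrefl by blast
    from P_cells[OF pq(1) disjI1[OF conjI[OF pq(2,3)]]] obtain u v where
      uv: "\<forall>x\<in>{x\<in>E. ltE e0 x}. u x \<in> P \<and> v x \<in> P \<and> ltP p (u x) \<and> ltP (u x) (v x) \<and> (q = p \<or> ltP (v x) q)"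
      and sep: "\<forall>x\<in>{x\<in>E. ltE e0 x}. \<forall>y\<in>{x\<in>E. ltE e0 x}. x \<noteq> y \<longrightarrow> ltP (v x) (u y) \<or> ltP (v y) (u x)"
      by (elim exE conjE)
    have uv': "\<forall>e\<in>{x\<in>E. ltE e0 x}. u e \<in> P \<and> v e \<in> P \<and> ltP p (u e) \<and> ltP (u e) (v e) \<and> ltP (v e) q"
    proof
      fix e assume "e \<in> {x\<in>E. ltE e0 x}"
      from bspec[OF uv this] show "u e \<in> P \<and> v e \<in> P \<and> ltP p (u e) \<and> ltP (u e) (v e) \<and> ltP (v e) q"
        using \<open>q \<noteq> p\<close> by (elim conjE disjE) (blast, intro conjI)
    qed
    show ?thesis
      by (rule exI[of _ "{x\<in>E. ltE e0 x}"], rule exI[of _ u], rule exI[of _ v]) (intro conjI T uv' sep)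
  qed
  show "weight (chain_topology X) =o \<kappa>"
  proof (rule weights(1)[OF assms(1,2)])
    fix p q assume "p \<in> P" "q \<in> P" "ltP p q"
    then show "\<exists>(T :: 'e set) u v. \<kappa> \<le>o |T| \<and> (\<forall>e\<in>T. u e \<in> P \<and> v e \<in> P \<and> ltP p (u e) \<and> ltP (u e) (v e) \<and> ltP (v e) q) \<and>
        (\<forall>d\<in>T. \<forall>e\<in>T. d \<noteq> e \<longrightarrow> ltP (v d) (u e) \<or> ltP (v e) (u d))" by (rule cell)
  qed
  show "min_open_weight (chain_topology X) =o weight (chain_topology X)"
  proof (rule weights(2)[OF assms(1,2)])
    fix p q assume "p \<in> P" "q \<in> P" "ltP p q"
    then show "\<exists>(T :: 'e set) u v. \<kappa> \<le>o |T| \<and> (\<forall>e\<in>T. u e \<in> P \<and> v e \<in> P \<and> ltP p (u e) \<and> ltP (u e) (v e) \<and> ltP (v e) q) \<and>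
        (\<forall>d\<in>T. \<forall>e\<in>T. d \<noteq> e \<longrightarrow> ltP (v d) (u e) \<or> ltP (v e) (u d))" by (rule cell)
  qed
qed

end

section \<open>Cardinal arithmetic\<close>

text \<open>
  A member of \<open>Q\<close> is given by a bound \<open>d\<close> of its support, its values in \<open>EL\<close> below \<open>d\<close>, and a sequence
  that enumerates the pairs of exceptional arguments and values.
\<close>

lemma (in lex_functions) card_Q_le:
  fixes \<kappa> :: "'k rel"
  assumes \<kappa>: "Cinfinite \<kappa>" and N: "|N| \<le>o \<kappa>"
    and initial: "\<And>d. d \<in> N \<Longrightarrow> |Func {n\<in>N. ltN n d} EL| \<le>o \<kappa>"
    and omega: "|Func (UNIV :: nat set) (N \<times> E)| \<le>o \<kappa>"
  shows "|Q| \<le>o \<kappa>"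
proof -
  let ?S = "\<lambda>d. {n\<in>N. ltN n d}"
  let ?f = "\<lambda>(g, h :: nat \<Rightarrow> 'n \<times> 'e) n. if n \<in> fst ` range h then snd (h (LEAST i. fst (h i) = n))
     else if g n \<in> EL then g n else e0"
  let ?A = "\<lambda>d. Func (?S d) EL \<times> Func (UNIV :: nat set) (N \<times> E)"
  obtain n1 where n1: "n1 \<in> N" using N_ne by blast
  have "Q \<subseteq> (\<Union>d\<in>N. ((\<lambda>q n. if n \<in> ?S d \<or> n \<in> fst ` range (snd q) then ?f q n else e0) ` ?A d))"
  proof
    fix f assume f: "f \<in> Q"
    then obtain a where a: "a \<in> N" "\<forall>n\<in>N. ltN a n \<longrightarrow> f n = e0" unfolding Q_def by blast
    obtain d where d: "d \<in> N" "ltN a d" using N_above2[OF a(1) a(1)] by metis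
    have zero: "f n = e0" if "n \<notin> ?S d" for n
    proof (cases "n \<in> N")
      case True
      then have "n = d \<or> ltN d n" using that N_total[OF True d(1)] by blast
      then have "ltN a n" using d(2) N_trans[OF a(1) d(1) True d(2)] by blast
      then show ?thesis using a(2) True by blast
    next
      case False then show ?thesis using f by (simp add: Q_def Fn_def)
    qed
    \<comment> \<open>The argument \<open>n1\<close> is added so that there is something to enumerate.\<close>
    let ?K = "insert n1 {n\<in>N. f n \<notin> EL}"
    have "countable {n\<in>N. f n \<notin> EL}" using f unfolding Q_def by (elim CollectE conjE)
    then have "countable ?K" by simp
    then obtain k :: "nat \<Rightarrow> 'n" where k: "range k = ?K"
      using range_from_nat_into[of ?K] by blast
    let ?h = "\<lambda>i. (k i, f (k i))"
    let ?g = "\<lambda>n. if n \<in> ?S d then (if f n \<in> EL then f n else bt) else undefined"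
    have "?K \<subseteq> N" using n1 by blast
    then have "k i \<in> N" for i using rangeI[of k i] unfolding k by blast
    then have "?h \<in> Func UNIV (N \<times> E)" using Q_E[OF f] by (simp add: Func_def)
    moreover have "?g \<in> Func (?S d) EL" using EL by (simp add: Func_def)
    moreover have "f = (\<lambda>n. if n \<in> ?S d \<or> n \<in> fst ` range ?h then ?f (?g, ?h) n else e0)"
    proof
      fix n
      have "fst ` range ?h = range k" by (simp add: image_image)
      then have im: "fst ` range ?h = ?K" unfolding k .
      show "f n = (if n \<in> ?S d \<or> n \<in> fst ` range ?h then ?f (?g, ?h) n else e0)"
      proof (cases "n \<in> ?K")
        case True
        then obtain i where "k i = n" using k by (metis rangeE)
        then have "k (LEAST i. k i = n) = n" by (rule LeastI)
        then show ?thesis using True im by simp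
      next
        case False
        then show ?thesis using im zero[of n] by auto
      qed
    qed
    ultimately show "f \<in> (\<Union>d\<in>N. ((\<lambda>q n. if n \<in> ?S d \<or> n \<in> fst ` range (snd q) then ?f q n else e0) ` ?A d))"
      using d(1) by (intro UN_I[of d] image_eqI[of _ _ "(?g, ?h)"]) auto
  qed
  moreover have "|\<Union>d\<in>N. ((\<lambda>q n. if n \<in> ?S d \<or> n \<in> fst ` range (snd q) then ?f q n else e0) ` ?A d)| \<le>o \<kappa>"
  proof (rule UNION_Cinfinite_bound[OF N _ \<kappa>], rule ballI)
    fix d assume "d \<in> N"
    then have "|?A d| \<le>o \<kappa>"
      using \<kappa> initial omega by (intro card_of_Times_ordLeq_infinite_Field) (auto simp: cinfinite_def)
    then show "|(\<lambda>q n. if n \<in> ?S d \<or> n \<in> fst ` range (snd q) then ?f q n else e0) ` ?A d| \<le>o \<kappa>"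
      by (rule ordLeq_transitive[OF card_of_image])
  qed
  ultimately show ?thesis using card_of_mono1 ordLeq_transitive by blast
qed

abbreviation strict :: "'a rel \<Rightarrow> 'a \<Rightarrow> 'a \<Rightarrow> bool" where
  "strict r x y \<equiv> (x, y) \<in> r \<and> x \<noteq> y"

lemma strict_linear: assumes "Well_order r" shows "linear_on (strict r) (Field r)"
proof (rule linear_onI)
  have r: "trans r" "antisym r" "total_on (Field r) r"
    using assms unfolding well_order_on_def linear_order_on_def partial_order_on_def preorder_on_def by blast+
  show "strict r x z" if "strict r x y" "strict r y z" for x y z
    using that r(1,2) by (auto dest: transD antisymD)
  show "strict r x y \<or> strict r y x" if "x \<in> Field r" "y \<in> Field r" "x \<noteq> y" for x y
    using that r(3) unfolding total_on_def by blast
qed simp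

lemma strict_wf: assumes "Well_order r" shows "wfp_on (Field r) (strict r)"
  unfolding wfp_on_iff_ex_minimal
proof (intro allI impI)
  fix B assume "B \<subseteq> Field r" "B \<noteq> {}"
  moreover have "wf (r - Id)" using assms by (simp add: well_order_on_def)
  ultimately obtain z where "z \<in> B" "\<forall>y. (y, z) \<in> r - Id \<longrightarrow> y \<notin> B" unfolding wf_iff_ex_minimal by blast
  then show "\<exists>z\<in>B. \<forall>y. strict r y z \<longrightarrow> y \<notin> B" by blast
qed

text \<open>
  Moving one element of a well-ordered set to its top gives a well-order with a greatest element.
\<close>

lemma well_order_with_ends:
  assumes "Cinfinite \<kappa>"
  obtains ltE bt e0 tp where "linear_on ltE (Field \<kappa>)" "wfp_on (Field \<kappa>) ltE"
    "bt \<in> Field \<kappa>" "e0 \<in> Field \<kappa>" "tp \<in> Field \<kappa>" "ltE bt e0" "ltE e0 tp"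
    "\<forall>x\<in>Field \<kappa>. x \<noteq> bt \<longrightarrow> ltE bt x" "\<forall>x\<in>Field \<kappa>. x \<noteq> tp \<longrightarrow> ltE x tp"
    "\<forall>x\<in>Field \<kappa>. x \<noteq> bt \<longrightarrow> x \<noteq> e0 \<longrightarrow> ltE e0 x"
proof -
  let ?E = "Field \<kappa>"
  have inf: "infinite ?E" and wo: "Well_order \<kappa>" using assms by (auto simp: cinfinite_def card_order_on_def)
  note lin = strict_linear[OF wo]
  note tr = lin[THEN linear_on_trans] and tot = lin[THEN linear_on_total]
  obtain a where a: "a \<in> ?E" using inf by (metis finite.emptyI ex_in_conv)
  define ltE where "ltE x y \<longleftrightarrow> x \<noteq> a \<and> (y = a \<or> strict \<kappa> x y)" for x y
  have linE: "linear_on ltE ?E"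
  proof (rule linear_onI)
    show "\<not> ltE x x" for x by (simp add: ltE_def)
    show "ltE x z" if m: "x \<in> ?E" "y \<in> ?E" "z \<in> ?E" and l: "ltE x y" "ltE y z" for x y z
    proof -
      have "x \<noteq> a" "strict \<kappa> x y" "z = a \<or> strict \<kappa> y z" using l unfolding ltE_def by auto
      then show ?thesis using tr[OF m] unfolding ltE_def by blast
    qed
    show "ltE x y \<or> ltE y x" if "x \<in> ?E" "y \<in> ?E" "x \<noteq> y" for x y
      using tot[OF that] that(3) unfolding ltE_def by blast
  qed
  have wfE: "wfp_on ?E ltE"
    unfolding wfp_on_iff_ex_minimal
  proof (intro allI impI)
    fix B assume B: "B \<subseteq> ?E" "B \<noteq> {}"
    show "\<exists>z\<in>B. \<forall>y. ltE y z \<longrightarrow> y \<notin> B"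
    proof (cases "B \<subseteq> {a}")
      case True
      then have "B = {a}" using B(2) by blast
      then show ?thesis unfolding ltE_def by simp
    next
      case False
      then have "B - {a} \<noteq> {}" "B - {a} \<subseteq> ?E" using B(1) by blast+
      then obtain z where z: "z \<in> B - {a}" "\<forall>y. strict \<kappa> y z \<longrightarrow> y \<notin> B - {a}"
        using strict_wf[OF wo] unfolding wfp_on_iff_ex_minimal by blast
      then have "\<forall>y. ltE y z \<longrightarrow> y \<notin> B" unfolding ltE_def by blast
      then show ?thesis using z(1) by blast
    qed
  qed
  note totE = linE[THEN linear_on_total]
  obtain bt where bt: "bt \<in> ?E" "\<forall>x\<in>?E. x \<noteq> bt \<longrightarrow> ltE bt x"
  proof -
    have "?E \<noteq> {}" using a by blast
    then obtain b where "b \<in> ?E" "\<forall>y. ltE y b \<longrightarrow> y \<notin> ?E" using wfE unfolding wfp_on_iff_ex_minimal by blast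
    then show ?thesis using that[of b] totE by blast
  qed
  have "infinite (?E - {bt})" using inf by simp
  then have "?E - {bt} \<noteq> {}" by (metis finite.emptyI)
  then obtain e0 where e0: "e0 \<in> ?E - {bt}" "\<forall>y. ltE y e0 \<longrightarrow> y \<notin> ?E - {bt}"
    using wfE unfolding wfp_on_iff_ex_minimal by blast
  then have e0': "\<forall>x\<in>?E. x \<noteq> bt \<longrightarrow> x \<noteq> e0 \<longrightarrow> ltE e0 x" using totE by blast
  have "e0 \<noteq> a"
  proof
    assume "e0 = a"
    have "infinite (?E - {bt, a})" using inf by simp
    then have "?E - {bt, a} \<noteq> {}" by (metis finite.emptyI)
    then obtain x where "x \<in> ?E" "x \<noteq> bt" "x \<noteq> a" by blast
    then have "ltE a x" using e0' \<open>e0 = a\<close> by blast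
    then show False by (simp add: ltE_def)
  qed
  then have "ltE e0 a" "\<forall>x\<in>?E. x \<noteq> a \<longrightarrow> ltE x a" by (simp_all add: ltE_def)
  moreover have "ltE bt e0" using bt e0(1) by blast
  ultimately show ?thesis using that[OF linE wfE bt(1) _ a _ _ bt(2) _ e0'] e0(1) by blast
qed

locale cardinal_pair =
  fixes \<kappa> :: "'k rel" and lam :: "'l rel"
  assumes \<kappa>: "Cinfinite \<kappa>" and lam: "Cinfinite lam" and le: "lam \<le>o \<kappa>" and omega: "\<kappa> ^c natLeq =o \<kappa>"
begin

abbreviation "\<nu> \<equiv> nu lam \<kappa>"

lemma nu_in: "\<nu> \<in> {\<mu>. Cinfinite \<mu> \<and> \<kappa> <o lam ^c \<mu>}"
  and nu_le: "\<And>\<mu> :: 'k rel. Cinfinite \<mu> \<Longrightarrow> \<kappa> <o lam ^c \<mu> \<Longrightarrow> \<nu> \<le>o \<mu>"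
proof -
  let ?R = "{\<mu> :: 'k rel. Cinfinite \<mu> \<and> \<kappa> <o lam ^c \<mu>}"
  have ne: "?R \<noteq> {}" using nu_candidate[OF lam \<kappa>] \<kappa> by blast
  have co: "\<And>r. r \<in> ?R \<Longrightarrow> Card_order r" by blast
  show "\<nu> \<in> ?R" unfolding nu_def by (rule least_card_in[OF ne co])
  show "\<nu> \<le>o \<mu>" if "Cinfinite \<mu>" "\<kappa> <o lam ^c \<mu>" for \<mu> :: "'k rel"
    unfolding nu_def by (rule least_card_le[OF ne co]) (use that in auto)
qed

lemma nu_inf: "Cinfinite \<nu>" and nu_gt: "\<kappa> <o lam ^c \<nu>" using nu_in by auto

lemma nu_le_\<kappa>: "\<nu> \<le>o \<kappa>" by (rule nu_le[OF \<kappa> nu_candidate[OF lam \<kappa>]])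

lemma Func_nat_le: assumes "|A| \<le>o \<kappa>" shows "|Func (UNIV :: nat set) A| \<le>o \<kappa>"
proof -
  have "|A| ^c natLeq \<le>o \<kappa> ^c natLeq" using assms natLeq_Card_order by (rule cexp_mono1)
  then have "|A| ^c natLeq \<le>o \<kappa>" using omega ordLeq_ordIso_trans by blast
  then show ?thesis by (simp add: cexp_def Field_natLeq Field_card_of)
qed

text \<open>
  For infinite \<open>U\<close> this is the minimality of \<open>\<nu>\<close>; for finite \<open>U\<close> the exponent is at most \<open>\<omega>\<close>.
\<close>

lemma Func_small_le:
  fixes U :: "'k set"
  assumes U: "|U| <o \<nu>" and A: "|A| \<le>o lam" shows "|Func U A| \<le>o \<kappa>"
proof (cases "finite U")
  case True
  have A\<kappa>: "|A| \<le>o \<kappa>" using A le ordLeq_transitive by blast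
  show ?thesis
  proof (cases "U = {}")
    case True
    then have "Func U A = {\<lambda>_. undefined}" by (auto simp: Func_def)
    moreover have "Field \<kappa> \<noteq> {}" using \<kappa> by (auto simp: cinfinite_def)
    ultimately show ?thesis using Card_order_singl_ordLeq[of \<kappa>] \<kappa> by simp
  next
    case False
    have "|U| \<le>o natLeq" using True finite_iff_ordLess_natLeq ordLess_imp_ordLeq by blast
    moreover have "Cnotzero |U|" using False by (simp add: card_of_ordIso_czero_iff_empty card_of_Card_order)
    ultimately have "|A| ^c |U| \<le>o |A| ^c natLeq" by (intro cexp_mono2_Cnotzero) (auto simp: card_of_Card_order)
    then have "|Func U A| \<le>o |Func (UNIV :: nat set) A|" by (simp add: cexp_def Field_natLeq Field_card_of)
    then show ?thesis using Func_nat_le[OF A\<kappa>] ordLeq_transitive by blast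
  qed
next
  case False
  then have inf: "Cinfinite |U|" by (simp add: cinfinite_def card_of_card_order_on Field_card_of)
  have "\<not> \<kappa> <o lam ^c |U|" using nu_le[OF inf] U not_ordLess_ordLeq by blast
  moreover have "Well_order \<kappa>" "Well_order (lam ^c |U| )"
    using \<kappa> Card_order_cexp[of lam "|U|"] by (auto simp: card_order_on_def)
  ultimately have "lam ^c |U| \<le>o \<kappa>" using ordLess_or_ordLeq by blast
  moreover have "|A| ^c |U| \<le>o lam ^c |U|" using A card_of_Card_order by (rule cexp_mono1)
  ultimately show ?thesis using ordLeq_transitive by (auto simp: cexp_def Field_card_of)
qed

lemma nu_initial: assumes "d \<in> Field \<nu>" shows "|{n\<in>Field \<nu>. strict \<nu> n d}| <o \<nu>"
proof -
  have "{n\<in>Field \<nu>. strict \<nu> n d} = underS \<nu> d" by (auto simp: underS_def Field_def)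
  then show ?thesis using card_of_underS[of \<nu> d] nu_inf assms by simp
qed

text \<open>
  A countable cofinal subset of \<open>\<nu>\<close> would bound \<open>\<lambda>\<^sup>\<nu>\<close> by a product of countably many powers
  \<open>\<lambda>\<^sup>\<mu> \<le> \<kappa>\<close>, hence by \<open>\<kappa>\<^sup>\<omega> = \<kappa>\<close>.
\<close>

lemma nu_uncountable_cofinality:
  assumes K: "K \<subseteq> Field \<nu>" "countable K"
  shows "\<exists>n\<in>Field \<nu>. \<forall>k\<in>K. strict \<nu> k n"
proof (rule ccontr)
  assume no: "\<not> ?thesis"
  let ?N = "Field \<nu>" and ?L = "Field lam"
  have wo: "Well_order \<nu>" using nu_inf by (auto simp: card_order_on_def)
  note lin = strict_linear[OF wo]
  have "?N \<noteq> {}" using nu_inf by (metis cinfinite_def finite.emptyI)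
  then have "K \<noteq> {}" using no by blast
  then obtain k :: "nat \<Rightarrow> 'k" where k: "range k = K" using range_from_nat_into K(2) by metis
  have "\<exists>b\<in>?N. k i \<noteq> b \<and> (k i, b) \<in> \<nu>" for i
  proof (rule infinite_Card_order_limit)
    show "k i \<in> ?N" using k K(1) by blast
  qed (use nu_inf in \<open>auto simp: cinfinite_def\<close>)
  then obtain b where b: "\<And>i. b i \<in> ?N \<and> k i \<noteq> b i \<and> (k i, b i) \<in> \<nu>" by metis
  let ?S = "\<lambda>i. {n\<in>?N. strict \<nu> n (b i)}"
  have cover: "\<exists>i. n \<in> ?S i" if n: "n \<in> ?N" for n
  proof -
    obtain i where i: "\<not> strict \<nu> (k i) n" using no n k by blast
    have kN: "k i \<in> ?N" using k K(1) by blast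
    have "n = k i \<or> strict \<nu> n (k i)" using lin[THEN linear_on_total] n kN i by blast
    moreover have bi: "b i \<in> ?N" "strict \<nu> (k i) (b i)" using b[of i] by simp_all
    moreover have "strict \<nu> n (b i)" if "strict \<nu> n (k i)"
      by (rule lin[THEN linear_on_trans, OF n kN bi(1) that bi(2)])
    ultimately have "strict \<nu> n (b i)" by (elim disjE) simp_all
    then show ?thesis using n by blast
  qed
  have "|?L| \<le>o lam" using lam card_of_Field_ordIso ordIso_imp_ordLeq by blast
  then have le: "|Func (?S i) ?L| \<le>o \<kappa>" for i
    using Func_small_le[OF nu_initial] b by blast
  have \<kappa>F: "\<kappa> =o |Field \<kappa>|" using \<kappa> card_of_Field_ordIso ordIso_symmetric by blast
  have "\<exists>c. inj_on c (Func (?S i) ?L) \<and> c ` Func (?S i) ?L \<subseteq> Field \<kappa>" for i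
    using le[of i] \<kappa>F ordLeq_ordIso_trans card_of_ordLeq by blast
  then have "\<forall>i. \<exists>c. inj_on c (Func (?S i) ?L) \<and> c ` Func (?S i) ?L \<subseteq> Field \<kappa>" by (rule allI)
  from choice[OF this] obtain c
    where "\<forall>i. inj_on (c i) (Func (?S i) ?L) \<and> c i ` Func (?S i) ?L \<subseteq> Field \<kappa>" by (elim exE)
  then have c: "inj_on (c i) (Func (?S i) ?L) \<and> c i ` Func (?S i) ?L \<subseteq> Field \<kappa>" for i by (rule spec)
  let ?r = "\<lambda>f i n. if n \<in> ?S i then f n else undefined"
  let ?\<Phi> = "\<lambda>f i. c i (?r f i)"
  have rF: "?r f i \<in> Func (?S i) ?L" if "f \<in> Func ?N ?L" for f i using that by (auto simp: Func_def)
  have "inj_on ?\<Phi> (Func ?N ?L)"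
  proof (rule inj_onI)
    fix f g assume f: "f \<in> Func ?N ?L" "g \<in> Func ?N ?L" and eq: "?\<Phi> f = ?\<Phi> g"
    have "f n = g n" for n
    proof (cases "n \<in> ?N")
      case True
      then obtain i where i: "n \<in> ?S i" using cover by blast
      have "?r f i = ?r g i"
        by (rule inj_onD[OF conjunct1[OF c[of i]] fun_cong[OF eq, of i] rF[OF f(1)] rF[OF f(2)]])
      then show ?thesis using fun_cong[of "?r f i" "?r g i" n] i by simp
    next
      case False then show ?thesis using f by (simp add: Func_def)
    qed
    then show "f = g" by blast
  qed
  moreover have "?\<Phi> ` Func ?N ?L \<subseteq> Func (UNIV :: nat set) (Field \<kappa>)"
  proof (rule image_subsetI)
    fix f assume "f \<in> Func ?N ?L"
    then have "c i (?r f i) \<in> Field \<kappa>" for i using conjunct2[OF c[of i]] rF[of f i] by blast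
    then show "?\<Phi> f \<in> Func (UNIV :: nat set) (Field \<kappa>)" by (simp add: Func_def)
  qed
  ultimately have "|Func ?N ?L| \<le>o |Func (UNIV :: nat set) (Field \<kappa>)|" using card_of_ordLeq by blast
  moreover have "|Func (UNIV :: nat set) (Field \<kappa>)| \<le>o \<kappa>"
    by (rule Func_nat_le) (use \<kappa>F ordIso_symmetric ordIso_imp_ordLeq in blast)
  ultimately have "lam ^c \<nu> \<le>o \<kappa>" unfolding cexp_def by (rule ordLeq_transitive)
  then show False using nu_gt not_ordLess_ordLeq by blast
qed

end

section \<open>The family of continua\<close>

text \<open>
  An order with at most \<open>\<kappa>\<close> elements is copied into the type of \<open>\<kappa>\<close>, so that the cuts become sets over
  that type.
\<close>

lemma completion_exists:
  fixes P :: "'p set" and \<kappa> :: "'k rel"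
  assumes lin: "linear_on lt P" and ne: "P \<noteq> {}" and card: "Card_order \<kappa>" "|P| \<le>o \<kappa>"
    and dense: "\<And>p q. p \<in> P \<Longrightarrow> q \<in> P \<Longrightarrow> lt p q \<Longrightarrow> \<exists>z\<in>P. lt p z \<and> lt z q"
    and nomax: "\<And>p. p \<in> P \<Longrightarrow> \<exists>z\<in>P. lt p z"
  shows "\<exists>(X :: 'k set set) j. completion X P lt j"
proof -
  have "|P| \<le>o |Field \<kappa>|"
    by (rule ordLeq_ordIso_trans[OF card(2) ordIso_symmetric[OF card_of_Field_ordIso[OF card(1)]]])
  from iffD2[OF card_of_ordLeq this] obtain e where e: "inj_on e P" "e ` P \<subseteq> Field \<kappa>" by (elim exE conjE)
  let ?A = "e ` P" and ?i = "the_inv_into P e"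
  let ?lt = "\<lambda>x y. lt (?i x) (?i y)"
  have ie: "?i (e p) = p" if "p \<in> P" for p using the_inv_into_f_f[OF e(1) that] .
  have iA: "?i x \<in> P" if "x \<in> ?A" for x using that ie by auto
  have inj: "?i x = ?i y \<longleftrightarrow> x = y" if "x \<in> ?A" "y \<in> ?A" for x y using that ie by auto
  note l = lin
  have "linear_on ?lt ?A"
  proof (rule linear_onI)
    show "\<not> ?lt x x" if "x \<in> ?A" for x using l[THEN linear_on_irrefl] iA[OF that] by blast
    show "?lt x z" if "x \<in> ?A" "y \<in> ?A" "z \<in> ?A" "?lt x y" "?lt y z" for x y z
      by (rule l[THEN linear_on_trans, OF iA iA iA, OF that])
    show "?lt x y \<or> ?lt y x" if "x \<in> ?A" "y \<in> ?A" "x \<noteq> y" for x y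
      using l[THEN linear_on_total] iA[OF that(1)] iA[OF that(2)] inj[OF that(1,2)] that(3) by blast
  qed
  moreover have "\<exists>z\<in>?A. ?lt x z \<and> ?lt z y" if xy: "x \<in> ?A" "y \<in> ?A" "?lt x y" for x y
  proof -
    obtain z where "z \<in> P" "lt (?i x) z" "lt z (?i y)" using dense[OF iA[OF xy(1)] iA[OF xy(2)] xy(3)] by blast
    then show ?thesis using ie by (intro bexI[of _ "e z"]) auto
  qed
  moreover have "\<exists>z\<in>?A. ?lt x z" if x: "x \<in> ?A" for x
  proof -
    obtain z where "z \<in> P" "lt (?i x) z" using nomax[OF iA[OF x]] by blast
    then show ?thesis using ie by (intro bexI[of _ "e z"]) auto
  qed
  ultimately have "completion (cuts ?A ?lt) ?A ?lt (\<lambda>x. {q\<in>?A. ?lt q x})"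
    using ne by (intro completion_cuts) auto
  then have "completion (cuts ?A ?lt) P lt (\<lambda>p. {q\<in>?A. ?lt q (e p)})"
    by (rule completion.reindex) (use e(1) ie in \<open>auto simp: bij_betw_def\<close>)
  then show ?thesis by blast
qed

lemma (in coded_order) coded_continuum_exists:
  fixes \<kappa> :: "'k rel" and \<mu> :: "'m rel"
  assumes \<kappa>: "Cinfinite \<kappa>" and P: "|P| \<le>o \<kappa>" and E: "\<kappa> \<le>o |{x\<in>E. ltE e0 x}|"
    and \<mu>: "Cinfinite \<mu>" "|Func N P| \<le>o \<mu>"
  shows "\<exists>(X :: 'k set set) b. coded_chain X ltI (I - {i0}) b S \<and>
    weight (chain_topology X) =o \<kappa> \<and> min_open_weight (chain_topology X) =o weight (chain_topology X) \<and>
    |Func N (EL - {bt})| \<le>o |X| \<and> |X| \<le>o \<mu>"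
proof -
  have "Card_order \<kappa>" using \<kappa> by blast
  from completion_exists[OF P_linear P_ne this P P_dense P_greater]
  obtain X :: "'k set set" and j where X: "completion X P ltP j" by blast
  interpret coded_completion N ltN E ltE EL bt e0 tp I ltI i0 S X j
    by (rule coded_completion.intro[OF coded_order_axioms X])
  show ?thesis
    by (rule exI[of _ X], rule exI[of _ "\<lambda>i. B (i, 0)"])
      (intro conjI coded weights_eq[OF \<kappa> P E] card_ge card_le[OF \<mu>])
qed

lemma ordLeq_diff_finite:
  fixes r :: "'r rel"
  assumes r: "Cinfinite r" "r \<le>o |A|" and F: "finite F"
  shows "r \<le>o |A - F|"
proof (rule ccontr)
  assume "\<not> r \<le>o |A - F|"
  moreover have "Well_order r" using r(1) by (auto simp: card_order_on_def)
  ultimately have "|A - F| <o r" using ordLess_or_ordLeq card_of_Well_order by blast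
  moreover have "natLeq \<le>o r" using r(1) natLeq_ordLeq_cinfinite by blast
  then have "|F| <o r" using F finite_iff_ordLess_natLeq ordLess_ordLeq_trans by blast
  ultimately have "|(A - F) \<union> F| <o r" using r(1) by (intro Un_Cinfinite_bound_strict)
  moreover have "|A| \<le>o |(A - F) \<union> F|" by (rule card_of_mono1) blast
  ultimately have "|A| <o r" using ordLeq_ordLess_trans by blast
  then show False using r(2) not_ordLess_ordLeq by blast
qed

context cardinal_pair
begin

lemma Field_\<kappa>: "|Field \<kappa>| =o \<kappa>" using \<kappa> card_of_Field_ordIso by blast

lemma Well_order_\<kappa>: "Well_order \<kappa>" and infinite_\<kappa>: "infinite (Field \<kappa>)" and Card_order_\<kappa>: "Card_order \<kappa>"
  using \<kappa> by (auto simp: cinfinite_def card_order_on_def)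

lemma least_ordinal: obtains i0 where "i0 \<in> Field \<kappa>" "\<forall>i\<in>Field \<kappa>. i \<noteq> i0 \<longrightarrow> strict \<kappa> i0 i"
proof -
  have "Field \<kappa> \<noteq> {}" using infinite_\<kappa> by (metis finite.emptyI)
  then obtain i0 where i0: "i0 \<in> Field \<kappa>" "\<forall>y. strict \<kappa> y i0 \<longrightarrow> y \<notin> Field \<kappa>"
    using strict_wf[OF Well_order_\<kappa>] unfolding wfp_on_iff_ex_minimal by blast
  note tot = strict_linear[OF Well_order_\<kappa>, THEN linear_on_total]
  have "strict \<kappa> i0 i" if "i \<in> Field \<kappa>" "i \<noteq> i0" for i using tot i0 that by blast
  then show ?thesis using that i0(1) by blast
qed

lemma lex_functions_exist:
  obtains ltE EL bt e0 tp where "lex_functions (Field \<nu>) (strict \<nu>) (Field \<kappa>) ltE EL bt e0 tp"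
    "|EL| \<le>o lam" "lam \<le>o |EL - {bt}|" "\<kappa> \<le>o |{x\<in>Field \<kappa>. ltE e0 x}|"
proof -
  obtain ltE bt e0 tp where E: "linear_on ltE (Field \<kappa>)" "wfp_on (Field \<kappa>) ltE"
    "bt \<in> Field \<kappa>" "e0 \<in> Field \<kappa>" "tp \<in> Field \<kappa>" "ltE bt e0" "ltE e0 tp"
    "\<forall>x\<in>Field \<kappa>. x \<noteq> bt \<longrightarrow> ltE bt x" "\<forall>x\<in>Field \<kappa>. x \<noteq> tp \<longrightarrow> ltE x tp"
    "\<forall>x\<in>Field \<kappa>. x \<noteq> bt \<longrightarrow> x \<noteq> e0 \<longrightarrow> ltE e0 x"
    using \<kappa> by (rule well_order_with_ends)
  have L: "|Field lam| =o lam" using lam card_of_Field_ordIso by blast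
  have "|Field lam| \<le>o |Field \<kappa>|" using le by (rule card_of_mono2)
  from iffD2[OF card_of_ordLeq this] obtain f where f: "inj_on f (Field lam)" "f ` Field lam \<subseteq> Field \<kappa>"
    by (elim exE conjE)
  let ?EL = "{bt, e0, tp} \<union> f ` Field lam"
  have "|f ` Field lam| \<le>o |Field lam|" by (rule card_of_image)
  then have 1: "|f ` Field lam| \<le>o lam" using L ordLeq_ordIso_trans by blast
  have "|{bt, e0, tp}| <o natLeq" using finite_iff_ordLess_natLeq by blast
  moreover have "natLeq \<le>o lam" using lam natLeq_ordLeq_cinfinite by blast
  ultimately have "|{bt, e0, tp}| \<le>o lam" using ordLess_imp_ordLeq ordLeq_transitive by blast
  then have upper: "|?EL| \<le>o lam" using 1 lam by (intro Un_Cinfinite_bound)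
  have "|Field lam| \<le>o |?EL|" using f(1) by (intro card_of_ordLeqI[of f]) auto
  then have "lam \<le>o |?EL|" using L ordIso_symmetric ordIso_ordLeq_trans by blast
  then have lower: "lam \<le>o |?EL - {bt}|" using lam by (intro ordLeq_diff_finite) auto
  have "\<kappa> \<le>o |Field \<kappa>|" using Field_\<kappa> ordIso_symmetric ordIso_imp_ordLeq by blast
  then have "\<kappa> \<le>o |Field \<kappa> - {bt, e0}|" using \<kappa> by (intro ordLeq_diff_finite) auto
  moreover have "|Field \<kappa> - {bt, e0}| \<le>o |{x\<in>Field \<kappa>. ltE e0 x}|" by (rule card_of_mono1) (use E(10) in blast)
  ultimately have above: "\<kappa> \<le>o |{x\<in>Field \<kappa>. ltE e0 x}|" by (rule ordLeq_transitive)
  have wo: "Well_order \<nu>" using nu_inf by (auto simp: card_order_on_def)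
  have "lex_functions (Field \<nu>) (strict \<nu>) (Field \<kappa>) ltE ?EL bt e0 tp"
  proof
    show "linear_on (strict \<nu>) (Field \<nu>)" by (rule strict_linear[OF wo])
    show "wfp_on (Field \<nu>) (strict \<nu>)" by (rule strict_wf[OF wo])
    show "\<exists>n\<in>Field \<nu>. \<forall>k\<in>K. strict \<nu> k n" if "K \<subseteq> Field \<nu>" "countable K" for K
      using that by (rule nu_uncountable_cofinality)
    show "?EL \<subseteq> Field \<kappa>" using E(3-5) f(2) by blast
  qed (use E in auto)
  then show ?thesis using upper lower above by (rule that)
qed

lemma coded_family_exists:
  assumes i0: "i0 \<in> Field \<kappa>" "\<forall>i\<in>Field \<kappa>. i \<noteq> i0 \<longrightarrow> strict \<kappa> i0 i"
  shows "\<exists>(X :: 'k set set) b. coded_chain X (strict \<kappa>) (Field \<kappa> - {i0}) b S \<and>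
    weight (chain_topology X) =o \<kappa> \<and> min_open_weight (chain_topology X) =o weight (chain_topology X) \<and>
    |X| =o lam ^c \<nu>"
proof -
  obtain ltE EL bt e0 tp where LF: "lex_functions (Field \<nu>) (strict \<nu>) (Field \<kappa>) ltE EL bt e0 tp"
    and size: "|EL| \<le>o lam" "lam \<le>o |EL - {bt}|" and above: "\<kappa> \<le>o |{x\<in>Field \<kappa>. ltE e0 x}|"
    by (rule lex_functions_exist)
  interpret lex_functions "Field \<nu>" "strict \<nu>" "Field \<kappa>" ltE EL bt e0 tp by (rule LF)
  interpret coded_order "Field \<nu>" "strict \<nu>" "Field \<kappa>" ltE EL bt e0 tp "Field \<kappa>" "strict \<kappa>" i0 S
  proof
    show "linear_on (strict \<kappa>) (Field \<kappa>)" by (rule strict_linear[OF Well_order_\<kappa>])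
    show "wfp_on (Field \<kappa>) (strict \<kappa>)" by (rule strict_wf[OF Well_order_\<kappa>])
    show "\<exists>i'\<in>Field \<kappa>. strict \<kappa> i i'" if "i \<in> Field \<kappa>" for i
      using infinite_Card_order_limit[OF Card_order_\<kappa> infinite_\<kappa> that] by blast
  qed (use i0 in auto)
  have F\<kappa>: "|Field \<kappa>| \<le>o \<kappa>" using Field_\<kappa> ordIso_imp_ordLeq by blast
  have N\<kappa>: "|Field \<nu>| \<le>o \<kappa>"
  proof -
    have "|Field \<nu>| =o \<nu>" using nu_inf card_of_Field_ordIso by blast
    then show ?thesis using nu_le_\<kappa> ordIso_ordLeq_trans by blast
  qed
  have Q\<kappa>: "|Q| \<le>o \<kappa>"
  proof (rule card_Q_le[OF \<kappa> N\<kappa>])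
    show "|Func {n\<in>Field \<nu>. strict \<nu> n d} EL| \<le>o \<kappa>" if "d \<in> Field \<nu>" for d
      by (rule Func_small_le[OF nu_initial[OF that] size(1)])
    show "|Func (UNIV :: nat set) (Field \<nu> \<times> Field \<kappa>)| \<le>o \<kappa>"
      by (rule Func_nat_le, rule card_of_Times_ordLeq_infinite_Field[OF infinite_\<kappa> N\<kappa> F\<kappa> Card_order_\<kappa>])
  qed
  have nat\<kappa>: "natLeq \<le>o \<kappa>" using \<kappa> natLeq_ordLeq_cinfinite by blast
  have "|UNIV :: (int \<times> int) set| \<le>o |UNIV :: nat set|"
    by (rule card_of_ordLeqI[of to_nat]) auto
  then have "|UNIV :: (int \<times> int) set| \<le>o \<kappa>"
    using card_of_nat nat\<kappa> ordLeq_ordIso_trans ordLeq_transitive by blast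
  then have "|Field \<kappa> \<times> (UNIV :: (int \<times> int) set)| \<le>o \<kappa>"
    by (rule card_of_Times_ordLeq_infinite_Field[OF infinite_\<kappa> F\<kappa> _ Card_order_\<kappa>])
  moreover have "|C| \<le>o |Field \<kappa> \<times> (UNIV :: (int \<times> int) set)|" by (rule card_of_mono1) (auto simp: C_def)
  ultimately have C\<kappa>: "|C| \<le>o \<kappa>" by (rule ordLeq_transitive[rotated])
  have P\<kappa>: "|P| \<le>o \<kappa>" by (rule card_of_Times_ordLeq_infinite_Field[OF infinite_\<kappa> C\<kappa> Q\<kappa> Card_order_\<kappa>])
  have co: "Card_order \<nu>" "Card_order lam" using nu_inf lam by auto
  have \<mu>: "Cinfinite (lam ^c \<nu>)"
    using ctwo_ordLeq_Cinfinite[OF lam] nu_inf by (rule Cinfinite_cexp)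
  have "|P| \<le>o lam ^c \<nu>" using P\<kappa> nu_gt ordLess_imp_ordLeq ordLeq_transitive by blast
  then have "|P| ^c \<nu> \<le>o (lam ^c \<nu>) ^c \<nu>" using co(1) by (rule cexp_mono1)
  moreover have "(lam ^c \<nu>) ^c \<nu> =o lam ^c \<nu>"
    by (rule cexp_cprod_ordLeq[OF co(2) nu_inf Cinfinite_Cnotzero[OF nu_inf] ordLeq_refl[OF co(1)]])
  ultimately have "|P| ^c \<nu> \<le>o lam ^c \<nu>" by (rule ordLeq_ordIso_trans)
  then have upper: "|Func (Field \<nu>) P| \<le>o lam ^c \<nu>" unfolding cexp_def Field_card_of .
  have "lam ^c \<nu> \<le>o |EL - {bt}| ^c \<nu>" using size(2) co(1) by (rule cexp_mono1)
  then have lower: "lam ^c \<nu> \<le>o |Func (Field \<nu>) (EL - {bt})|"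
    unfolding cexp_def[of "|EL - {bt}|"] Field_card_of .
  obtain X :: "'k set set" and b where X: "coded_chain X (strict \<kappa>) (Field \<kappa> - {i0}) b S"
    "weight (chain_topology X) =o \<kappa>" "min_open_weight (chain_topology X) =o weight (chain_topology X)"
    "|Func (Field \<nu>) (EL - {bt})| \<le>o |X|" "|X| \<le>o lam ^c \<nu>"
    using coded_continuum_exists[OF \<kappa> P\<kappa> above \<mu> upper] by blast
  have "|X| =o lam ^c \<nu>"
    using X(5) ordLeq_transitive[OF lower X(4)] by (simp add: ordIso_iff_ordLeq)
  then show ?thesis using X(1-3) by blast
qed

lemma card_Pow_minus_point: "|Pow (Field \<kappa> - {i0})| =o ctwo ^c \<kappa>"
proof -
  let ?A = "Field \<kappa> - {i0}"
  have "|?A| \<le>o |Field \<kappa>|" by (rule card_of_mono1) blast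
  then have "|?A| \<le>o \<kappa>" using Field_\<kappa> ordLeq_ordIso_trans by blast
  moreover have "\<kappa> \<le>o |Field \<kappa>|" using Field_\<kappa> ordIso_symmetric ordIso_imp_ordLeq by blast
  then have "\<kappa> \<le>o |?A|" using \<kappa> by (intro ordLeq_diff_finite) auto
  ultimately have "|?A| =o \<kappa>" by (simp add: ordIso_iff_ordLeq)
  then have "ctwo ^c |?A| =o ctwo ^c \<kappa>"
    using Card_order_ctwo Card_order_\<kappa> card_of_Card_order by (intro cexp_cong2) auto
  moreover have "ctwo ^c |?A| = |Func ?A (UNIV :: bool set)|" by (simp add: cexp_def ctwo_def Field_card_of)
  ultimately show ?thesis using card_of_Pow_Func ordIso_transitive by metis
qed

end

text \<open>
  The family is indexed by the sets \<open>S\<close> of ordinals below \<open>\<kappa>\<close> that omit the least one, whose copy in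
  the coded order has the special form that marks the beginning.
\<close>

theorem theorem8:
  fixes \<kappa> :: "'k rel" and lam :: "'l rel"
  assumes "Cinfinite \<kappa>" and "Cinfinite lam"
    and "lam \<le>o \<kappa>"
    and "\<kappa> ^c natLeq =o \<kappa>"
  shows "\<exists>(I :: 'k set set) (X :: 'k set \<Rightarrow> 'k set topology).
           |I| =o ctwo ^c \<kappa> \<and>
           incomparable I X \<and>
           (\<forall>i\<in>I. linearly_ordered_space (X i) \<and> continuum (X i) \<and>
              min_open_weight (X i) =o weight (X i) \<and> weight (X i) =o \<kappa> \<and>
              |topspace (X i)| =o lam ^c nu lam \<kappa>)"
proof -
  interpret cardinal_pair \<kappa> lam by unfold_locales (rule assms)+
  obtain i0 where i0: "i0 \<in> Field \<kappa>" "\<forall>i\<in>Field \<kappa>. i \<noteq> i0 \<longrightarrow> strict \<kappa> i0 i" by (rule least_ordinal)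
  let ?J = "Field \<kappa> - {i0}"
  have "\<forall>S. \<exists>X :: 'k set set. (\<exists>b. coded_chain X (strict \<kappa>) ?J b S) \<and>
    weight (chain_topology X) =o \<kappa> \<and> min_open_weight (chain_topology X) =o weight (chain_topology X) \<and>
    |X| =o lam ^c \<nu>"
    using coded_family_exists[OF i0] by blast
  from choice[OF this] obtain X :: "'k set \<Rightarrow> 'k set set" where
    X: "\<forall>S. (\<exists>b. coded_chain (X S) (strict \<kappa>) ?J b S) \<and>
    weight (chain_topology (X S)) =o \<kappa> \<and> min_open_weight (chain_topology (X S)) =o weight (chain_topology (X S)) \<and>
    |X S| =o lam ^c \<nu>" by (elim exE)
  have coded: "\<exists>b. coded_chain (X S) (strict \<kappa>) ?J b S" for S using X by blast
  then have dc: "dense_chain (X S)" for S using coded_chain.axioms(1) by blast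
  have wf: "wfp_on ?J (strict \<kappa>)"
    using strict_wf[OF Well_order_\<kappa>] by (rule wfp_on_subset) blast
  note tot = strict_linear[OF Well_order_\<kappa>, THEN linear_on_total]
  have total: "strict \<kappa> i j \<or> strict \<kappa> j i" if "i \<in> ?J" "j \<in> ?J" "i \<noteq> j" for i j
    by (rule tot) (use that in auto)
  obtain i1 i2 where i12: "i1 \<in> ?J" "i2 \<in> ?J" "strict \<kappa> i1 i2"
  proof -
    obtain i1 where i1: "i1 \<in> Field \<kappa>" "i0 \<noteq> i1 \<and> (i0, i1) \<in> \<kappa>"
      using infinite_Card_order_limit[OF Card_order_\<kappa> infinite_\<kappa> i0(1)] by blast
    obtain i2 where i2: "i2 \<in> Field \<kappa>" "i1 \<noteq> i2 \<and> (i1, i2) \<in> \<kappa>"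
      using infinite_Card_order_limit[OF Card_order_\<kappa> infinite_\<kappa> i1(1)] by blast
    have "antisym \<kappa>" using Well_order_\<kappa>
      unfolding well_order_on_def linear_order_on_def partial_order_on_def by blast
    then have "i2 \<noteq> i0" using i1 i2 by (auto dest: antisymD)
    then show thesis using that[of i1 i2] i1 i2 by blast
  qed
  have inc: "incomparable (Pow ?J) (\<lambda>S. chain_topology (X S))"
  proof (rule incomparable_chains)
    show "dense_chain (X S)" for S by (rule dc)
    fix S T f assume ST: "S \<in> Pow ?J" "T \<in> Pow ?J" "S \<noteq> T"
    obtain b c where bc: "coded_chain (X S) (strict \<kappa>) ?J b S" "coded_chain (X T) (strict \<kappa>) ?J c T"
      using coded by blast
    show "\<not> order_embeds (<) (X S) (>) (X T) f"
      by (rule coded_chain_not_embeds_decreasing[OF bc i12])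
    show "\<not> order_embeds (<) (X S) (<) (X T) f"
    proof
      assume f: "order_embeds (<) (X S) (<) (X T) f"
      have "S \<inter> ?J = T \<inter> ?J" by (rule coded_chain_embeds_imp_eq[OF bc wf total f])
      then show False using ST by blast
    qed
  qed
  have "linearly_ordered_space (chain_topology (X S)) \<and> continuum (chain_topology (X S)) \<and>
    min_open_weight (chain_topology (X S)) =o weight (chain_topology (X S)) \<and>
    weight (chain_topology (X S)) =o \<kappa> \<and> |topspace (chain_topology (X S))| =o lam ^c nu lam \<kappa>" for S
    using dense_chain.linearly_ordered[OF dc] dense_chain.continuum[OF dc] X by simp
  then show ?thesis
    using card_Pow_minus_point[of i0] inc
    by (intro exI[of _ "Pow ?J"] exI[of _ "\<lambda>S. chain_topology (X S)"] conjI ballI) simp_all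
qed

end
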